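(* Let $\theta>2$ and let $\nu$ be the Cantor-Lebesgue measure with constant dissection ratio $\theta$ constructed on $[0,1)\simeq S^1=\mathbb{R}/\mathbb{Z}$, i.e. the image of the Bernoulli convolution $\mu_\theta$ under the affine map $x\mapsto \frac{\theta-1}{2\theta}x+\frac12$, regarded as a probability measure on $S^1$. Then for every $p\in(1,\infty)$ the spectrum of the convolution operator $T_\nu: L^p(S^1)\to L^p(S^1)$, $T_\nu f=\nu*f$, is countable.
   Context: For $\theta>1$, the Bernoulli convolution $\mu_\theta$ is the Borel probability measure on $\mathbb{R}$ given by the infinite convolution product over $k\ge 0$ of the measures $\frac12\delta_{-\theta^{-k}}+\frac12\delta_{\theta^{-k}}$, where $\delta_x$ is the Dirac measure at $x$. Its Fourier transform is $\widehat{\mu_\theta}(t)=\prod_{k=0}^\infty\cos(2\pi\theta^{-k}t)$, $t\in\mathbb{R}$, and its support is contained in $[-\frac{\theta}{\theta-1},\frac{\theta}{\theta-1}]$. For $\theta>2$ its support is a Cantor set with constant dissection ratio $\theta$, and $\mu_\theta$ is called the Cantor-Lebesgue measure parameterized by $\theta$. The rescaled and translated measure $\nu$ has Fourier coefficients $(-1)^n\,\widehat{\mu_\theta}\bigl(\tfrac{\theta-1}{2\theta}n\bigr)$, $n\in\mathbb{Z}$. *)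

theory Defs
  imports "HOL-Probability.Probability"
begin

section \<open>Bernoulli convolutions\<close>

definition coin_measure :: "real \<Rightarrow> real measure" where
  "coin_measure a = distr (measure_pmf (bernoulli_pmf (1/2))) borel (\<lambda>b. if b then a else - a)"

lemma emeasure_coin_measure:
  assumes "A \<in> sets borel"
  shows "emeasure (coin_measure a) A =
           ennreal (1/2) * emeasure (return borel (- a)) A + ennreal (1/2) * emeasure (return borel a) A"
proof -
  have "emeasure (coin_measure a) A =
      emeasure (measure_pmf (bernoulli_pmf (1/2))) {b. (if b then a else - a) \<in> A}"
    unfolding coin_measure_def using assms by (subst emeasure_distr) (auto simp: vimage_def)
  also have "\<dots> = ennreal (\<Sum>b\<in>{b. (if b then a else - a) \<in> A}. pmf (bernoulli_pmf (1/2)) b)"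
    by (rule emeasure_measure_pmf_finite) simp
  also have "{b. (if b then a else - a) \<in> A} =
      (if a \<in> A then {True} else {}) \<union> (if - a \<in> A then {False} else {})"
    by (auto split: if_splits)
  finally show ?thesis
    using assms ennreal_plus[of "1/2" "1/2"]
    by (auto simp: emeasure_return indicator_def simp flip: ennreal_plus)
qed

primrec bernoulli_partial :: "real \<Rightarrow> nat \<Rightarrow> real measure" where
  "bernoulli_partial \<theta> 0 = return borel 0"
| "bernoulli_partial \<theta> (Suc n) = (bernoulli_partial \<theta> n \<star> coin_measure ((1 / \<theta>) ^ n))"

text \<open>The infinite convolution product is the weak limit of its partial products; for
  \<open>\<theta> > 1\<close> it exists, and weak limits are unique.\<close>

definition bernoulli_convolution :: "real \<Rightarrow> real measure" where
  "bernoulli_convolution \<theta> =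
     (THE \<mu>. real_distribution \<mu> \<and> weak_conv_m (bernoulli_partial \<theta>) \<mu>)"


section \<open>The circle\<close>

text \<open>The circle \<open>\<real>/\<int>\<close> is represented by the fundamental domain \<open>{0..<1}\<close>, with
  group operation \<open>(x, y) \<mapsto> frac (x + y)\<close>; \<open>circle\<close> carries the normalised Haar measure.\<close>

definition circle :: "real measure" where
  "circle = restrict_space lborel {0..<1}"

lemma space_circle: "space circle = {0..<1}"
  by (simp add: circle_def space_restrict_space)

lemma measurable_frac_circle: "frac \<in> borel \<rightarrow>\<^sub>M circle"
  unfolding circle_def
proof (rule measurable_restrict_space2)
  show "frac \<in> borel \<rightarrow>\<^sub>M (lborel :: real measure)"
    unfolding frac_def[abs_def] by measurable
qed (auto simp: frac_lt_1)

text \<open>For \<open>\<theta> > 2\<close> the affine image of the Bernoulli convolution lives on \<open>[0,1]\<close>;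
  \<open>frac\<close> is the projection to \<open>\<real>/\<int>\<close>.\<close>

definition cantor_lebesgue :: "real \<Rightarrow> real measure" where
  "cantor_lebesgue \<theta> =
     distr (bernoulli_convolution \<theta>) circle (\<lambda>x. frac ((\<theta> - 1) / (2 * \<theta>) * x + 1/2))"


section \<open>Classes of measurable functions on the circle\<close>

quotient_type circle_fun =
  "real \<Rightarrow> complex" / partial:
  "\<lambda>f g. f \<in> borel_measurable circle \<and> g \<in> borel_measurable circle \<and> (AE x in circle. f x = g x)"
proof (rule part_equivpI)
  show "\<exists>f. f \<in> borel_measurable circle \<and> f \<in> borel_measurable circle \<and>
      (AE x in circle. f x = (f x :: complex))"
    by (intro exI[of _ "\<lambda>_. 0"]) auto
qed (auto intro!: sympI transpI elim: AE_mp)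

instantiation circle_fun :: ab_group_add
begin

lift_definition zero_circle_fun :: circle_fun is "\<lambda>_. 0"
  by auto

lift_definition plus_circle_fun :: "circle_fun \<Rightarrow> circle_fun \<Rightarrow> circle_fun" is
  "\<lambda>f g x. f x + g x"
  by (auto elim: AE_mp)

lift_definition minus_circle_fun :: "circle_fun \<Rightarrow> circle_fun \<Rightarrow> circle_fun" is
  "\<lambda>f g x. f x - g x"
  by (auto elim: AE_mp)

lift_definition uminus_circle_fun :: "circle_fun \<Rightarrow> circle_fun" is "\<lambda>f x. - f x"
  by (auto elim: AE_mp)

instance
  by standard (transfer; auto simp: algebra_simps)+

end

lift_definition scale_circle_fun :: "complex \<Rightarrow> circle_fun \<Rightarrow> circle_fun" (infixr \<open>*\<^sub>c\<close> 75) is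
  "\<lambda>c f x. c * f x"
  by (auto elim: AE_mp)

interpretation circle_fun: vector_space scale_circle_fun
  by unfold_locales (transfer; auto simp: algebra_simps)+


section \<open>Lebesgue spaces and spectra of their operators\<close>

lift_definition in_Lp :: "real \<Rightarrow> circle_fun \<Rightarrow> bool" is
  "\<lambda>p f. integrable circle (\<lambda>x. norm (f x) powr p)"
  by (rule integrable_cong_AE) (auto elim!: AE_mp)

definition Lp :: "real \<Rightarrow> circle_fun set" where
  "Lp p = {F. in_Lp p F}"

lift_definition Lp_norm :: "real \<Rightarrow> circle_fun \<Rightarrow> real" is
  "\<lambda>p f. (integral\<^sup>L circle (\<lambda>x. norm (f x) powr p)) powr (1 / p)"
  by (rule arg_cong[of _ _ "\<lambda>I. I powr _"], rule integral_cong_AE) (auto elim!: AE_mp)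

text \<open>An operator on \<open>L\<^sup>p\<close> is a map on all of \<^typ>\<open>circle_fun\<close> of which only the
  restriction to \<^term>\<open>Lp p\<close> matters.\<close>

definition bounded_operator_Lp :: "real \<Rightarrow> (circle_fun \<Rightarrow> circle_fun) \<Rightarrow> bool" where
  "bounded_operator_Lp p T \<longleftrightarrow>
     (\<forall>F\<in>Lp p. T F \<in> Lp p) \<and>
     (\<forall>F\<in>Lp p. \<forall>G\<in>Lp p. T (F + G) = T F + T G) \<and>
     (\<forall>c. \<forall>F\<in>Lp p. T (c *\<^sub>c F) = c *\<^sub>c T F) \<and>
     (\<exists>C. \<forall>F\<in>Lp p. Lp_norm p (T F) \<le> C * Lp_norm p F)"

definition Lp_spectrum :: "real \<Rightarrow> (circle_fun \<Rightarrow> circle_fun) \<Rightarrow> complex set" where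
  "Lp_spectrum p T =
     {z. \<not> (\<exists>S. bounded_operator_Lp p S \<and>
          (\<forall>F\<in>Lp p. S (T F - z *\<^sub>c F) = F \<and> T (S F) - z *\<^sub>c S F = F))}"


section \<open>Convolution operators\<close>

text \<open>For a probability measure \<open>\<nu>\<close> the result does not depend on the representative chosen by
  \<^const>\<open>rep_circle_fun\<close>; see \<open>convolution_operator_abs\<close> below.\<close>

definition convolution_operator :: "real measure \<Rightarrow> circle_fun \<Rightarrow> circle_fun" where
  "convolution_operator \<nu> F =
     abs_circle_fun (\<lambda>x. integral\<^sup>L \<nu> (\<lambda>y. rep_circle_fun F (frac (x - y))))"

lemma AE_circle_iff: "(AE x in circle. P x) \<longleftrightarrow> (AE x in lborel. x \<in> {0..<1} \<longrightarrow> P x)"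
  unfolding circle_def by (rule AE_restrict_space_iff) auto

lemma AE_circle_rotate:
  assumes "AE x in circle. P x"
  shows "AE x in circle. P (frac (x - y))"
proof -
  have "AE x in lborel. x \<in> {0..<1} \<longrightarrow> P x"
    using assms by (simp add: AE_circle_iff)
  then obtain N where N: "N \<in> null_sets lborel" "{x. \<not> (x \<in> {0..<1} \<longrightarrow> P x)} \<subseteq> N"
    by (auto simp: eventually_ae_filter)
  have null: "(\<Union>k::int. {x. x - (y + of_int k) \<in> N}) \<in> null_sets lborel"
    by (intro null_sets_UN null_sets_translation N)
  have "AE x in lborel. P (frac (x - y))"
  proof (rule AE_I'[OF null], safe)
    fix x assume "\<not> P (frac (x - y))"
    then have "frac (x - y) \<in> N"
      using N(2) by (auto simp: frac_lt_1)
    then have "x - (y + of_int \<lfloor>x - y\<rfloor>) \<in> N"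
      by (simp add: frac_def algebra_simps)
    then show "x \<in> (\<Union>k::int. {x. x - (y + of_int k) \<in> N})"
      by blast
  qed
  then show ?thesis
    unfolding AE_circle_iff by (auto elim: AE_mp)
qed

lemma measurable_convolution_kernel:
  assumes "f \<in> borel_measurable circle" and "sets \<nu> = sets circle"
  shows "(\<lambda>(x, y). f (frac (x - y)) :: complex) \<in> borel_measurable (circle \<Otimes>\<^sub>M \<nu>)"
proof -
  have c: "(\<lambda>x. x) \<in> borel_measurable circle"
    unfolding circle_def by (rule measurable_restrict_space1) simp
  then have "(\<lambda>x. x) \<in> borel_measurable \<nu>"
    using assms(2) measurable_cong_sets by blast
  with c have "(\<lambda>z. fst z - snd z) \<in> borel_measurable (circle \<Otimes>\<^sub>M \<nu>)"
    by (intro borel_measurable_diff measurable_compose[OF measurable_fst]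
        measurable_compose[OF measurable_snd])
  then have "(\<lambda>z. f (frac (fst z - snd z))) \<in> borel_measurable (circle \<Otimes>\<^sub>M \<nu>)"
    by (intro measurable_compose[OF _ assms(1)] measurable_compose[OF _ measurable_frac_circle])
  then show ?thesis
    by (simp add: case_prod_beta')
qed

lemma sigma_finite_circle: "sigma_finite_measure circle"
  unfolding circle_def by (rule sigma_finite_measure_restrict_space) (auto intro: sigma_finite_lborel)

lemma convolution_respects:
  fixes f g :: "real \<Rightarrow> complex"
  assumes "prob_space \<nu>" and sets: "sets \<nu> = sets circle"
    and f: "f \<in> borel_measurable circle" and g: "g \<in> borel_measurable circle"
    and eq: "AE x in circle. f x = g x"
  shows "(\<lambda>x. integral\<^sup>L \<nu> (\<lambda>y. f (frac (x - y)))) \<in> borel_measurable circle"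
    and "AE x in circle. integral\<^sup>L \<nu> (\<lambda>y. f (frac (x - y))) = integral\<^sup>L \<nu> (\<lambda>y. g (frac (x - y)))"
proof -
  interpret \<nu>: prob_space \<nu> by fact
  interpret circle: sigma_finite_measure circle by (rule sigma_finite_circle)
  interpret pair_sigma_finite circle \<nu> ..
  note mf = measurable_convolution_kernel[OF f sets]
  note mg = measurable_convolution_kernel[OF g sets]
  show "(\<lambda>x. integral\<^sup>L \<nu> (\<lambda>y. f (frac (x - y)))) \<in> borel_measurable circle"
    using \<nu>.borel_measurable_lebesgue_integral[OF mf] .
  have meas: "Measurable.pred (circle \<Otimes>\<^sub>M \<nu>) (\<lambda>z. f (frac (fst z - snd z)) = g (frac (fst z - snd z)))"
    using mf mg unfolding case_prod_beta' by measurable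
  have "AE y in \<nu>. AE x in circle. f (frac (x - y)) = g (frac (x - y))"
    by (intro AE_I2 AE_circle_rotate eq)
  then have "AE x in circle. AE y in \<nu>. f (frac (x - y)) = g (frac (x - y))"
    using AE_commute[of "\<lambda>x y. f (frac (x - y)) = g (frac (x - y))"] meas
    by (auto simp: pred_def case_prod_beta')
  moreover have "(\<lambda>y. h (frac (x - y))) \<in> borel_measurable \<nu>"
    if "x \<in> space circle" "h \<in> borel_measurable circle" for x and h :: "real \<Rightarrow> complex"
    using measurable_Pair2[OF measurable_convolution_kernel[OF that(2) sets] that(1)] by simp
  ultimately show "AE x in circle. integral\<^sup>L \<nu> (\<lambda>y. f (frac (x - y))) = integral\<^sup>L \<nu> (\<lambda>y. g (frac (x - y)))"
    using f g by (auto intro!: integral_cong_AE elim!: AE_mp)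
qed

lemma convolution_operator_abs:
  fixes f :: "real \<Rightarrow> complex"
  assumes "prob_space \<nu>" "sets \<nu> = sets circle" "f \<in> borel_measurable circle"
  shows "convolution_operator \<nu> (abs_circle_fun f) =
           abs_circle_fun (\<lambda>x. integral\<^sup>L \<nu> (\<lambda>y. f (frac (x - y))))"
proof -
  define g where "g = rep_circle_fun (abs_circle_fun f)"
  have *: "f \<in> borel_measurable circle" "g \<in> borel_measurable circle" "AE x in circle. f x = g x"
    using Quotient3_rep_abs[OF Quotient3_circle_fun, of f] assms(3)
    by (auto simp: g_def elim: AE_mp)
  have **: "AE x in circle. g x = f x"
    using *(3) by (auto elim: AE_mp)
  show ?thesis
    unfolding convolution_operator_def g_def[symmetric]
    using convolution_respects[OF assms(1,2) *(2,1) **] convolution_respects[OF assms(1,2) *]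
    by (intro Quotient3_rel_abs[OF Quotient3_circle_fun]) auto
qed

end

theory Submission
  imports Defs "HOL-Computational_Algebra.Fundamental_Theorem_Algebra"
begin

text \<open>
  The Fourier coefficients of \<open>\<nu>\<close> are \<open>(-1)\<^sup>n \<Prod>k. cos (\<pi> (1 - 1/\<theta>) n / \<theta>\<^sup>k)\<close>. Two facts are combined.

  First, the closure of the set of coefficients is countable. If the product stays away from \<open>0\<close> along
  a sequence \<open>t = (1 - 1/\<theta>) n\<close>, then, up to bounded error, \<open>t\<close> is a sum of boundedly many terms
  \<open>\<lambda> \<theta>\<^sup>m\<close> with \<open>\<Sum>k. \<parallel>\<lambda> \<theta>\<^sup>k\<parallel>\<^sup>2 < \<infinity>\<close>. By a theorem of Pisot the distances \<open>\<parallel>\<lambda> \<theta>\<^sup>k\<parallel>\<close> are then even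
  summable, and there are only countably many such \<open>\<lambda>\<close>. So the limit of the products splits into
  factors depending on the \<open>\<lambda>\<close> and on the limit of the bounded error; the latter lies in a countable
  set because \<open>n\<close> is an integer and \<open>\<lambda> \<theta>\<^sup>m / (1 - 1/\<theta>)\<close> converges modulo \<open>1\<close>.

  Second, if the coefficients lie in a countable compact set \<open>K\<close>, then the spectrum on every \<open>L\<^sup>p\<close> is
  contained in \<open>K\<close>. A countable compact set has capacity zero, so for every \<open>\<epsilon> > 0\<close> there is a
  polynomial \<open>q\<close> with roots in \<open>K\<close> and \<open>\<bar>q\<bar> \<le> \<epsilon>\<^sup>d\<close> on \<open>K\<close>, \<open>d = deg q\<close>. The powers \<open>q(T)\<^sup>m\<close> are bounded by
  \<open>\<epsilon>\<^sup>d\<^sup>m\<close> on \<open>L\<^sup>2\<close> and by \<open>2\<^sup>d\<^sup>m\<close> on \<open>L\<^sup>1\<close> and \<open>L\<^sup>\<infinity>\<close>, hence by interpolation the spectral radius of \<open>q(T)\<close> on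
  \<open>L\<^sup>p\<close> is smaller than \<open>\<bar>q(z)\<bar>\<close> for a given \<open>z \<notin> K\<close>, and \<open>T - z\<close> divides the invertible \<open>q(T) - q(z)\<close>.
\<close>

section \<open>Square summable distances to the integers\<close>

text \<open>On \<open>L^2\<close> the characters diagonalise the operator, so its spectrum there is
  the closure of the coefficients. On other \<open>L^p\<close> the spectrum of a convolution
  operator can be strictly larger. This is why countability is used twice: as the conclusion of the
  first half and as the tool of the second. The first half meets a mismatch of exponents. A product
  of cosines bounded away from 0 controls only the squares of the distances to the integers, since 1
  - |cos| is quadratic near its zeros. Separating two scales inside such a product costs first
  powers, since |cos| is only Lipschitz at a general argument. Pisot's theorem closes this gap for
  every real \<theta> > 2: a pigeonhole argument makes the nearest integers satisfy a linear
  recurrence with integer coefficients, the errors inherit it, and a null sequence with such a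
  recurrence decays geometrically. In the second half real interpolation is as good as the sharp
  convexity theorem: its constant depends on \<open>p\<close> alone and disappears when m-th roots
  of the norms of q(T)^m are taken.\<close>

lemma sum_power_abs_le:
  fixes q :: real
  assumes "0 < q" "q < 1"
  shows "(\<Sum>z\<in>{- int D..int D}. q ^ nat \<bar>z\<bar>) \<le> (1 + q) / (1 - q)"
proof -
  have sub: "{- int D..int D} = int ` {..D} \<union> (\<lambda>k. - int (Suc k)) ` {..<D}"
    (is "?L = ?R")
  proof
    show "?L \<subseteq> ?R"
    proof
      fix z assume z: "z \<in> ?L"
      show "z \<in> ?R"
      proof (cases "z \<ge> 0")
        case True
        then have "z = int (nat z)" "nat z \<le> D" using z by auto
        then show ?thesis by blast
      next
        case False
        then have "z = - int (Suc (nat (- z - 1)))" "nat (- z - 1) < D" using z by auto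
        then show ?thesis by blast
      qed
    qed
  qed auto
  have "(\<Sum>z\<in>?L. q ^ nat \<bar>z\<bar>) = (\<Sum>z\<in>int ` {..D}. q ^ nat \<bar>z\<bar>) + (\<Sum>z\<in>(\<lambda>k. - int (Suc k)) ` {..<D}. q ^ nat \<bar>z\<bar>)"
    unfolding sub by (rule sum.union_disjoint) auto
  also have "(\<Sum>z\<in>int ` {..D}. q ^ nat \<bar>z\<bar>) = (\<Sum>k\<in>{..D}. q ^ k)"
    by (subst sum.reindex) (auto simp: inj_on_def)
  also have "(\<Sum>z\<in>(\<lambda>k. - int (Suc k)) ` {..<D}. q ^ nat \<bar>z\<bar>) = (\<Sum>k<D. q * q ^ k)"
    by (subst sum.reindex) (auto simp: inj_on_def nat_add_distrib intro!: sum.cong)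
  also have "(\<Sum>k<D. q * q ^ k) = q * (\<Sum>k<D. q ^ k)"
    by (simp add: sum_distrib_left)
  also have "(\<Sum>k\<in>{..D}. q ^ k) + q * (\<Sum>k<D. q ^ k) \<le> 1 / (1 - q) + q * (1 / (1 - q))"
  proof -
    have a: "(\<Sum>k<n. q ^ k) \<le> 1 / (1 - q)" for n
      using assms by (subst sum_gp_strict) (auto simp: divide_right_mono)
    have "(\<Sum>k\<in>{..D}. q ^ k) \<le> 1 / (1 - q)" using a[of "Suc D"] by (simp add: lessThan_Suc_atMost)
    then show ?thesis using a[of D] assms by (intro add_mono mult_left_mono) auto
  qed
  also have "\<dots> = (1 + q) / (1 - q)" by (simp add: add_divide_distrib)
  finally show ?thesis .
qed

text \<open>Rankin's trick: weight each vector by \<open>q\<close> to the power of its l1 norm. A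
  counted vector weighs at least \<open>q powr B\<close>, and the total weight factorises into one
  two-sided geometric series per coordinate. The bound is uniform in \<open>D\<close>, which only
  keeps the box finite.\<close>

lemma card_small_l1_vectors:
  fixes q B :: real
  assumes I: "finite I" and q: "0 < q" "q < 1"
  shows "card {d \<in> I \<rightarrow>\<^sub>E {- int D..int D}. real_of_int (\<Sum>i\<in>I. \<bar>d i\<bar>) \<le> B} * q powr B
     \<le> ((1 + q) / (1 - q)) ^ card I"
proof -
  let ?P = "I \<rightarrow>\<^sub>E {- int D..int D}"
  let ?S = "{d \<in> ?P. real_of_int (\<Sum>i\<in>I. \<bar>d i\<bar>) \<le> B}"
  have fP: "finite ?P" using I by (intro finite_PiE) auto
  have "card ?S * q powr B = (\<Sum>d\<in>?S. q powr B)" by simp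
  also have "\<dots> \<le> (\<Sum>d\<in>?S. \<Prod>i\<in>I. q ^ nat \<bar>d i\<bar>)"
  proof (rule sum_mono)
    fix d assume d: "d \<in> ?S"
    have "(\<Prod>i\<in>I. q ^ nat \<bar>d i\<bar>) = q ^ (\<Sum>i\<in>I. nat \<bar>d i\<bar>)" by (simp add: power_sum)
    also have "\<dots> = q powr real (\<Sum>i\<in>I. nat \<bar>d i\<bar>)" using q by (simp only: powr_realpow)
    also have "\<dots> \<ge> q powr B"
    proof -
      have "real (\<Sum>i\<in>I. nat \<bar>d i\<bar>) = real_of_int (\<Sum>i\<in>I. \<bar>d i\<bar>)" by (simp flip: of_int_abs)
      then have "real (\<Sum>i\<in>I. nat \<bar>d i\<bar>) \<le> B" using d by simp
      then show ?thesis using q by (simp add: powr_mono')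
    qed
    finally show "q powr B \<le> (\<Prod>i\<in>I. q ^ nat \<bar>d i\<bar>)" .
  qed
  also have "\<dots> \<le> (\<Sum>d\<in>?P. \<Prod>i\<in>I. q ^ nat \<bar>d i\<bar>)"
    using fP q by (intro sum_mono2) (auto intro!: prod_nonneg)
  also have "\<dots> = (\<Prod>i\<in>I. \<Sum>z\<in>{- int D..int D}. q ^ nat \<bar>z\<bar>)"
    using I by (subst prod_sum_PiE) auto
  also have "\<dots> \<le> (\<Prod>i\<in>I. (1 + q) / (1 - q))"
    using q by (intro prod_mono conjI sum_nonneg sum_power_abs_le) auto
  finally show ?thesis by simp
qed

text \<open>Second moment for independent coordinates, uniform on a symmetric interval: the mixed
  terms average to zero, and \<open>H\<^sup>2\<close> bounds the variance of a coordinate. So the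
  mean square of the linear form is at most \<open>H\<^sup>2\<close> times the sum of the
  \<open>(x i)\<^sup>2\<close>.\<close>

lemma sum_square_linear_form_le:
  fixes x :: "'i \<Rightarrow> real"
  assumes "finite I"
  shows "(\<Sum>c\<in>I \<rightarrow>\<^sub>E {- int H..int H}. (\<Sum>i\<in>I. c i * x i)\<^sup>2)
    \<le> (2 * real H + 1) ^ card I * (real H)\<^sup>2 * (\<Sum>i\<in>I. (x i)\<^sup>2)"
  using assms
proof (induction I rule: finite_induct)
  case empty
  then show ?case by simp
next
  case (insert j I)
  let ?A = "{- int H..int H}" and ?P = "I \<rightarrow>\<^sub>E {- int H..int H}"
  let ?L = "\<lambda>c. \<Sum>i\<in>I. of_int (c i) * x i"
  have fP: "finite ?P" using insert by (intro finite_PiE) auto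
  have cP: "card ?P = (2 * H + 1) ^ card I"
    using insert by (simp add: card_PiE nat_add_distrib nat_mult_distrib)
  have inj: "inj_on (\<lambda>(y, g). g(j := y)) (?A \<times> ?P)"
    by (rule inj_combinator) (use insert in auto)
  have sum0: "(\<Sum>z\<in>?A. real_of_int z) = 0"
  proof -
    have "(\<Sum>z\<in>?A. real_of_int z) = (\<Sum>z\<in>?A. real_of_int (- z))"
      by (rule sum.reindex_bij_witness[of _ uminus uminus]) auto
    then show ?thesis by (simp add: sum_negf)
  qed
  have "(\<Sum>c\<in>insert j I \<rightarrow>\<^sub>E ?A. (\<Sum>i\<in>insert j I. c i * x i)\<^sup>2)
      = (\<Sum>(z, c)\<in>?A \<times> ?P. (of_int z * x j + ?L c)\<^sup>2)"
    unfolding PiE_insert_eq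
    apply (subst sum.reindex[OF inj])
    apply (rule sum.cong[OF refl])
    using insert
    by (auto simp: case_prod_beta' intro!: arg_cong[where f="\<lambda>t. t\<^sup>2"] sum.cong)
  also have "\<dots> = (\<Sum>z\<in>?A. \<Sum>c\<in>?P. (of_int z * x j)\<^sup>2 + real_of_int z * (2 * x j * ?L c) + (?L c)\<^sup>2)"
    by (subst sum.cartesian_product[symmetric]) (simp add: power2_sum algebra_simps)
  also have "\<dots> = (\<Sum>z\<in>?A. \<Sum>c\<in>?P. (of_int z * x j)\<^sup>2)
      + (\<Sum>z\<in>?A. real_of_int z) * (\<Sum>c\<in>?P. 2 * x j * ?L c) + (\<Sum>z\<in>?A. \<Sum>c\<in>?P. (?L c)\<^sup>2)"
    by (simp add: sum.distrib sum_product)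
  also have "\<dots> = (\<Sum>z\<in>?A. \<Sum>c\<in>?P. (of_int z * x j)\<^sup>2) + (2 * real H + 1) * (\<Sum>c\<in>?P. (?L c)\<^sup>2)"
    by (simp add: sum0 nat_add_distrib)
  also have "\<dots> \<le> (\<Sum>z\<in>?A. \<Sum>c\<in>?P. (real H)\<^sup>2 * (x j)\<^sup>2) + (2 * real H + 1) * 
      ((2 * real H + 1) ^ card I * (real H)\<^sup>2 * (\<Sum>i\<in>I. (x i)\<^sup>2))"
  proof (intro add_mono sum_mono mult_left_mono insert)
    fix z assume "z \<in> ?A"
    then have "\<bar>real_of_int z\<bar> \<le> real H" by auto
    then have "(real_of_int z)\<^sup>2 \<le> (real H)\<^sup>2" by (simp add: abs_le_square_iff[symmetric])
    then show "(of_int z * x j)\<^sup>2 \<le> (real H)\<^sup>2 * (x j)\<^sup>2"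
      by (simp add: power_mult_distrib mult_right_mono)
  qed auto
  also have "\<dots> = (2 * real H + 1) ^ card (insert j I) * (real H)\<^sup>2 * (\<Sum>i\<in>insert j I. (x i)\<^sup>2)"
    using insert by (simp add: cP nat_add_distrib algebra_simps)
  finally show ?case .
qed

text \<open>A sequence of integers is recovered from its first term and its corrections to
  \<open>round (\<theta> * u k)\<close>. Hence counting first terms and lists of corrections counts
  windows.\<close>

lemma eq_if_rounding_eq:
  fixes u v :: "nat \<Rightarrow> int" and \<theta> :: real
  assumes "u 0 = v 0"
    and "\<And>k. k < s \<Longrightarrow> u (Suc k) - round (\<theta> * u k) = v (Suc k) - round (\<theta> * v k)"
  shows "k \<le> s \<Longrightarrow> u k = v k"
proof (induction k)
  case 0 then show ?case using assms by simp
next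
  case (Suc k)
  then have "u k = v k" by simp
  then show ?case using assms(2)[of k] Suc by simp
qed

text \<open>If \<open>m\<close> is not the nearest integer, then the integer
  \<open>m - round x\<close> is at most twice as large as \<open>m - x\<close>, and being nonzero it
  is bounded by its own square. A mean square bound thereby becomes an l1 bound, which leaves few
  choices for the corrections.\<close>

lemma abs_round_le_square:
  fixes x :: real and m :: int
  shows "\<bar>real_of_int m - round x\<bar> \<le> 4 * (m - x)\<^sup>2"
proof -
  define d where "d = m - round x"
  have r: "\<bar>of_int (round x) - x\<bar> \<le> 1/2" by (rule of_int_round_abs_le)
  show ?thesis
  proof (cases "d = 0")
    case True then show ?thesis by (simp add: d_def)
  next
    case False
    then have d1: "1 \<le> \<bar>real_of_int d\<bar>" by linarith
    have "\<bar>real_of_int d\<bar> \<le> 2 * \<bar>m - x\<bar>" using r d1 unfolding d_def of_int_diff by (simp add: abs_if split: if_splits)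
    then have "\<bar>real_of_int d\<bar>\<^sup>2 \<le> (2 * \<bar>m - x\<bar>)\<^sup>2" by (intro power_mono) auto
    moreover have "\<bar>real_of_int d\<bar> \<le> \<bar>real_of_int d\<bar>\<^sup>2" using mult_right_mono[OF d1, of "\<bar>real_of_int d\<bar>"] by (simp add: power2_eq_square)
    ultimately show ?thesis by (simp add: d_def power_mult_distrib)
  qed
qed

text \<open>A pigeonhole argument: among the integer vectors \<open>c\<close> with entries bounded by \<open>H\<close>, at least half
  produce sequences \<open>u\<close> whose defects \<open>u (k + 1) - round (\<theta> * u k)\<close> are so small in mean square that there
  are fewer possible windows of \<open>u\<close> than vectors \<open>c\<close>.\<close>

lemma annihilated_window:
  fixes a :: "nat \<Rightarrow> int" and \<theta> \<tau> :: real and H n :: nat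
  defines "\<delta> \<equiv> \<lambda>k. real_of_int (a (Suc k)) - \<theta> * a k"
  assumes \<theta>: "2 \<le> \<theta>" and H: "8 * \<theta> \<le> 2 * real H + 1"
    and \<tau>: "0 < \<tau>" "264 * (real H)\<^sup>2 * \<tau> \<le> 1"
    and small: "\<And>k n. (\<Sum>i\<le>n. (\<delta> (k + i))\<^sup>2) \<le> \<tau>"
    and n: "3 * (\<bar>real_of_int (a 0)\<bar> + 1) \<le> 2 ^ n"
  shows "\<exists>c::nat \<Rightarrow> int. (\<exists>i\<le>n. c i \<noteq> 0) \<and> (\<forall>k\<le>3 * n. (\<Sum>i\<le>n. c i * a (k + i)) = 0)"
proof -
  define A where "A = \<bar>real_of_int (a 0)\<bar> + 1"
  define C where "C = {..n} \<rightarrow>\<^sub>E {- int H..int H}"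
  define u where "u = (\<lambda>c k. \<Sum>i\<le>n. c i * a (k + i))"
  define L where "L = (\<lambda>(c::nat \<Rightarrow> int) k. \<Sum>i\<le>n. c i * \<delta> (k + i))"
  \<comment> \<open>Three window lengths, because \<open>recurrence_of_windows\<close> composes two
    annihilators: it consumes \<open>2 * n\<close> shifts and, in addition, the order of the shorter
    one, which is at most \<open>n\<close>.\<close>
  define s where "s = 3 * n"
  define d where "d = (\<lambda>c. \<lambda>k\<in>{..<s}. u c (Suc k) - round (\<theta> * real_of_int (u c k)))"
  \<comment> \<open>Twice the bound for the mean of the sum of squares, so by Markov's inequality at
    most half of the vectors exceed \<open>M\<close>.\<close>
  define M where "M = 2 * (real s * (real H)\<^sup>2 * \<tau>)"
  define G where "G = {c \<in> C. (\<Sum>k<s. (L c k)\<^sup>2) \<le> M}"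
  have H1: "H \<ge> 1" using H \<theta> by linarith
  have npos: "n > 0" using n by (cases n) auto
  have fC: "finite C" unfolding C_def by (intro finite_PiE) auto
  have cC: "real (card C) = (2 * real H + 1) ^ (n + 1)"
    unfolding C_def by (simp add: card_PiE nat_add_distrib nat_mult_distrib algebra_simps)
  have uL: "u c (Suc k) - \<theta> * u c k = L c k" for c k
    by (simp add: u_def L_def \<delta>_def sum_distrib_left sum_subtractf[symmetric] algebra_simps)
  have Mpos: "M > 0" using npos H1 \<tau> by (simp add: M_def s_def)
  have "(\<Sum>c\<in>C. \<Sum>k<s. (L c k)\<^sup>2) = (\<Sum>k<s. \<Sum>c\<in>C. (L c k)\<^sup>2)" by (rule sum.swap)
  also have "\<dots> \<le> (\<Sum>k<s. (2 * real H + 1) ^ (n + 1) * (real H)\<^sup>2 * \<tau>)"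
  proof (rule sum_mono)
    fix k
    have "(\<Sum>c\<in>C. (L c k)\<^sup>2) \<le> (2 * real H + 1) ^ card {..n} * (real H)\<^sup>2 * (\<Sum>i\<le>n. (\<delta> (k + i))\<^sup>2)"
      unfolding C_def L_def by (rule sum_square_linear_form_le) simp
    also have "\<dots> \<le> (2 * real H + 1) ^ (n + 1) * (real H)\<^sup>2 * \<tau>"
      using small[where k=k and n=n] by (simp add: mult_left_mono)
    finally show "(\<Sum>c\<in>C. (L c k)\<^sup>2) \<le> (2 * real H + 1) ^ (n + 1) * (real H)\<^sup>2 * \<tau>" .
  qed
  also have "\<dots> = real (card C) * M / 2" by (simp add: cC M_def)
  finally have mom: "(\<Sum>c\<in>C. \<Sum>k<s. (L c k)\<^sup>2) \<le> real (card C) * M / 2" .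
  have "real (card (C - G)) * M = (\<Sum>c\<in>C - G. M)" by simp
  also have "\<dots> \<le> (\<Sum>c\<in>C - G. \<Sum>k<s. (L c k)\<^sup>2)"
    by (intro sum_mono) (auto simp: G_def)
  also have "\<dots> \<le> (\<Sum>c\<in>C. \<Sum>k<s. (L c k)\<^sup>2)"
    using fC by (intro sum_mono2) (auto intro!: sum_nonneg)
  finally have "real (card (C - G)) * M \<le> real (card C) / 2 * M" using mom by simp
  then have "real (card (C - G)) \<le> real (card C) / 2" using Mpos
    by (rule mult_right_le_imp_le)
  moreover have "real (card (C - G)) = real (card C) - real (card G)"
    using fC by (subst card_Diff_subset) (auto simp: G_def card_mono of_nat_diff intro: finite_subset)
  ultimately have cG: "real (card G) \<ge> real (card C) / 2" by linarith
  have fG: "finite G" using fC by (simp add: G_def)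
  have d1: "\<bar>\<delta> k\<bar> \<le> 1" for k
  proof -
    have "1 \<le> (real H)\<^sup>2" using H1 by simp
    then have "1 * \<tau> \<le> (real H)\<^sup>2 * \<tau>" using \<tau> by (intro mult_right_mono) auto
    then have "\<tau> \<le> (real H)\<^sup>2 * \<tau>" by simp
    moreover have "264 * ((real H)\<^sup>2 * \<tau>) \<le> 1" using \<tau>(2) by simp
    moreover have "(\<delta> k)\<^sup>2 \<le> \<tau>" using small[where k=k and n=0] by simp
    ultimately have "(\<delta> k)\<^sup>2 \<le> 1" by linarith
    then show ?thesis by (simp add: abs_square_le_1)
  qed
  \<comment> \<open>The summand 1 on the left absorbs the defect:
    \<open>\<theta> * x + 2 \<le> \<theta> * (x + 1)\<close> because
    \<open>2 \<le> \<theta>\<close>.\<close>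
  have a_le: "\<bar>real_of_int (a k)\<bar> + 1 \<le> A * \<theta> ^ k" for k
  proof (induction k)
    case (Suc k)
    have "\<bar>real_of_int (a (Suc k))\<bar> \<le> \<theta> * \<bar>real_of_int (a k)\<bar> + 1"
    proof -
      have "real_of_int (a (Suc k)) = \<theta> * a k + \<delta> k" by (simp add: \<delta>_def)
      moreover have "\<bar>\<theta> * a k\<bar> = \<theta> * \<bar>real_of_int (a k)\<bar>" using \<theta> by (simp add: abs_mult)
      ultimately show ?thesis using d1[of k] by linarith
    qed
    then have "\<bar>real_of_int (a (Suc k))\<bar> + 1 \<le> \<theta> * (\<bar>real_of_int (a k)\<bar> + 1)"
      using \<theta> by (simp add: algebra_simps)
    also have "\<dots> \<le> \<theta> * (A * \<theta> ^ k)" using Suc \<theta> by (intro mult_left_mono) auto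
    finally show ?case by (simp add: algebra_simps)
  qed (simp add: A_def)
  define U where "U = nat \<lfloor>real H * (real n + 1) * A * \<theta> ^ n\<rfloor>"
  have A1: "A \<ge> 1" by (simp add: A_def)
  have tn1: "\<theta> ^ n \<ge> 1" using \<theta> by (simp add: one_le_power)
  have big1: "1 \<le> real H * (real n + 1) * A * \<theta> ^ n"
    using mult_mono[OF mult_mono[OF mult_mono[of 1 "real H" 1 "real n + 1"] A1] tn1] H1 A1 by simp
  have u0: "u c 0 \<in> {- int U..int U}" if "c \<in> C" for c
  proof -
    have "\<bar>real_of_int (u c 0)\<bar> \<le> (\<Sum>i\<le>n. \<bar>real_of_int (c i) * a i\<bar>)"
      unfolding u_def by (simp add: sum_abs)
    also have "\<dots> \<le> (\<Sum>i\<le>n. real H * (A * \<theta> ^ n))"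
    proof (rule sum_mono)
      fix i assume i: "i \<in> {..n}"
      have "\<bar>real_of_int (c i)\<bar> \<le> real H" using that i by (force simp: C_def PiE_iff)
      moreover have "\<bar>real_of_int (a i)\<bar> \<le> A * \<theta> ^ n"
      proof -
        have "A * \<theta> ^ i \<le> A * \<theta> ^ n" using i \<theta> A1 by (intro mult_left_mono power_increasing) auto
        then show ?thesis using a_le[of i] by linarith
      qed
      ultimately show "\<bar>real_of_int (c i) * a i\<bar> \<le> real H * (A * \<theta> ^ n)"
        unfolding abs_mult by (intro mult_mono) auto
    qed
    also have "\<dots> = real H * (real n + 1) * A * \<theta> ^ n" by (simp add: algebra_simps)
    finally have "\<bar>real_of_int (u c 0)\<bar> \<le> real H * (real n + 1) * A * \<theta> ^ n" .
    then have "\<bar>u c 0\<bar> \<le> \<lfloor>real H * (real n + 1) * A * \<theta> ^ n\<rfloor>"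
      by (simp add: le_floor_iff)
    moreover have "int U = \<lfloor>real H * (real n + 1) * A * \<theta> ^ n\<rfloor>"
      unfolding U_def using big1 by (subst int_nat_eq) (simp add: le_floor_iff)
    ultimately show ?thesis by auto
  qed
  have cU: "real (card {- int U..int U}) \<le> 3 * (real H * (real n + 1) * A * \<theta> ^ n)"
  proof -
    have "real U \<le> real H * (real n + 1) * A * \<theta> ^ n"
      unfolding U_def using big1 by (simp add: of_nat_nat)
    then show ?thesis using big1 by (simp add: nat_add_distrib)
  qed
  \<comment> \<open>Any common bound will do, since the count of l1 bounded vectors is uniform in
    it.\<close>
  obtain D where D: "\<And>c k. c \<in> C \<Longrightarrow> k < s \<Longrightarrow> \<bar>d c k\<bar> \<le> int D"
  proof
    fix c k assume "c \<in> C" "k < s"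
    then have "\<bar>d c k\<bar> \<in> (\<lambda>(c, k). \<bar>d c k\<bar>) ` (C \<times> {..<s})" by auto
    then have "\<bar>d c k\<bar> \<le> Max ((\<lambda>(c, k). \<bar>d c k\<bar>) ` (C \<times> {..<s}))"
      using fC by (intro Max_ge) auto
    then show "\<bar>d c k\<bar> \<le> int (nat (Max ((\<lambda>(c, k). \<bar>d c k\<bar>) ` (C \<times> {..<s}))))" by linarith
  qed
  define S where "S = {d \<in> {..<s} \<rightarrow>\<^sub>E {- int D..int D}. real_of_int (\<Sum>i\<in>{..<s}. \<bar>d i\<bar>) \<le> 4 * M}"
  have fS: "finite S" unfolding S_def by (rule finite_subset[OF _ finite_PiE[of "{..<s}" "\<lambda>_. {- int D..int D}"]]) auto
  have dS: "d c \<in> S" if c: "c \<in> G" for c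
  proof -
    have "real_of_int (\<Sum>k<s. \<bar>d c k\<bar>) \<le> (\<Sum>k<s. 4 * (L c k)\<^sup>2)"
      unfolding of_int_sum
    proof (rule sum_mono)
      fix k assume "k \<in> {..<s}"
      then show "real_of_int \<bar>d c k\<bar> \<le> 4 * (L c k)\<^sup>2"
        using abs_round_le_square[of "u c (Suc k)" "\<theta> * u c k"] by (simp add: d_def uL)
    qed
    also have "\<dots> \<le> 4 * M" using c by (simp add: G_def sum_distrib_left[symmetric])
    finally have "real_of_int (\<Sum>k<s. \<bar>d c k\<bar>) \<le> 4 * M" .
    moreover have "d c \<in> {..<s} \<rightarrow>\<^sub>E {- int D..int D}"
    proof (rule PiE_I)
      fix k assume "k \<in> {..<s}"
      then show "d c k \<in> {- int D..int D}" using D[of c k] c by (auto simp: G_def)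
    qed (simp add: d_def)
    ultimately show ?thesis by (simp add: S_def)
  qed
  \<comment> \<open>Count with \<open>q = 1/20\<close>. Each of the \<open>3 * n\<close> coordinates
    costs 21/19, and \<open>(21/19)^3 \<le> 3/2\<close>. The exponent \<open>4 * M\<close> equals
    \<open>24 * n * H\<^sup>2 * \<tau>\<close>, at most \<open>n / 11\<close> (whence 264 = 24 *
    11), and \<open>(3/4)^11 \<le> 1/20\<close> makes the weight at least \<open>(3/4)^n\<close>.
    The quotient of 3/2 and 3/4 is the base 2.\<close>
  have cS: "real (card S) \<le> 2 ^ n"
  proof -
    have M4: "4 * M \<le> real n / 11"
    proof -
      have "4 * M = real n * (264 * (real H)\<^sup>2 * \<tau>) / 11" by (simp add: M_def s_def)
      also have "\<dots> \<le> real n * 1 / 11" using \<tau> by (intro divide_right_mono mult_left_mono) auto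
      finally show ?thesis by simp
    qed
    have e: "real (card S) * (1/20) powr (4 * M) \<le> (21/19) ^ s"
      using card_small_l1_vectors[of "{..<s}" "1/20" D "4 * M"] by (simp add: S_def)
    have p: "(1/20) powr (4 * M) \<ge> (3/4::real) ^ n"
    proof -
      have "(3/4::real) powr (11 * (real n / 11)) = ((3/4) powr 11) powr (real n / 11)"
        by (rule powr_powr[symmetric])
      then have "(3/4::real) ^ n = ((3/4) powr 11) powr (real n / 11)"
        by (simp add: powr_realpow del: powr_numeral)
      also have "(3/4::real) powr 11 = (3/4) ^ 11" by (rule powr_numeral) simp
      also have "((3/4::real) ^ 11) powr (real n / 11) \<le> (1/20) powr (real n / 11)"
        by (intro powr_mono2) (auto simp: power_divide)
      also have "\<dots> \<le> (1/20) powr (4 * M)" using M4 by (intro powr_mono') auto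
      finally show ?thesis .
    qed
    have "real (card S) * (3/4) ^ n \<le> (21/19) ^ s"
      using e mult_left_mono[OF p, of "real (card S)"] by linarith
    also have "(21/19::real) ^ s = ((21/19) ^ 3) ^ n" by (simp add: s_def power_mult)
    also have "\<dots> \<le> (3/2) ^ n" by (intro power_mono) (auto simp: power3_eq_cube)
    finally have "real (card S) * (3/4) ^ n \<le> 2 ^ n * (3/4) ^ n"
      by (simp add: power_mult_distrib[symmetric])
    then show ?thesis by simp
  qed
  \<comment> \<open>Windows against vectors: \<open>3 * A\<close> and \<open>n + 1\<close> are each
    at most \<open>2 ^ n\<close>, another \<open>2 ^ n\<close> comes from \<open>S\<close>, and the
    range of the first term contributes \<open>\<theta> ^ n\<close>; together
    \<open>(8 * \<theta>) ^ n\<close>. This is the origin of the lower bound on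
    \<open>H\<close>.\<close>
  have lt: "3 * (real H * (real n + 1) * A * \<theta> ^ n) * 2 ^ n < real (card C) / 2"
  proof -
    have "3 * (real H * (real n + 1) * A * \<theta> ^ n) * 2 ^ n = (3 * A) * (real n + 1) * real H * (2 * \<theta>) ^ n"
      by (simp add: power_mult_distrib)
    also have "\<dots> \<le> 2 ^ n * 2 ^ n * real H * (2 * \<theta>) ^ n"
    proof -
      have "n + 1 \<le> 2 ^ n" by (simp add: Suc_leI)
      then have "real (n + 1) \<le> real (2 ^ n)" by (simp only: of_nat_le_iff)
      then have "real n + 1 \<le> 2 ^ n" by simp
      then have "(3 * A) * (real n + 1) \<le> 2 ^ n * 2 ^ n" using n unfolding A_def by (intro mult_mono) auto
      then show ?thesis using \<theta> by (intro mult_right_mono) auto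
    qed
    also have "\<dots> = real H * (8 * \<theta>) ^ n"
    proof -
      have "8 * \<theta> = 2 * 2 * (2 * \<theta>)" by simp
      then show ?thesis by (simp only: power_mult_distrib mult_ac)
    qed
    also have "\<dots> \<le> real H * (2 * real H + 1) ^ n" using H \<theta> by (intro mult_left_mono power_mono) auto
    also have "\<dots> < (2 * real H + 1) / 2 * (2 * real H + 1) ^ n" by (intro mult_strict_right_mono) auto
    finally show ?thesis by (simp add: cC)
  qed
  \<comment> \<open>Two good vectors with the same first term and corrections give the same window;
    their difference is the annihilator.\<close>
  define \<Phi> where "\<Phi> = (\<lambda>c. (u c 0, d c))"
  have "card (\<Phi> ` G) \<le> card ({- int U..int U} \<times> S)"
    using u0 dS fS by (intro card_mono) (auto simp: \<Phi>_def G_def)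
  then have "real (card (\<Phi> ` G)) \<le> real (card {- int U..int U}) * real (card S)"
    unfolding card_cartesian_product of_nat_mult[symmetric] of_nat_le_iff .
  also have "\<dots> \<le> 3 * (real H * (real n + 1) * A * \<theta> ^ n) * 2 ^ n"
    using cU cS big1 by (intro mult_mono) auto
  also have "\<dots> < real (card G)" using lt cG by linarith
  finally have "\<not> inj_on \<Phi> G" using fG by (auto dest: card_image)
  then obtain c c' where cc: "c \<in> G" "c' \<in> G" "c \<noteq> c'" "\<Phi> c = \<Phi> c'" by (auto simp: inj_on_def)
  have eq: "u c k = u c' k" if "k \<le> s" for k
  proof (rule eq_if_rounding_eq[where u = "u c" and v = "u c'" and \<theta> = \<theta>, OF _ _ that])
    show "u c 0 = u c' 0" using cc by (simp add: \<Phi>_def)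
    fix k assume k: "k < s"
    have "d c = d c'" using cc by (simp add: \<Phi>_def)
    then have "d c k = d c' k" by simp
    then show "u c (Suc k) - round (\<theta> * u c k) = u c' (Suc k) - round (\<theta> * u c' k)"
      using k by (simp add: d_def)
  qed
  show ?thesis
  proof (intro exI[of _ "\<lambda>i. c i - c' i"] conjI allI impI)
    show "\<exists>i\<le>n. c i - c' i \<noteq> 0"
    proof (rule ccontr)
      assume "\<not> (\<exists>i\<le>n. c i - c' i \<noteq> 0)"
      then have "c = c'" using cc(1,2) by (intro PiE_ext[of c "{..n}" "\<lambda>_. {- int H..int H}" c']) (auto simp: G_def C_def)
      then show False using cc(3) by simp
    qed
    fix k assume "k \<le> 3 * n"
    then show "(\<Sum>i\<le>n. (c i - c' i) * a (k + i)) = 0"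
      using eq[of k] by (simp add: u_def s_def algebra_simps sum_subtractf)
  qed
qed

section \<open>Null sequences whose image under a polynomial in the shift decays
  geometrically\<close>

definition geometric_decay :: "(nat \<Rightarrow> complex) \<Rightarrow> bool" where
  "geometric_decay f \<longleftrightarrow> (\<exists>C r. 0 < r \<and> r < 1 \<and> (\<forall>k. norm (f k) \<le> C * r ^ k))"

lemma geometric_decayI:
  assumes "0 < r" "r < 1" "\<And>k. norm (f k) \<le> C * r ^ k" shows "geometric_decay f"
  unfolding geometric_decay_def using assms by blast

lemma geometric_decay_imp_summable_norm:
  assumes "geometric_decay f" shows "summable (\<lambda>k. norm (f k))"
proof -
  obtain C r where r: "0 < r" "r < 1" "\<And>k. norm (f k) \<le> C * r ^ k"
    using assms by (auto simp: geometric_decay_def)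
  have "summable (\<lambda>k. C * r ^ k)" using r by (intro summable_mult summable_geometric) auto
  then show ?thesis
    by (rule summable_comparison_test') (use r in auto)
qed

text \<open>If \<open>\<alpha>\<close> is contracting, the recursion is solved forwards, with a rate
  above both \<open>norm \<alpha>\<close> and \<open>r\<close>. Otherwise it is solved backwards
  from infinity: \<open>g k\<close> is bounded by \<open>g (m + k)\<close> plus a geometric sum, and
  the former tends to 0. In this case \<open>lim\<close> is what rules out the homogeneous
  solution.\<close>

lemma geometric_decay_first_order:
  fixes g :: "nat \<Rightarrow> complex"
  assumes lim: "g \<longlonglongrightarrow> 0" and f: "geometric_decay (\<lambda>k. g (Suc k) - \<alpha> * g k)"
  shows "geometric_decay g"
proof -
  obtain C r where r: "0 < r" "r < 1" and C: "\<And>k. norm (g (Suc k) - \<alpha> * g k) \<le> C * r ^ k"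
    using f by (auto simp: geometric_decay_def)
  have C0: "C \<ge> 0" using C[of 0] norm_ge_zero[of "g (Suc 0) - \<alpha> * g 0"] by (simp del: norm_ge_zero)
  show ?thesis
  proof (cases "norm \<alpha> < 1")
    case True
    define \<rho> where "\<rho> = max (norm \<alpha>) r"
    \<comment> \<open>Strictly larger than \<open>\<rho>\<close>, so that the resonant case
      \<open>norm \<alpha> = r\<close>, where a factor \<open>k\<close> would appear, needs no
      separate treatment.\<close>
    define s where "s = (1 + \<rho>) / 2"
    have s: "\<rho> < s" "s < 1" "0 < s" "\<rho> > 0" using True r by (auto simp: \<rho>_def s_def)
    define D where "D = norm (g 0) + C / (s - \<rho>)"
    have D: "\<rho> * D + C \<le> D * s" 
    proof -
      have "C = C / (s - \<rho>) * (s - \<rho>)" using s by simp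
      also have "\<dots> \<le> D * (s - \<rho>)" using s by (intro mult_right_mono) (auto simp: D_def)
      finally show ?thesis by (simp add: algebra_simps)
    qed
    have "norm (g k) \<le> D * s ^ k" for k
    proof (induction k)
      case 0 then show ?case using C0 s by (simp add: D_def)
    next
      case (Suc k)
      have "norm (g (Suc k)) \<le> norm (\<alpha> * g k) + norm (g (Suc k) - \<alpha> * g k)"
        by (rule norm_triangle_sub)
      also have "\<dots> \<le> \<rho> * (D * s ^ k) + C * s ^ k"
        unfolding norm_mult
        using s r C0 Suc
        by (intro add_mono mult_mono order_trans[OF C] mult_left_mono power_mono) (auto simp: \<rho>_def)
      also have "\<dots> = (\<rho> * D + C) * s ^ k" by (simp add: algebra_simps)
      also have "\<dots> \<le> D * s * s ^ k" using D s by (intro mult_right_mono) auto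
      finally show ?case by (simp add: algebra_simps)
    qed
    then show ?thesis by (rule geometric_decayI[OF s(3,2)])
  next
    case False
    have step: "norm (g k) \<le> norm (g (Suc k)) + C * r ^ k" for k
    proof -
      have "norm (g k) \<le> norm (\<alpha> * g k)" using False mult_right_mono[of 1 "norm \<alpha>" "norm (g k)"] by (simp add: norm_mult)
      also have "\<dots> \<le> norm (g (Suc k)) + norm (g (Suc k) - \<alpha> * g k)"
        using norm_triangle_sub[of "\<alpha> * g k" "g (Suc k)"] by (simp add: norm_minus_commute)
      finally show ?thesis using C[of k] by simp
    qed
    have multi: "norm (g k) \<le> norm (g (m + k)) + (\<Sum>i<m. C * r ^ (i + k))" for k m
    proof (induction m)
      case (Suc m)
      then show ?case using step[of "m + k"] by simp
    qed simp
    have "norm (g k) \<le> C / (1 - r) * r ^ k" for k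
    proof -
      have "norm (g k) \<le> norm (g (m + k)) + C / (1 - r) * r ^ k" for m
      proof -
        have "(\<Sum>i<m. C * r ^ (i + k)) = C * r ^ k * (\<Sum>i<m. r ^ i)"
          by (simp add: sum_distrib_left power_add algebra_simps)
        also have "\<dots> \<le> C * r ^ k * (1 / (1 - r))"
          using r C0 by (intro mult_left_mono) (auto simp: sum_gp_strict divide_right_mono)
        finally show ?thesis using multi[of k m] by simp
      qed
      moreover have "(\<lambda>m. norm (g (m + k)) + C / (1 - r) * r ^ k) \<longlonglongrightarrow> 0 + C / (1 - r) * r ^ k"
        using LIMSEQ_ignore_initial_segment[OF lim, of k] by (intro tendsto_add tendsto_const tendsto_norm_zero)
      ultimately show ?thesis using LIMSEQ_le_const by fastforce
    qed
    then show ?thesis by (rule geometric_decayI[OF r])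
  qed
qed

text \<open>\<open>P\<close> evaluated at the left shift, applied to \<open>e\<close>. The sequences
  it kills are the solutions of the linear recurrence with characteristic polynomial
  \<open>P\<close>.\<close>

definition shift_op :: "complex poly \<Rightarrow> (nat \<Rightarrow> complex) \<Rightarrow> nat \<Rightarrow> complex" where
  "shift_op P e k = (\<Sum>i\<le>degree P. coeff P i * e (k + i))"

lemma shift_op_altdef: "degree P \<le> N \<Longrightarrow> shift_op P e k = (\<Sum>i\<le>N. coeff P i * e (k + i))"
  unfolding shift_op_def by (rule sum.mono_neutral_left) (auto simp: coeff_eq_0)

lemma shift_op_linear_factor:
  "shift_op ([:- \<alpha>, 1:] * Q) e k = shift_op Q e (Suc k) - \<alpha> * shift_op Q e k"
proof -
  define N where "N = degree Q"
  have 1: "shift_op ([:- \<alpha>, 1:] * Q) e k = (\<Sum>i\<le>Suc N. coeff ([:- \<alpha>, 1:] * Q) i * e (k + i))"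
    using degree_mult_le[of "[:- \<alpha>, 1:]" Q] by (intro shift_op_altdef) (simp add: N_def)
  have "coeff ([:- \<alpha>, 1:] * Q) i = - \<alpha> * coeff Q i + coeff (pCons 0 Q) i" for i by simp
  then have "shift_op ([:- \<alpha>, 1:] * Q) e k = (\<Sum>i\<le>Suc N. - \<alpha> * (coeff Q i * e (k + i)) + coeff (pCons 0 Q) i * e (k + i))"
    unfolding 1 by (intro sum.cong) (auto simp: algebra_simps)
  also have "\<dots> = - \<alpha> * (\<Sum>i\<le>Suc N. coeff Q i * e (k + i)) + (\<Sum>i\<le>Suc N. coeff (pCons 0 Q) i * e (k + i))"
    by (simp only: sum.distrib sum_distrib_left)
  also have "(\<Sum>i\<le>Suc N. coeff Q i * e (k + i)) = shift_op Q e k"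
    by (rule shift_op_altdef[symmetric]) (simp add: N_def)
  also have "(\<Sum>i\<le>Suc N. coeff (pCons 0 Q) i * e (k + i)) = shift_op Q e (Suc k)"
    by (simp add: sum.atMost_Suc_shift shift_op_def N_def del: sum.atMost_Suc)
  finally show ?thesis by simp
qed

lemma tendsto_shift_op:
  assumes "e \<longlonglongrightarrow> 0" shows "shift_op P e \<longlonglongrightarrow> 0"
proof -
  have "(\<lambda>k. \<Sum>i\<le>degree P. coeff P i * e (k + i)) \<longlonglongrightarrow> (\<Sum>i\<le>degree P. coeff P i * 0)"
    using LIMSEQ_ignore_initial_segment[OF assms] by (intro tendsto_sum tendsto_mult tendsto_const) auto
  then show ?thesis unfolding shift_op_def[abs_def] by simp
qed

text \<open>Over the complex numbers \<open>P\<close> splits, and its action becomes a composition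
  of first order differences; one root is removed at a time. The intermediate sequences are null
  sequences again by \<open>tendsto_shift_op\<close>.\<close>

lemma geometric_decay_shift_op:
  assumes "P \<noteq> 0" and "e \<longlonglongrightarrow> 0" and "geometric_decay (shift_op P e)"
  shows "geometric_decay e"
  using assms
proof (induction "degree P" arbitrary: P)
  case 0
  then obtain c where P: "P = [:c:]" using degree_eq_zeroE by metis
  then have c: "c \<noteq> 0" using 0 by auto
  obtain C r where r: "0 < r" "r < 1" "\<And>k. norm (shift_op P e k) \<le> C * r ^ k"
    using 0 by (auto simp: geometric_decay_def)
  have "norm (e k) \<le> (C / norm c) * r ^ k" for k
    using r(3)[of k] c by (simp add: P shift_op_def norm_mult field_simps)
  then show ?case by (rule geometric_decayI[OF r(1,2)])
next
  case (Suc n)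
  then have "\<not> constant (poly P)" by (simp add: constant_degree)
  then obtain \<alpha> where "poly P \<alpha> = 0" using fundamental_theorem_of_algebra by blast
  then obtain Q where Q: "P = [:- \<alpha>, 1:] * Q" by (auto simp: poly_eq_0_iff_dvd)
  then have Q0: "Q \<noteq> 0" using Suc by auto
  have "degree P = Suc (degree Q)" unfolding Q using Q0 by (subst degree_mult_eq) auto
  then have n: "n = degree Q" using Suc by simp
  have "shift_op P e = (\<lambda>k. shift_op Q e (Suc k) - \<alpha> * shift_op Q e k)"
    by (rule ext) (simp only: Q shift_op_linear_factor)
  then have "geometric_decay (\<lambda>k. shift_op Q e (Suc k) - \<alpha> * shift_op Q e k)"
    using Suc(5) by simp
  then have "geometric_decay (shift_op Q e)"
    by (rule geometric_decay_first_order[OF tendsto_shift_op[OF Suc(4)]])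
  then show ?case by (rule Suc(1)[OF n Q0 Suc(4)])
qed

section \<open>Linear recurrences over the integers, from finite windows to the whole
  sequence\<close>

lemma recurrence_zero_extend:
  fixes v c :: "nat \<Rightarrow> int"
  assumes rec: "\<And>k. k \<le> K \<Longrightarrow> (\<Sum>j\<le>n. c j * v (k + j)) = 0" and c: "\<exists>j\<le>n. c j \<noteq> 0"
    and init: "\<And>k. k < n \<Longrightarrow> v k = 0"
  shows "m \<le> K \<longrightarrow> v m = 0"
proof -
  \<comment> \<open>The top coefficient \<open>c n\<close> may vanish, hence the last nonzero one.
    Since \<open>d \<le> n\<close>, the given zeros below \<open>n\<close> still suffice, and over
    the integers a vanishing multiple \<open>c d * v m\<close> forces
    \<open>v m = 0\<close>.\<close>
  define d where "d = Max {j. j \<le> n \<and> c j \<noteq> 0}"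
  have "d \<in> {j. j \<le> n \<and> c j \<noteq> 0}" unfolding d_def using c by (intro Max_in) auto
  then have d: "d \<le> n" "c d \<noteq> 0" by auto
  have dmax: "j \<le> d" if "j \<le> n" "c j \<noteq> 0" for j unfolding d_def using that by (intro Max_ge) auto
  have "m \<le> K \<longrightarrow> v m = 0" for m
  proof (induction m rule: less_induct)
    case (less m)
    show ?case
    proof (cases "m < n")
      case False
      show ?thesis
      proof
        assume "m \<le> K"
        define k where "k = m - d"
        have k: "k + d = m" "k \<le> K" using False d \<open>m \<le> K\<close> by (auto simp: k_def)
        have "(\<Sum>j\<le>n. c j * v (k + j)) = c d * v (k + d) + (\<Sum>j\<in>{..n} - {d}. c j * v (k + j))"
          using d by (subst sum.remove[of _ d]) auto
        also have "(\<Sum>j\<in>{..n} - {d}. c j * v (k + j)) = 0"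
        proof (rule sum.neutral, rule ballI)
          fix j assume "j \<in> {..n} - {d}"
          then have j: "j \<le> n" "j \<noteq> d" by auto
          show "c j * v (k + j) = 0"
          proof (cases "c j = 0")
            case False
            then have "k + j < m" using dmax[of j] j k by simp
            then show ?thesis using less[of "k + j"] \<open>m \<le> K\<close> by simp
          qed simp
        qed
        finally show "v m = 0" using rec[OF k(2)] d k by simp
      qed
    qed (use init in auto)
  qed
  then show ?thesis by simp
qed

text \<open>Annihilators commute. Let \<open>v\<close> be the image of \<open>a\<close> under the
  first annihilator \<open>c\<close>. A longer annihilator \<open>c'\<close> of \<open>a\<close>
  also annihilates \<open>v\<close> on a longer range, and \<open>v\<close> already vanishes on at
  least as many terms as the order of \<open>c'\<close>, so it vanishes on that whole range. One
  vector \<open>c\<close> therefore serves for all \<open>k\<close>.\<close>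

lemma recurrence_of_windows:
  fixes a :: "nat \<Rightarrow> int"
  assumes "\<And>n. n \<ge> n0 \<Longrightarrow> \<exists>c::nat \<Rightarrow> int. (\<exists>i\<le>n. c i \<noteq> 0) \<and> (\<forall>k\<le>3 * n. (\<Sum>i\<le>n. c i * a (k + i)) = 0)"
    and "n0 > 0"
  shows "\<exists>c::nat \<Rightarrow> int. (\<exists>i\<le>n0. c i \<noteq> 0) \<and> (\<forall>k. (\<Sum>i\<le>n0. c i * a (k + i)) = 0)"
proof -
  obtain c where c: "\<exists>i\<le>n0. c i \<noteq> 0" "\<And>k. k \<le> 3 * n0 \<Longrightarrow> (\<Sum>i\<le>n0. c i * a (k + i)) = 0"
    using assms(1)[of n0] by auto
  define v where "v k = (\<Sum>i\<le>n0. c i * a (k + i))" for k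
  \<comment> \<open>The range \<open>2 * n\<close> contains the \<open>Suc n\<close> initial zeros
    that the next annihilator requires. The next range \<open>2 * Suc n\<close>, together with
    shifts up to \<open>n0\<close>, still fits into \<open>3 * Suc n\<close>.\<close>
  have vz: "n \<ge> n0 \<longrightarrow> (\<forall>k\<le>2 * n. v k = 0)" for n
  proof (induction n)
    case 0
    show ?case using assms(2) by simp
  next
    case (Suc n)
    show ?case
    proof (cases "Suc n = n0")
      case True then show ?thesis using c(2) by (simp add: v_def)
    next
      case False
      show ?thesis
      proof (intro impI)
        assume n: "Suc n \<ge> n0"
        then have n': "n \<ge> n0" using False by simp
        obtain c' where c': "\<exists>i\<le>Suc n. c' i \<noteq> 0"
          "\<And>k. k \<le> 3 * Suc n \<Longrightarrow> (\<Sum>i\<le>Suc n. c' i * a (k + i)) = 0"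
          using assms(1)[OF n] by blast
        have rec: "(\<Sum>j\<le>Suc n. c' j * v (k + j)) = 0" if k: "k \<le> 2 * Suc n" for k
        proof -
          have "(\<Sum>j\<le>Suc n. c' j * v (k + j)) = (\<Sum>j\<le>Suc n. \<Sum>i\<le>n0. c' j * (c i * a (k + j + i)))"
            by (simp only: v_def sum_distrib_left)
          also have "\<dots> = (\<Sum>i\<le>n0. \<Sum>j\<le>Suc n. c' j * (c i * a (k + j + i)))" by (rule sum.swap)
          also have "\<dots> = (\<Sum>i\<le>n0. c i * (\<Sum>j\<le>Suc n. c' j * a (k + i + j)))"
            by (simp only: sum_distrib_left) (auto intro!: sum.cong simp: algebra_simps)
          also have "\<dots> = 0"
          proof (rule sum.neutral, safe)
            fix i assume "i \<le> n0"
            then have "k + i \<le> 3 * Suc n" using k n by simp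
            then show "c i * (\<Sum>j\<le>Suc n. c' j * a (k + i + j)) = 0" using c'(2) by simp
          qed
          finally show ?thesis .
        qed
        have "v k = 0" if "k \<le> 2 * Suc n" for k
          by (rule recurrence_zero_extend[OF rec c'(1) _, rule_format, OF _ _ that]) (use Suc n' assms(2) in auto)
        then show "\<forall>k\<le>2 * Suc n. v k = 0" by blast
      qed
    qed
  qed
  then have "v k = 0" for k
  proof -
    have "n0 + k \<ge> n0 \<and> k \<le> 2 * (n0 + k)" by simp
    then show ?thesis using vz[of "n0 + k"] by simp
  qed
  then show ?thesis using c(1) by (auto simp: v_def)
qed

section \<open>Distance to the nearest integer, and Pisot's theorem\<close>

definition int_dist :: "real \<Rightarrow> real" where
  "int_dist x = \<bar>x - of_int (round x)\<bar>"

lemma int_dist_nonneg [simp]: "0 \<le> int_dist x" by (simp add: int_dist_def)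

lemma int_dist_le_half: "int_dist x \<le> 1 / 2"
  using of_int_round_abs_le[of x] by (simp add: int_dist_def abs_minus_commute)

lemma int_dist_le: "int_dist x \<le> \<bar>x - of_int m\<bar>"
  unfolding int_dist_def by (rule round_diff_minimal)

lemma int_dist_add_le: "int_dist (x + y) \<le> int_dist x + int_dist y"
proof -
  have "int_dist (x + y) \<le> \<bar>x + y - of_int (round x + round y)\<bar>" by (rule int_dist_le)
  also have "\<dots> \<le> int_dist x + int_dist y" by (simp add: int_dist_def)
  finally show ?thesis .
qed

lemma int_dist_le_abs: "int_dist x \<le> \<bar>x\<bar>" using int_dist_le[of x 0] by simp

lemma int_dist_minus: "int_dist (- x) = int_dist x"
proof -
  have "int_dist (- y) \<le> int_dist y" for y
    using int_dist_le[of "- y" "- round y"] by (simp add: int_dist_def)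
  from this[of x] this[of "- x"] show ?thesis by simp
qed

lemma int_dist_eq_abs: "\<bar>x\<bar> \<le> 1 / 2 \<Longrightarrow> int_dist x = \<bar>x\<bar>"
proof -
  assume x: "\<bar>x\<bar> \<le> 1 / 2"
  have "\<bar>x\<bar> \<le> \<bar>x - of_int m\<bar>" for m :: int
  proof (cases "m = 0")
    case False
    then have "1 \<le> \<bar>real_of_int m\<bar>" by linarith
    then show ?thesis using x by linarith
  qed simp
  from this[of "round x"] show ?thesis using int_dist_le_abs[of x] by (simp add: int_dist_def)
qed

text \<open>The nearest integers \<open>a k\<close> are multiplied by \<theta> up to square summable
  defects, so beyond some \<open>k0\<close> the pigeonhole argument gives them an integer
  recurrence. The errors \<open>e k\<close> then satisfy it up to a multiple of
  \<open>\<theta> ^ k\<close>, which has to vanish because the errors tend to 0; so they decay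
  geometrically.\<close>

lemma square_summable_imp_summable_int_dist:
  fixes \<theta> lam :: real
  assumes \<theta>: "2 < \<theta>" and sm: "summable (\<lambda>k. (int_dist (lam * \<theta> ^ k))\<^sup>2)"
  shows "summable (\<lambda>k. int_dist (lam * \<theta> ^ k))"
proof -
  define a where "a k = round (lam * \<theta> ^ k)" for k
  define e where "e k = lam * \<theta> ^ k - a k" for k
  define \<delta> where "\<delta> k = real_of_int (a (Suc k)) - \<theta> * a k" for k
  have ae: "int_dist (lam * \<theta> ^ k) = \<bar>e k\<bar>" for k by (simp add: int_dist_def e_def a_def)
  have sm2: "summable (\<lambda>k. (e k)\<^sup>2)" using sm by (simp add: ae)
  have \<delta>e: "\<delta> k = \<theta> * e k - e (Suc k)" for k by (simp add: \<delta>_def e_def algebra_simps)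
  have "summable (\<lambda>k. (\<delta> k)\<^sup>2)"
  proof (rule summable_comparison_test'[where N=0])
    show "summable (\<lambda>k. 2 * \<theta>\<^sup>2 * (e k)\<^sup>2 + 2 * (e (Suc k))\<^sup>2)"
      using sm2 by (intro summable_add summable_mult) (auto simp: summable_Suc_iff[of "\<lambda>k. (e k)\<^sup>2"])
    fix k
    have "(\<delta> k)\<^sup>2 + (\<theta> * e k + e (Suc k))\<^sup>2 = 2 * \<theta>\<^sup>2 * (e k)\<^sup>2 + 2 * (e (Suc k))\<^sup>2"
      unfolding \<delta>e by (simp add: power2_eq_square algebra_simps)
    moreover have "0 \<le> (\<theta> * e k + e (Suc k))\<^sup>2" by simp
    ultimately show "norm ((\<delta> k)\<^sup>2) \<le> 2 * \<theta>\<^sup>2 * (e k)\<^sup>2 + 2 * (e (Suc k))\<^sup>2"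
      unfolding real_norm_def abs_power2 by linarith
  qed
  \<comment> \<open>About \<open>4 * \<theta>\<close>, as the pigeonhole count requires; the
    threshold \<open>\<tau>\<close> is then fixed by the constant 264.\<close>
  define H where "H = nat \<lceil>4 * \<theta>\<rceil>"
  define \<tau> where "\<tau> = 1 / (264 * (real H)\<^sup>2)"
  have H: "8 * \<theta> \<le> 2 * real H + 1" "H > 0" using \<theta> by (auto simp: H_def) linarith+
  have \<tau>: "0 < \<tau>" "264 * (real H)\<^sup>2 * \<tau> \<le> 1" using H by (auto simp: \<tau>_def)
  \<comment> \<open>Dropping the first \<open>k0\<close> terms makes the energy of every window of
    defects smaller than \<open>\<tau>\<close>.\<close>
  obtain k0 where k0: "\<And>n. n \<ge> k0 \<Longrightarrow> norm (\<Sum>i. (\<delta> (i + n))\<^sup>2) < \<tau>"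
    using suminf_exist_split[OF \<tau>(1) \<open>summable (\<lambda>k. (\<delta> k)\<^sup>2)\<close>] by auto
  have small: "(\<Sum>i\<le>n. (\<delta> (k0 + (k + i)))\<^sup>2) \<le> \<tau>" for k n
  proof -
    have "(\<Sum>i\<le>n. (\<delta> (k0 + (k + i)))\<^sup>2) = (\<Sum>i\<in>{..n}. (\<delta> (i + (k0 + k)))\<^sup>2)" by (simp add: algebra_simps)
    also have "\<dots> \<le> (\<Sum>i. (\<delta> (i + (k0 + k)))\<^sup>2)"
      using \<open>summable (\<lambda>k. (\<delta> k)\<^sup>2)\<close> by (intro sum_le_suminf) (auto simp: summable_iff_shift[of "\<lambda>k. (\<delta> k)\<^sup>2"])
    also have "\<dots> \<le> \<tau>" using k0[of "k0 + k"] by simp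
    finally show ?thesis .
  qed
  define b where "b k = a (k0 + k)" for k
  \<comment> \<open>Windows must be long enough for \<open>2 ^ n\<close> to absorb the size of the
    first term.\<close>
  obtain m where m: "3 * (\<bar>real_of_int (b 0)\<bar> + 1) < 2 ^ m"
    using real_arch_pow[of 2] by auto
  have win: "\<exists>c::nat \<Rightarrow> int. (\<exists>i\<le>n. c i \<noteq> 0) \<and> (\<forall>k\<le>3 * n. (\<Sum>i\<le>n. c i * b (k + i)) = 0)" if "n \<ge> Suc m" for n
  proof (rule annihilated_window[of \<theta> H \<tau>])
    show "2 \<le> \<theta>" using \<theta> by simp
    show "(\<Sum>i\<le>n. (real_of_int (b (Suc (k + i))) - \<theta> * real_of_int (b (k + i)))\<^sup>2) \<le> \<tau>" for k n
      using small[of k n] by (simp add: b_def \<delta>_def)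
    have "(2::real) ^ m \<le> 2 ^ n" using that by (intro power_increasing) auto
    then show "3 * (\<bar>real_of_int (b 0)\<bar> + 1) \<le> 2 ^ n" using m by linarith
  qed (use H \<tau> in auto)
  then obtain c :: "nat \<Rightarrow> int" where c: "\<exists>i\<le>Suc m. c i \<noteq> 0" "\<And>k. (\<Sum>i\<le>Suc m. c i * b (k + i)) = 0"
    using recurrence_of_windows[of "Suc m" b] by blast
  define P :: "complex poly" where "P = (\<Sum>i\<le>Suc m. monom (of_int (c i)) i)"
  have cP: "coeff P i = (if i \<le> Suc m then of_int (c i) else 0)" for i
    by (simp add: P_def coeff_sum del: sum.atMost_Suc)
  have P0: "P \<noteq> 0" using c(1) cP by (metis coeff_0 of_int_eq_0_iff)
  define f where "f k = complex_of_real (e (k0 + k))" for k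
  have "(\<lambda>k. (e k)\<^sup>2) \<longlonglongrightarrow> 0" using sm2 by (rule summable_LIMSEQ_zero)
  then have "e \<longlonglongrightarrow> 0" using tendsto_real_sqrt tendsto_rabs_zero_iff by fastforce
  then have "(\<lambda>k. e (k + k0)) \<longlonglongrightarrow> 0" by (rule LIMSEQ_ignore_initial_segment)
  then have f0: "f \<longlonglongrightarrow> 0" unfolding f_def[abs_def] using tendsto_of_real[of _ 0] by (fastforce simp: add.commute)
  define S where "S = (\<Sum>i\<le>Suc m. c i * (lam * \<theta> ^ (k0 + i)))"
  have Sk: "shift_op P f k = of_real (\<theta> ^ k * S)" for k
  proof -
    have "shift_op P f k = (\<Sum>i\<le>Suc m. coeff P i * f (k + i))"
      unfolding P_def by (intro shift_op_altdef degree_sum_le order_trans[OF degree_monom_le]) auto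
    also have "\<dots> = of_real (\<Sum>i\<le>Suc m. c i * e (k0 + (k + i)))"
      by (simp add: cP f_def of_real_sum)
    also have "(\<Sum>i\<le>Suc m. c i * e (k0 + (k + i)))
       = (\<Sum>i\<le>Suc m. c i * (lam * \<theta> ^ (k0 + (k + i)))) - of_int (\<Sum>i\<le>Suc m. c i * b (k + i))"
      by (simp add: e_def b_def algebra_simps sum_subtractf del: sum.atMost_Suc)
    also have "\<dots> = \<theta> ^ k * S"
      unfolding c(2) S_def by (simp add: sum_distrib_left power_add algebra_simps del: sum.atMost_Suc)
    finally show ?thesis .
  qed
  \<comment> \<open>For \<open>S \<noteq> 0\<close> the right side of \<open>Sk\<close> stays away
    from 0, while the left side tends to 0.\<close>
  have "S = 0"
  proof (rule ccontr)
    assume S: "S \<noteq> 0"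
    have "norm (shift_op P f k) \<ge> \<bar>S\<bar>" for k
      using mult_right_mono[OF one_le_power[of \<theta> k], of "\<bar>S\<bar>"] \<theta> unfolding Sk
      by (simp add: abs_mult norm_mult norm_power)
    then have "\<bar>S\<bar> \<le> norm (0::complex)"
      by (intro LIMSEQ_le_const[OF tendsto_norm[OF tendsto_shift_op[OF f0]]]) auto
    then show False using S by simp
  qed
  then have "shift_op P f = (\<lambda>k. 0)" by (auto simp: Sk)
  then have "geometric_decay (shift_op P f)" by (auto intro: geometric_decayI[of "1/2" _ 0])
  then have "geometric_decay f" by (rule geometric_decay_shift_op[OF P0 f0])
  then have "summable (\<lambda>k. \<bar>e (k + k0)\<bar>)"
    using geometric_decay_imp_summable_norm[of f] by (simp add: f_def add.commute)
  then show ?thesis unfolding ae by (subst (asm) summable_iff_shift)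
qed

section \<open>Limits of cosine products\<close>

definition abs_cos :: "real \<Rightarrow> real" where
  "abs_cos x = \<bar>cos (pi * x)\<bar>"

lemma abs_cos_nonneg [simp]: "0 \<le> abs_cos x" and abs_cos_le_1 [simp]: "abs_cos x \<le> 1"
  by (auto simp: abs_cos_def)

lemma abs_cos_0 [simp]: "abs_cos 0 = 1" by (simp add: abs_cos_def)

lemma abs_cos_add_of_int [simp]: "abs_cos (x + of_int n) = abs_cos x"
proof -
  have "cos (pi * (x + of_int n)) = cos (pi * x) * cos (pi * of_int n)"
    by (simp add: distrib_left cos_add mult.commute[of pi "of_int n"] sin_times_pi_eq_0)
  moreover have "\<bar>cos (pi * of_int n)\<bar> = 1"
    using cos_int_times_real[of n] sin_cos_squared_add[of "pi * of_int n"]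
    by (metis abs_square_eq_1 add_0 mult.commute power_zero_numeral sin_times_pi_eq_0 Ints_of_int)
  ultimately show ?thesis by (simp add: abs_cos_def abs_mult)
qed

lemma abs_cos_diff_le: "\<bar>abs_cos x - abs_cos y\<bar> \<le> pi * \<bar>x - y\<bar>"
proof -
  have "\<bar>cos a - cos b\<bar> \<le> \<bar>a - b\<bar>" for a b :: real
  proof -
    have "cos a - cos b = 2 * sin ((a + b) / 2) * sin ((b - a) / 2)" by (rule cos_diff_cos)
    then have "\<bar>cos a - cos b\<bar> = 2 * \<bar>sin ((a + b) / 2)\<bar> * \<bar>sin ((b - a) / 2)\<bar>" by (simp add: abs_mult)
    also have "\<dots> \<le> 2 * 1 * \<bar>(b - a) / 2\<bar>"
      by (intro mult_mono abs_sin_x_le_abs_x) auto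
    finally show ?thesis by simp
  qed
  from this[of "pi * x" "pi * y"] show ?thesis
    by (simp add: abs_cos_def abs_mult right_diff_distrib[symmetric])
qed

text \<open>Periodicity removes the nearest integer from \<open>x\<close> and leaves the Lipschitz
  bound. The distance enters to the first power; this is where summability, rather than square
  summability, is required later.\<close>

lemma abs_cos_add_diff_le: "\<bar>abs_cos (x + y) - abs_cos y\<bar> \<le> pi * int_dist x"
proof -
  have "abs_cos (x + y) = abs_cos (x - of_int (round x) + y)"
    using abs_cos_add_of_int[of "x - of_int (round x) + y" "round x"] by (simp add: algebra_simps)
  then show ?thesis using abs_cos_diff_le[of "x - of_int (round x) + y" y] by (simp add: int_dist_def)
qed

text \<open>With \<open>d = int_dist x\<close> one has \<open>sin (pi * d) \<ge> d\<close> on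
  [0, 1/2], and \<open>cos^2 = 1 - sin^2 \<le> 1 - d^2 \<le> exp (- d^2)\<close>; the square root
  accounts for the factor 1/2.\<close>

lemma abs_cos_le_exp: "abs_cos x \<le> exp (- ((int_dist x)\<^sup>2 / 2))"
proof -
  define d where "d = int_dist x"
  define y where "y = pi * d"
  have d: "0 \<le> d" "d \<le> 1/2" using int_dist_le_half by (auto simp: d_def)
  have y: "0 \<le> y" "y \<le> 16/10" using d pi_less_4 mult_mono[of pi "32/10" d "1/2"] pi_approx by (auto simp: y_def)
  have "sin y \<ge> d"
  proof -
    \<comment> \<open>Third order Taylor bound: \<open>y ^ 3 \<le> y * 3\<close> on the range in
      question, so \<open>sin y \<ge> y / 2\<close>, and \<open>y / 2 \<ge> d\<close>.\<close>
    have "(\<Sum>m<3. sin_coeff m * y ^ m) = y" by (simp add: sin_coeff_def numeral_3_eq_3)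
    then have "\<bar>sin y - y\<bar> \<le> inverse (fact 3) * \<bar>y\<bar> ^ 3" using Maclaurin_sin_bound[of y 3] by simp
    moreover have "inverse (fact 3) = (1 / 6 :: real)" by (simp add: fact_numeral)
    ultimately have "sin y \<ge> y - y ^ 3 / 6" using y(1) by (simp only: abs_of_nonneg)
    moreover have "y ^ 3 \<le> y * 3"
    proof -
      have "y * y \<le> (16/10) * (16/10)" using y by (intro mult_mono) auto
      then have "y * (y * y) \<le> y * 3" using y by (intro mult_left_mono) auto
      then show ?thesis by (simp add: power3_eq_cube)
    qed
    moreover have "y \<ge> 2 * d" unfolding y_def using d pi_gt3 by (intro mult_right_mono) auto
    ultimately show ?thesis by simp
  qed
  then have "d\<^sup>2 \<le> (sin y)\<^sup>2" using d by (intro power_mono) auto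
  have "abs_cos x = \<bar>cos y\<bar>"
  proof -
    have "abs_cos x = abs_cos (x - of_int (round x))" using abs_cos_add_of_int[of x "- round x"] by simp
    also have "\<dots> = \<bar>cos y\<bar>" by (cases "x - of_int (round x) \<ge> 0")
        (auto simp: abs_cos_def y_def d_def int_dist_def abs_if right_diff_distrib cos_diff)
    finally show ?thesis .
  qed
  then have "(abs_cos x)\<^sup>2 = 1 - (sin y)\<^sup>2" by (simp add: cos_squared_eq)
  also have "\<dots> \<le> 1 + (- d\<^sup>2)" using \<open>d\<^sup>2 \<le> (sin y)\<^sup>2\<close> by simp
  also have "\<dots> \<le> exp (- d\<^sup>2)" by (rule exp_ge_add_one_self)
  also have "\<dots> = (exp (- (d\<^sup>2 / 2)))\<^sup>2" by (simp add: power2_eq_square flip: exp_add)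
  finally show ?thesis unfolding d_def by (rule power2_le_imp_le) simp
qed

lemma prod_abs_cos_bounds: "0 \<le> (\<Prod>i\<in>I. abs_cos (f i))" "(\<Prod>i\<in>I. abs_cos (f i)) \<le> 1"
  by (auto intro: prod_nonneg prod_le_1)

lemma prod_abs_cos_diff_le:
  "\<bar>(\<Prod>i\<in>I. abs_cos (f i)) - (\<Prod>i\<in>I. abs_cos (g i))\<bar> \<le> (\<Sum>i\<in>I. \<bar>abs_cos (f i) - abs_cos (g i)\<bar>)"
  using norm_prod_diff[of I "\<lambda>i. abs_cos (f i)" "\<lambda>i. abs_cos (g i)"] by simp

lemma prod_abs_cos_mono:
  assumes "finite J" "I \<subseteq> J"
  shows "(\<Prod>i\<in>J. abs_cos (f i)) \<le> (\<Prod>i\<in>I. abs_cos (f i))"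
proof -
  have "(\<Prod>i\<in>J. abs_cos (f i)) = (\<Prod>i\<in>J - I. abs_cos (f i)) * (\<Prod>i\<in>I. abs_cos (f i))"
    by (rule prod.subset_diff) (use assms in auto)
  also have "\<dots> \<le> 1 * (\<Prod>i\<in>I. abs_cos (f i))"
    by (intro mult_right_mono prod_abs_cos_bounds)
  finally show ?thesis by simp
qed

lemma convergent_prod_abs_cos: "convergent (\<lambda>n. \<Prod>k<n. abs_cos (f k))"
proof (rule Bseq_monoseq_convergent)
  show "Bseq (\<lambda>n. \<Prod>k<n. abs_cos (f k))"
    by (rule BseqI'[of _ 1]) (simp add: prod_abs_cos_bounds)
  show "monoseq (\<lambda>n. \<Prod>k<n. abs_cos (f k))"
    by (rule decseq_imp_monoseq) (auto simp: decseq_def intro!: prod_abs_cos_mono)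
qed

lemma abs_mult_diff_le:
  fixes a b c d :: real
  assumes "\<bar>b\<bar> \<le> 1" "\<bar>c\<bar> \<le> 1"
  shows "\<bar>a * b - c * d\<bar> \<le> \<bar>a - c\<bar> + \<bar>b - d\<bar>"
proof -
  have "a * b - c * d = (a - c) * b + c * (b - d)" by (simp add: algebra_simps)
  also have "\<bar>\<dots>\<bar> \<le> \<bar>a - c\<bar> * \<bar>b\<bar> + \<bar>c\<bar> * \<bar>b - d\<bar>"
    by (metis abs_mult abs_triangle_ineq)
  also have "\<dots> \<le> \<bar>a - c\<bar> * 1 + 1 * \<bar>b - d\<bar>"
    using assms by (intro add_mono mult_mono) auto
  finally show ?thesis by simp
qed

section \<open>Lacunary cosine products in both directions of scale\<close>

locale dissection_ratio =
  fixes \<theta> :: real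
  assumes \<theta>: "2 < \<theta>"
begin

text \<open>The modulus of the Fourier transform of the Bernoulli convolution at
  \<open>t / 2\<close>. The partial products decrease in [0, 1], so the limit always exists.\<close>

definition cos_product :: "real \<Rightarrow> real" where
  "cos_product t = lim (\<lambda>n. \<Prod>k<n. abs_cos (t / \<theta> ^ k))"

text \<open>The same product towards large scales. By \<open>abs_cos_le_exp\<close> it is positive
  only if the distances \<open>int_dist (t * \<theta> ^ k)\<close> are square summable.\<close>

definition cos_product_up :: "real \<Rightarrow> real" where
  "cos_product_up t = lim (\<lambda>n. \<Prod>k<n. abs_cos (t * \<theta> ^ k))"

lemma cos_product_LIMSEQ: "(\<lambda>n. \<Prod>k<n. abs_cos (t / \<theta> ^ k)) \<longlonglongrightarrow> cos_product t"
  unfolding cos_product_def using convergent_prod_abs_cos by (simp add: convergent_LIMSEQ_iff)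

lemma cos_product_up_LIMSEQ: "(\<lambda>n. \<Prod>k<n. abs_cos (t * \<theta> ^ k)) \<longlonglongrightarrow> cos_product_up t"
  unfolding cos_product_up_def using convergent_prod_abs_cos by (simp add: convergent_LIMSEQ_iff)

lemma cos_product_le:
  assumes "finite I" shows "cos_product t \<le> (\<Prod>k\<in>I. abs_cos (t / \<theta> ^ k))"
proof -
  obtain N where N: "I \<subseteq> {..<N}" using finite_nat_iff_bounded assms by blast
  show ?thesis
  proof (rule LIMSEQ_le_const2[OF cos_product_LIMSEQ], intro exI[of _ N] allI impI)
    fix n assume "N \<le> n"
    then show "(\<Prod>k<n. abs_cos (t / \<theta> ^ k)) \<le> (\<Prod>k\<in>I. abs_cos (t / \<theta> ^ k))"
      using N by (intro prod_abs_cos_mono) auto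
  qed
qed

lemma cos_product_bounds: "0 \<le> cos_product t" "cos_product t \<le> 1"
proof -
  show "0 \<le> cos_product t"
    by (rule LIMSEQ_le_const[OF cos_product_LIMSEQ]) (simp add: prod_abs_cos_bounds)
  show "cos_product t \<le> 1" using cos_product_le[of "{}" t] by simp
qed

lemma cos_product_up_bounds: "0 \<le> cos_product_up t" "cos_product_up t \<le> 1"
proof -
  show "0 \<le> cos_product_up t"
    by (rule LIMSEQ_le_const[OF cos_product_up_LIMSEQ]) (simp add: prod_abs_cos_bounds)
  show "cos_product_up t \<le> 1"
    by (rule LIMSEQ_le_const2[OF cos_product_up_LIMSEQ]) (simp add: prod_abs_cos_bounds)
qed

lemma sum_inverse_power_le: "(\<Sum>k=h..<N. c / \<theta> ^ k) \<le> 2 * c / \<theta> ^ h" if "0 \<le> c"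
proof (cases "h \<le> N")
  case True
  \<comment> \<open>The extra summand bounds the remaining tail and lets the induction
    close.\<close>
  have "(\<Sum>k=h..<N. c / \<theta> ^ k) + 2 * c / \<theta> ^ N \<le> 2 * c / \<theta> ^ h"
    using True
  proof (induction N rule: dec_induct)
    case (step n)
    have "c / \<theta> ^ n + 2 * c / \<theta> ^ Suc n \<le> 2 * c / \<theta> ^ n"
    proof -
      have "2 * c / \<theta> ^ Suc n = (2 / \<theta>) * (c / \<theta> ^ n)" using \<theta> by simp
      also have "\<dots> \<le> 1 * (c / \<theta> ^ n)" using \<theta> that by (intro mult_right_mono) auto
      finally show ?thesis by simp
    qed
    then show ?case using step by simp
  qed simp
  moreover have "0 \<le> 2 * c / \<theta> ^ N" using \<theta> that by simp
  ultimately show ?thesis by linarith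
qed (use \<theta> that in auto)

lemma cos_product_diff_le: "\<bar>cos_product s - cos_product t\<bar> \<le> 2 * pi * \<bar>s - t\<bar>"
proof (rule LIMSEQ_le_const2[OF tendsto_rabs[OF tendsto_diff[OF cos_product_LIMSEQ cos_product_LIMSEQ]]], intro exI allI impI)
  fix n
  have "\<bar>(\<Prod>k<n. abs_cos (s / \<theta> ^ k)) - (\<Prod>k<n. abs_cos (t / \<theta> ^ k))\<bar>
      \<le> (\<Sum>k<n. \<bar>abs_cos (s / \<theta> ^ k) - abs_cos (t / \<theta> ^ k)\<bar>)"
    by (rule prod_abs_cos_diff_le)
  also have "\<dots> \<le> (\<Sum>k<n. (pi * \<bar>s - t\<bar>) / \<theta> ^ k)"
  proof (rule sum_mono)
    fix k
    have "\<bar>s / \<theta> ^ k - t / \<theta> ^ k\<bar> = \<bar>s - t\<bar> / \<theta> ^ k" using \<theta> by (simp add: diff_divide_distrib[symmetric])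
    then show "\<bar>abs_cos (s / \<theta> ^ k) - abs_cos (t / \<theta> ^ k)\<bar> \<le> (pi * \<bar>s - t\<bar>) / \<theta> ^ k"
      using abs_cos_diff_le[of "s / \<theta> ^ k" "t / \<theta> ^ k"] by simp
  qed
  also have "\<dots> \<le> 2 * (pi * \<bar>s - t\<bar>) / \<theta> ^ 0"
    using sum_inverse_power_le[of "pi * \<bar>s - t\<bar>" 0 n] by (simp add: atLeast0LessThan)
  finally show "\<bar>(\<Prod>k<n. abs_cos (s / \<theta> ^ k)) - (\<Prod>k<n. abs_cos (t / \<theta> ^ k))\<bar> \<le> 2 * pi * \<bar>s - t\<bar>" by simp
qed

lemma cos_product_tendsto: "f \<longlonglongrightarrow> t \<Longrightarrow> (\<lambda>j. cos_product (f j)) \<longlonglongrightarrow> cos_product t"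
proof -
  assume f: "f \<longlonglongrightarrow> t"
  have "(\<lambda>j. \<bar>f j - t\<bar>) \<longlonglongrightarrow> 0"
    by (rule tendsto_rabs_zero[OF LIM_zero[OF f]])
  then have "(\<lambda>j. 2 * pi * \<bar>f j - t\<bar>) \<longlonglongrightarrow> 0"
    by (rule tendsto_mult_right_zero)
  then have "(\<lambda>j. cos_product (f j) - cos_product t) \<longlonglongrightarrow> 0"
    by (rule Lim_null_comparison[rotated]) (simp add: cos_product_diff_le)
  then show ?thesis by (simp add: LIM_zero_cancel)
qed

section \<open>Separation of scales\<close>

definition pisot_set :: "real set" where
  "pisot_set = {lam. summable (\<lambda>k. int_dist (lam * \<theta> ^ k))}"

text \<open>Near its bottom scales \<open>lam * \<theta> ^ m + s\<close> looks like \<open>lam\<close>, near its top scales like \<open>s\<close>;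
  summability makes the interaction of the two negligible.\<close>

lemma cos_product_split:
  fixes m L :: nat
  assumes lam: "lam \<in> pisot_set" and L: "L \<le> m" and tail: "(\<Sum>l. int_dist (lam * \<theta> ^ (l + L))) \<le> \<epsilon>"
  shows "\<bar>cos_product (lam * \<theta> ^ m + s) - cos_product_up lam * cos_product (lam / \<theta>) * cos_product s\<bar>
    \<le> 2 * pi * \<epsilon> + 4 * pi * \<bar>s\<bar> * \<theta> ^ L / \<theta> ^ m"
proof -
  \<comment> \<open>For \<open>k < h\<close> the term \<open>lam * \<theta> ^ (m - k)\<close> is
    close to an integer and the factor depends essentially on \<open>s\<close>; for
    \<open>k \<ge> h\<close> the term \<open>s / \<theta> ^ k\<close> is small and the factor
    depends essentially on \<open>lam\<close>.\<close>
  define h where "h = m - L"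
  have hm: "m = h + L" using L by (simp add: h_def)
  define t where "t = lam * \<theta> ^ m + s"
  have \<theta>0: "\<theta> > 0" using \<theta> by simp
  define d where "d l = int_dist (lam * \<theta> ^ l)" for l
  have smd: "summable (\<lambda>l. d (l + L))"
    using lam by (simp add: pisot_set_def d_def summable_iff_shift[of "\<lambda>l. int_dist (lam * \<theta> ^ l)"])
  have tl: "(\<Sum>l=L..<n. d l) \<le> \<epsilon>" for n
  proof -
    have "(\<Sum>l=L..<n. d l) = (\<Sum>l<n - L. d (l + L))"
      by (rule sum.reindex_bij_witness[of _ "\<lambda>l. l + L" "\<lambda>l. l - L"]) auto
    also have "\<dots> \<le> (\<Sum>l. d (l + L))" by (rule sum_le_suminf[OF smd]) (auto simp: d_def)
    finally show ?thesis using tail by (simp add: d_def)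
  qed
  define E where "E = 2 * (pi * \<bar>s\<bar>) / \<theta> ^ h"
  have E: "2 * E = 4 * pi * \<bar>s\<bar> * \<theta> ^ L / \<theta> ^ m"
    using \<theta>0 by (simp add: E_def hm power_add)
  define A where "A = (\<Prod>k<h. abs_cos (s / \<theta> ^ k))"
  define V where "V = (\<Prod>l<Suc L. abs_cos (lam * \<theta> ^ l))"
  have fin: "\<bar>(\<Prod>k<Suc m + n. abs_cos (t / \<theta> ^ k)) - A * (V * (\<Prod>k<n. abs_cos (lam / \<theta> / \<theta> ^ k)))\<bar> \<le> pi * \<epsilon> + E" for n
  proof -
    let ?N = "Suc m + n"
    \<comment> \<open>The hybrid arguments. Their product splits into the part \<open>A\<close> from
      \<open>s\<close>, the part \<open>V\<close> from \<open>lam\<close> at the scales 0 to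
      \<open>L\<close>, and the descending product of \<open>lam / \<theta>\<close>.\<close>
    define b where "b k = (if k < h then s / \<theta> ^ k else lam * \<theta> ^ m / \<theta> ^ k)" for k
    have "(\<Prod>k<?N. abs_cos (b k)) = (\<Prod>k<h. abs_cos (b k)) * (\<Prod>k=h..<?N. abs_cos (b k))"
      by (subst prod.atLeastLessThan_concat[of 0 h ?N, symmetric, unfolded atLeast0LessThan]) (auto simp: hm atLeast0LessThan)
    also have "(\<Prod>k<h. abs_cos (b k)) = A" unfolding A_def by (intro prod.cong) (auto simp: b_def)
    also have "(\<Prod>k=h..<?N. abs_cos (b k)) = (\<Prod>k=h..<Suc m. abs_cos (b k)) * (\<Prod>k=Suc m..<?N. abs_cos (b k))"
      by (rule prod.atLeastLessThan_concat[symmetric]) (auto simp: hm)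
    also have "(\<Prod>k=h..<Suc m. abs_cos (b k)) = V" unfolding V_def
      by (rule prod.reindex_bij_witness[of _ "\<lambda>l. m - l" "\<lambda>k. m - k"])
        (use \<theta>0 in \<open>auto simp: b_def hm power_add power_diff less_Suc_eq_le\<close>)
    also have "(\<Prod>k=Suc m..<?N. abs_cos (b k)) = (\<Prod>k<n. abs_cos (lam / \<theta> / \<theta> ^ k))"
      by (rule prod.reindex_bij_witness[of _ "\<lambda>k. k + Suc m" "\<lambda>k. k - Suc m"])
        (use \<theta>0 in \<open>auto simp: b_def hm power_add power_diff\<close>)
    finally have b: "(\<Prod>k<?N. abs_cos (b k)) = A * (V * (\<Prod>k<n. abs_cos (lam / \<theta> / \<theta> ^ k)))" .
    have "\<bar>(\<Prod>k<?N. abs_cos (t / \<theta> ^ k)) - (\<Prod>k<?N. abs_cos (b k))\<bar>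
        \<le> (\<Sum>k<?N. \<bar>abs_cos (t / \<theta> ^ k) - abs_cos (b k)\<bar>)" by (rule prod_abs_cos_diff_le)
    also have "\<dots> = (\<Sum>k<h. \<bar>abs_cos (t / \<theta> ^ k) - abs_cos (b k)\<bar>) + (\<Sum>k=h..<?N. \<bar>abs_cos (t / \<theta> ^ k) - abs_cos (b k)\<bar>)"
      by (subst sum.atLeastLessThan_concat[of 0 h ?N, symmetric, unfolded atLeast0LessThan]) (auto simp: hm atLeast0LessThan)
    also have "(\<Sum>k<h. \<bar>abs_cos (t / \<theta> ^ k) - abs_cos (b k)\<bar>) \<le> (\<Sum>k<h. pi * d (m - k))"
    proof (rule sum_mono)
      fix k assume "k \<in> {..<h}"
      then have k: "k < h" "k \<le> m" by (auto simp: hm)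
      have "t / \<theta> ^ k = lam * \<theta> ^ (m - k) + s / \<theta> ^ k"
        using k \<theta>0 by (simp add: t_def add_divide_distrib power_diff)
      then show "\<bar>abs_cos (t / \<theta> ^ k) - abs_cos (b k)\<bar> \<le> pi * d (m - k)"
        using k abs_cos_add_diff_le[of "lam * \<theta> ^ (m - k)" "s / \<theta> ^ k"] by (simp add: b_def d_def)
    qed
    also have "(\<Sum>k<h. pi * d (m - k)) = pi * (\<Sum>l=Suc L..<Suc m. d l)"
      unfolding sum_distrib_left
      by (rule sum.reindex_bij_witness[of _ "\<lambda>l. m - l" "\<lambda>k. m - k"]) (auto simp: hm)
    also have "\<dots> \<le> pi * (\<Sum>l=L..<Suc m. d l)"
      by (intro mult_left_mono sum_mono2) (auto simp: d_def)
    also have "\<dots> \<le> pi * \<epsilon>" by (rule mult_left_mono[OF tl]) simp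
    also have "(\<Sum>k=h..<?N. \<bar>abs_cos (t / \<theta> ^ k) - abs_cos (b k)\<bar>) \<le> (\<Sum>k=h..<?N. (pi * \<bar>s\<bar>) / \<theta> ^ k)"
    proof (rule sum_mono)
      fix k assume "k \<in> {h..<?N}"
      then have "b k = lam * \<theta> ^ m / \<theta> ^ k" by (simp add: b_def)
      then have "t / \<theta> ^ k - b k = s / \<theta> ^ k" by (simp add: t_def add_divide_distrib)
      then show "\<bar>abs_cos (t / \<theta> ^ k) - abs_cos (b k)\<bar> \<le> pi * \<bar>s\<bar> / \<theta> ^ k"
        using abs_cos_diff_le[of "t / \<theta> ^ k" "b k"] \<theta>0 by simp
    qed
    also have "\<dots> \<le> E" unfolding E_def by (rule sum_inverse_power_le) simp
    finally show ?thesis unfolding b by simp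
  qed
  have 1: "\<bar>cos_product t - A * (V * cos_product (lam / \<theta>))\<bar> \<le> pi * \<epsilon> + E"
  proof (rule LIMSEQ_le_const2)
    have "(\<lambda>n. \<Prod>k<Suc m + n. abs_cos (t / \<theta> ^ k)) \<longlonglongrightarrow> cos_product t"
      using LIMSEQ_ignore_initial_segment[OF cos_product_LIMSEQ[of t], of "Suc m"] by (simp add: add.commute)
    then show "(\<lambda>n. \<bar>(\<Prod>k<Suc m + n. abs_cos (t / \<theta> ^ k)) - A * (V * (\<Prod>k<n. abs_cos (lam / \<theta> / \<theta> ^ k)))\<bar>)
        \<longlonglongrightarrow> \<bar>cos_product t - A * (V * cos_product (lam / \<theta>))\<bar>"
      by (intro tendsto_intros cos_product_LIMSEQ)
  qed (use fin in auto)
  \<comment> \<open>Undoing the truncation of \<open>A\<close> here and that of \<open>V\<close>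
    below costs the same two errors a second time; hence the factors 2 in the final bound.\<close>
  have 2: "\<bar>A - cos_product s\<bar> \<le> E"
  proof (rule LIMSEQ_le_const2[OF tendsto_rabs[OF tendsto_diff[OF tendsto_const cos_product_LIMSEQ]]], intro exI allI impI)
    fix n assume n: "h \<le> n"
    define b where "b k = (if k < h then s / \<theta> ^ k else 0)" for k
    have "(\<Prod>k<n. abs_cos (b k)) = (\<Prod>k<h. abs_cos (b k)) * (\<Prod>k=h..<n. abs_cos (b k))"
      by (subst prod.atLeastLessThan_concat[of 0 h n, symmetric, unfolded atLeast0LessThan]) (use n in \<open>auto simp: atLeast0LessThan\<close>)
    also have "\<dots> = A" by (simp add: A_def b_def)
    finally have "A = (\<Prod>k<n. abs_cos (b k))" by simp
    then have "\<bar>A - (\<Prod>k<n. abs_cos (s / \<theta> ^ k))\<bar> \<le> (\<Sum>k<n. \<bar>abs_cos (b k) - abs_cos (s / \<theta> ^ k)\<bar>)"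
      using prod_abs_cos_diff_le by simp
    also have "\<dots> = (\<Sum>k<h. \<bar>abs_cos (b k) - abs_cos (s / \<theta> ^ k)\<bar>) + (\<Sum>k=h..<n. \<bar>abs_cos (b k) - abs_cos (s / \<theta> ^ k)\<bar>)"
      by (subst sum.atLeastLessThan_concat[of 0 h n, symmetric, unfolded atLeast0LessThan]) (use n in \<open>auto simp: atLeast0LessThan\<close>)
    also have "\<dots> = (\<Sum>k=h..<n. \<bar>abs_cos 0 - abs_cos (s / \<theta> ^ k)\<bar>)" by (simp add: b_def)
    also have "\<dots> \<le> (\<Sum>k=h..<n. (pi * \<bar>s\<bar>) / \<theta> ^ k)"
    proof (rule sum_mono)
      fix k show "\<bar>abs_cos 0 - abs_cos (s / \<theta> ^ k)\<bar> \<le> (pi * \<bar>s\<bar>) / \<theta> ^ k"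
        using abs_cos_diff_le[of 0 "s / \<theta> ^ k"] \<theta>0 by simp
    qed
    also have "\<dots> \<le> E" unfolding E_def by (rule sum_inverse_power_le) simp
    finally show "\<bar>A - (\<Prod>k<n. abs_cos (s / \<theta> ^ k))\<bar> \<le> E" .
  qed
  have 3: "\<bar>V - cos_product_up lam\<bar> \<le> pi * \<epsilon>"
  proof (rule LIMSEQ_le_const2[OF tendsto_rabs[OF tendsto_diff[OF tendsto_const cos_product_up_LIMSEQ]]], intro exI allI impI)
    fix n assume n: "Suc L \<le> n"
    define b where "b k = (if k < Suc L then lam * \<theta> ^ k else 0)" for k
    have "(\<Prod>k<n. abs_cos (b k)) = (\<Prod>k<Suc L. abs_cos (b k)) * (\<Prod>k=Suc L..<n. abs_cos (b k))"
      by (subst prod.atLeastLessThan_concat[of 0 "Suc L" n, symmetric, unfolded atLeast0LessThan]) (use n in \<open>auto simp: atLeast0LessThan\<close>)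
    also have "(\<Prod>k<Suc L. abs_cos (b k)) = V" unfolding V_def by (intro prod.cong) (auto simp: b_def)
    also have "(\<Prod>k=Suc L..<n. abs_cos (b k)) = 1" by (intro prod.neutral) (auto simp: b_def)
    finally have "V = (\<Prod>k<n. abs_cos (b k))" by simp
    then have "\<bar>V - (\<Prod>k<n. abs_cos (lam * \<theta> ^ k))\<bar> \<le> (\<Sum>k<n. \<bar>abs_cos (b k) - abs_cos (lam * \<theta> ^ k)\<bar>)"
      using prod_abs_cos_diff_le by simp
    also have "\<dots> = (\<Sum>k<Suc L. \<bar>abs_cos (b k) - abs_cos (lam * \<theta> ^ k)\<bar>) + (\<Sum>k=Suc L..<n. \<bar>abs_cos (b k) - abs_cos (lam * \<theta> ^ k)\<bar>)"
      by (subst sum.atLeastLessThan_concat[of 0 "Suc L" n, symmetric, unfolded atLeast0LessThan]) (use n in \<open>auto simp: atLeast0LessThan\<close>)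
    also have "(\<Sum>k<Suc L. \<bar>abs_cos (b k) - abs_cos (lam * \<theta> ^ k)\<bar>) = 0"
      by (intro sum.neutral) (auto simp: b_def)
    also have "(\<Sum>k=Suc L..<n. \<bar>abs_cos (b k) - abs_cos (lam * \<theta> ^ k)\<bar>) \<le> (\<Sum>k=Suc L..<n. pi * d k)"
    proof (rule sum_mono)
      fix k assume "k \<in> {Suc L..<n}"
      then show "\<bar>abs_cos (b k) - abs_cos (lam * \<theta> ^ k)\<bar> \<le> pi * d k"
        using abs_cos_add_diff_le[of "lam * \<theta> ^ k" 0] by (simp add: b_def d_def abs_minus_commute)
    qed
    also have "\<dots> = pi * (\<Sum>k=Suc L..<n. d k)" by (simp add: sum_distrib_left)
    also have "\<dots> \<le> pi * (\<Sum>k=L..<n. d k)"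
      by (intro mult_left_mono sum_mono2) (auto simp: d_def)
    also have "\<dots> \<le> pi * \<epsilon>" by (rule mult_left_mono[OF tl]) simp
    finally show "\<bar>V - (\<Prod>k<n. abs_cos (lam * \<theta> ^ k))\<bar> \<le> pi * \<epsilon>" by simp
  qed
  have "0 \<le> A" "A \<le> 1" "0 \<le> V" "V \<le> 1" unfolding A_def V_def by (rule prod_abs_cos_bounds)+
  then have A: "\<bar>A\<bar> \<le> 1" "\<bar>V\<bar> \<le> 1" by simp_all
  have "\<bar>A * (V * cos_product (lam / \<theta>)) - cos_product s * (cos_product_up lam * cos_product (lam / \<theta>))\<bar>
      \<le> \<bar>A - cos_product s\<bar> + \<bar>V * cos_product (lam / \<theta>) - cos_product_up lam * cos_product (lam / \<theta>)\<bar>"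
    using A cos_product_bounds by (intro abs_mult_diff_le) (auto simp: abs_mult intro!: mult_le_one)
  also have "\<bar>V * cos_product (lam / \<theta>) - cos_product_up lam * cos_product (lam / \<theta>)\<bar> = \<bar>V - cos_product_up lam\<bar> * cos_product (lam / \<theta>)"
    using cos_product_bounds[of "lam / \<theta>"] by (simp add: left_diff_distrib[symmetric] abs_mult)
  also have "\<dots> \<le> \<bar>V - cos_product_up lam\<bar> * 1" using cos_product_bounds by (intro mult_left_mono) auto
  finally have "\<bar>A * (V * cos_product (lam / \<theta>)) - cos_product s * (cos_product_up lam * cos_product (lam / \<theta>))\<bar> \<le> E + pi * \<epsilon>"
    using 2 3 by simp
  with 1 have "\<bar>cos_product t - cos_product s * (cos_product_up lam * cos_product (lam / \<theta>))\<bar> \<le> 2 * pi * \<epsilon> + 2 * E"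
    by linarith
  then show ?thesis unfolding E t_def by (simp add: mult_ac)
qed

section \<open>Countability of \<open>pisot_set\<close>\<close>

lemma ex_power_scale:
  assumes "0 < c" "0 < x" shows "\<exists>k::int. c \<le> x * \<theta> powi k \<and> x * \<theta> powi k < c * \<theta>"
proof -
  have \<theta>0: "0 < \<theta>" "1 < \<theta>" using \<theta> by auto
  define k where "k = \<lceil>log \<theta> (c / x)\<rceil>"
  have p: "\<theta> powi k = \<theta> powr k" using \<theta>0 by (simp add: powr_real_of_int')
  have "c / x = \<theta> powr (log \<theta> (c / x))" using assms \<theta>0 by simp
  also have "\<dots> \<le> \<theta> powr k" using \<theta>0 unfolding k_def by (intro powr_mono) linarith+
  finally have 1: "c / x \<le> \<theta> powi k" by (simp add: p)
  have "\<theta> powr k < \<theta> powr (log \<theta> (c / x) + 1)" using \<theta>0 unfolding k_def by (intro powr_less_mono) linarith+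
  also have "\<dots> = c / x * \<theta>" using assms \<theta>0 by (simp add: powr_add)
  finally have 2: "\<theta> powi k < c / x * \<theta>" by (simp add: p)
  show ?thesis using 1 2 assms by (intro exI[of _ k]) (simp add: field_simps)
qed

text \<open>A nonzero \<open>x\<close> this small, multiplied repeatedly by \<theta>, must enter the
  interval from \<open>1 / (2 * \<theta>)\<close> to 1/2. There the distance to the integers is the
  absolute value, contradicting \<open>small\<close>.\<close>

lemma eq_0_if_int_dist_small:
  assumes small: "\<And>k. int_dist (x * \<theta> ^ k) < 1 / (2 * \<theta>)" and x: "\<bar>x\<bar> < 1 / (2 * \<theta>)"
  shows "x = 0"
proof (rule ccontr)
  assume "x \<noteq> 0"
  define c where "c = 1 / (2 * \<theta>)"
  have c: "0 < c" "c * \<theta> = 1/2" using \<theta> by (auto simp: c_def)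
  obtain k where k: "c \<le> \<bar>x\<bar> * \<theta> powi k" "\<bar>x\<bar> * \<theta> powi k < c * \<theta>"
    using ex_power_scale[of c "\<bar>x\<bar>"] \<open>x \<noteq> 0\<close> c by auto
  have "k \<ge> 0"
  proof (rule ccontr)
    assume "\<not> k \<ge> 0"
    then have "\<theta> powi k \<le> \<theta> powi 0" using \<theta> by (intro power_int_increasing) auto
    then have "\<bar>x\<bar> * \<theta> powi k \<le> \<bar>x\<bar> * 1" by (intro mult_left_mono) auto
    then show False using k x by (simp add: c_def)
  qed
  then have "\<theta> powi k = \<theta> ^ nat k" by (simp add: power_int_def)
  then have "\<bar>x * \<theta> ^ nat k\<bar> = \<bar>x\<bar> * \<theta> powi k" using \<theta> by (simp add: abs_mult)
  then have "c \<le> int_dist (x * \<theta> ^ nat k)" using k c int_dist_eq_abs[of "x * \<theta> ^ nat k"] by simp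
  then show False using small[of "nat k"] by (simp add: c_def)
qed

text \<open>Multiplication by \<open>\<theta>\<close> is expansive, so an element is determined by a late nearest integer.\<close>

lemma countable_pisot_set: "countable pisot_set"
proof -
  have "\<exists>k0. \<forall>k\<ge>k0. int_dist (lam * \<theta> ^ k) < 1 / (4 * \<theta>)" if "lam \<in> pisot_set" for lam
  proof -
    have "(\<lambda>k. int_dist (lam * \<theta> ^ k)) \<longlonglongrightarrow> 0"
      using that by (intro summable_LIMSEQ_zero) (simp add: pisot_set_def)
    moreover have "0 < 1 / (4 * \<theta>)" using \<theta> by simp
    ultimately show ?thesis using order_tendstoD(2) by (fastforce simp: eventually_sequentially)
  qed
  \<comment> \<open>A stage after which the distances are so small that those of a difference of two
    elements stay below the threshold of \<open>eq_0_if_int_dist_small\<close>.\<close>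
  then obtain k0 where k0: "\<And>lam k. lam \<in> pisot_set \<Longrightarrow> k \<ge> k0 lam \<Longrightarrow> int_dist (lam * \<theta> ^ k) < 1 / (4 * \<theta>)"
    by metis
  show ?thesis
  proof (rule countableI')
    show "inj_on (\<lambda>lam. to_nat (k0 lam, round (lam * \<theta> ^ k0 lam))) pisot_set"
    proof (rule inj_onI)
      fix a b assume ab: "a \<in> pisot_set" "b \<in> pisot_set"
        "to_nat (k0 a, round (a * \<theta> ^ k0 a)) = to_nat (k0 b, round (b * \<theta> ^ k0 b))"
      define k where "k = k0 a"
      have k: "k0 b = k" "round (a * \<theta> ^ k) = round (b * \<theta> ^ k)" using ab by (auto simp: k_def)
      \<comment> \<open>The equal nearest integers cancel, so the difference at stage
        \<open>k\<close> is small as a real number, and at later stages it is small modulo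
        1.\<close>
      have "(a - b) * \<theta> ^ k = 0"
      proof (rule eq_0_if_int_dist_small)
        fix j
        have "(a - b) * \<theta> ^ k * \<theta> ^ j = a * \<theta> ^ (k + j) + - (b * \<theta> ^ (k + j))"
          by (simp add: power_add algebra_simps)
        then have "int_dist ((a - b) * \<theta> ^ k * \<theta> ^ j) \<le> int_dist (a * \<theta> ^ (k + j)) + int_dist (b * \<theta> ^ (k + j))"
          using int_dist_add_le[of "a * \<theta> ^ (k + j)" "- (b * \<theta> ^ (k + j))"] int_dist_minus by simp
        also have "\<dots> < 1 / (4 * \<theta>) + 1 / (4 * \<theta>)"
          using k0[OF ab(1), of "k + j"] k0[OF ab(2), of "k + j"] k by (intro add_strict_mono) (auto simp: k_def)
        finally show "int_dist ((a - b) * \<theta> ^ k * \<theta> ^ j) < 1 / (2 * \<theta>)" using \<theta> by (simp add: field_simps)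
      next
        have "\<bar>(a - b) * \<theta> ^ k\<bar> \<le> int_dist (a * \<theta> ^ k) + int_dist (b * \<theta> ^ k)"
          using k by (simp add: int_dist_def algebra_simps)
        also have "\<dots> < 1 / (4 * \<theta>) + 1 / (4 * \<theta>)"
          using k0[OF ab(1), of k] k0[OF ab(2), of k] k by (intro add_strict_mono) (auto simp: k_def)
        finally show "\<bar>(a - b) * \<theta> ^ k\<bar> < 1 / (2 * \<theta>)" using \<theta> by (simp add: field_simps)
      qed
      then show "a = b" using \<theta> by simp
    qed
  qed
qed

text \<open>Taking logarithms in the lower bound for the partial products bounds the sum of squares
  by \<open>- 2 * ln \<delta>\<close>; Pisot's theorem upgrades this to summability of the
  distances.\<close>

lemma summable_if_cos_product_pos:
  assumes "0 < \<delta>" and low: "\<And>L. \<delta> \<le> (\<Prod>l<L. abs_cos (lam * \<theta> ^ l))"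
  shows "lam \<in> pisot_set"
proof -
  have "summable (\<lambda>k. (int_dist (lam * \<theta> ^ k))\<^sup>2)"
  proof (rule summableI_nonneg_bounded)
    fix n
    have "\<delta> \<le> (\<Prod>l<n. exp (- ((int_dist (lam * \<theta> ^ l))\<^sup>2 / 2)))"
      by (rule order_trans[OF low prod_mono]) (simp add: abs_cos_le_exp)
    also have "\<dots> = exp (- (\<Sum>l<n. (int_dist (lam * \<theta> ^ l))\<^sup>2) / 2)"
      by (simp add: exp_sum[symmetric] sum_negf sum_divide_distrib)
    finally have "ln \<delta> \<le> ln (exp (- (\<Sum>l<n. (int_dist (lam * \<theta> ^ l))\<^sup>2) / 2))"
      using \<open>0 < \<delta>\<close> by (subst ln_le_cancel_iff) auto
    then show "(\<Sum>l<n. (int_dist (lam * \<theta> ^ l))\<^sup>2) \<le> - 2 * ln \<delta>" by simp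
  qed simp
  then show ?thesis
    unfolding pisot_set_def using square_summable_imp_summable_int_dist[OF \<theta>] by simp
qed

text \<open>Since \<open>1 + \<theta> * \<kappa> = \<theta>\<close>, the sequence
  \<open>z m = lam * \<theta> ^ m / \<kappa>\<close> satisfies
  \<open>z (Suc m) = z m + lam * \<theta> ^ Suc m\<close>. Its increments are integers up to
  summable errors, so it converges modulo 1.\<close>

lemma ex_limit_int_dist:
  assumes "lam \<in> pisot_set"
  shows "\<exists>\<beta>. (\<lambda>m. int_dist (lam * \<theta> ^ m / (1 - 1 / \<theta>) - \<beta>)) \<longlonglongrightarrow> 0"
proof -
  define \<kappa> where "\<kappa> = 1 - 1 / \<theta>"
  have \<kappa>: "\<kappa> \<noteq> 0" "\<theta> * \<kappa> = \<theta> - 1" using \<theta> by (auto simp: \<kappa>_def field_simps)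
  define e where "e k = lam * \<theta> ^ k - round (lam * \<theta> ^ k)" for k
  define z where "z m = lam * \<theta> ^ m / \<kappa>" for m
  have zS: "z (Suc m) = z m + lam * \<theta> ^ Suc m" for m
  proof -
    have "z (Suc m) = lam * \<theta> ^ m * (1 + \<theta> * \<kappa>) / \<kappa>" by (simp add: z_def \<kappa>(2))
    also have "\<dots> = z m + lam * \<theta> ^ Suc m" using \<kappa>(1) by (simp add: z_def add_divide_distrib distrib_left)
    finally show ?thesis .
  qed
  have "summable (\<lambda>k. \<bar>e k\<bar>)" using assms by (simp add: pisot_set_def e_def int_dist_def)
  then have "summable e" by (rule summable_rabs_cancel)
  then have sm: "summable (\<lambda>k. e (Suc k))" by (simp add: summable_Suc_iff)
  define \<beta> where "\<beta> = z 0 + (\<Sum>k. e (Suc k))"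
  have "\<exists>n::int. z m = z 0 + of_int n + (\<Sum>k<m. e (Suc k))" for m
  proof (induction m)
    case 0 show ?case by (intro exI[of _ 0]) simp
  next
    case (Suc m)
    then obtain n :: int where "z m = z 0 + of_int n + (\<Sum>k<m. e (Suc k))" by blast
    then have "z (Suc m) = z 0 + of_int (n + round (lam * \<theta> ^ Suc m)) + (\<Sum>k<Suc m. e (Suc k))"
      unfolding zS by (simp add: e_def)
    then show ?case by blast
  qed
  then obtain n :: "nat \<Rightarrow> int" where n: "\<And>m. z m = z 0 + of_int (n m) + (\<Sum>k<m. e (Suc k))" by metis
  have "int_dist (z m - \<beta>) \<le> \<bar>(\<Sum>k<m. e (Suc k)) - (\<Sum>k. e (Suc k))\<bar>" for m
  proof -
    have "z m - \<beta> - of_int (n m) = (\<Sum>k<m. e (Suc k)) - (\<Sum>k. e (Suc k))"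
      unfolding \<beta>_def using n[of m] by linarith
    then show ?thesis using int_dist_le[of "z m - \<beta>" "n m"] by simp
  qed
  moreover have "(\<lambda>m. \<bar>(\<Sum>k<m. e (Suc k)) - (\<Sum>k. e (Suc k))\<bar>) \<longlonglongrightarrow> 0"
    using summable_LIMSEQ[OF sm] by (intro tendsto_rabs_zero LIM_zero)
  ultimately have "(\<lambda>m. int_dist (z m - \<beta>)) \<longlonglongrightarrow> 0"
    by (intro Lim_null_comparison[of "\<lambda>m. int_dist (z m - \<beta>)"]) auto
  then show ?thesis by (auto simp: z_def \<kappa>_def)
qed

text \<open>Determined only modulo 1; the choice is harmless because \<open>cluster_values\<close>
  runs over all integers \<open>q\<close>.\<close>

definition drift :: "real \<Rightarrow> real" where
  "drift lam = (SOME \<beta>. (\<lambda>m. int_dist (lam * \<theta> ^ m / (1 - 1 / \<theta>) - \<beta>)) \<longlonglongrightarrow> 0)"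

lemma drift: "lam \<in> pisot_set \<Longrightarrow> (\<lambda>m. int_dist (lam * \<theta> ^ m / (1 - 1 / \<theta>) - drift lam)) \<longlonglongrightarrow> 0"
  unfolding drift_def by (rule someI_ex[OF ex_limit_int_dist])

section \<open>The loss per scale, and the set of possible limits\<close>

definition contraction :: real where "contraction = cos (pi / \<theta>\<^sup>2)"

lemma contraction_bounds: "0 < contraction" "contraction < 1"
proof -
  have "2 * 2 < \<theta> * \<theta>" using \<theta> by (intro mult_strict_mono) auto
  then have "pi / \<theta>\<^sup>2 < pi / 2" by (intro divide_strict_left_mono) (auto simp: power2_eq_square)
  moreover from this have "pi / \<theta>\<^sup>2 \<le> pi" using pi_gt_zero by linarith
  moreover have "0 < pi / \<theta>\<^sup>2" using \<theta> by simp
  ultimately show "0 < contraction" "contraction < 1"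
    using cos_gt_zero[of "pi / \<theta>\<^sup>2"] cos_monotone_0_pi[of 0 "pi / \<theta>\<^sup>2"]
    by (simp_all add: contraction_def)
qed

text \<open>The factor with \<open>k = 1\<close> of the second product is
  \<open>cos (pi * y)\<close>, where \<open>y = |lam| / \<theta>\<^sup>2\<close> lies between
  \<open>1 / \<theta>\<^sup>2\<close> and 1/2, a range on which it decreases. Its value at the left
  end is \<open>contraction\<close>; the other factors are at most 1.\<close>

lemma cluster_factor_le:
  assumes "1 \<le> \<bar>lam\<bar>" "\<bar>lam\<bar> \<le> \<theta>"
  shows "cos_product_up lam * cos_product (lam / \<theta>) \<le> contraction"
proof -
  have \<theta>0: "0 < \<theta>" "2 * 2 < \<theta> * \<theta>"
    using \<theta> mult_strict_mono[of 2 \<theta> 2 \<theta>] by simp_all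
  define y where "y = \<bar>lam\<bar> / \<theta>\<^sup>2"
  have y: "1 / \<theta>\<^sup>2 \<le> y" "y < 1 / 2"
  proof -
    show "1 / \<theta>\<^sup>2 \<le> y" unfolding y_def using assms \<theta>0 by (intro divide_right_mono) auto
    have "y \<le> \<theta> / \<theta>\<^sup>2" unfolding y_def using assms \<theta>0 by (intro divide_right_mono) auto
    also have "\<dots> < 1/2" using \<theta> by (simp add: power2_eq_square field_simps)
    finally show "y < 1 / 2" .
  qed
  have "cos_product (lam / \<theta>) \<le> (\<Prod>k\<in>{1}. abs_cos (lam / \<theta> / \<theta> ^ k))" by (rule cos_product_le) simp
  also have "\<dots> = \<bar>cos (pi * y)\<bar>"
    by (cases "lam \<ge> 0") (auto simp: abs_cos_def y_def power2_eq_square abs_if)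
  also have "\<dots> = cos (pi * y)"
  proof -
    have "0 \<le> pi * y" "pi * y \<le> pi / 2" using y mult_left_mono[of y "1 / 2" pi] by (auto simp: y_def)
    then show ?thesis using cos_ge_zero[of "pi * y"] by simp
  qed
  also have "\<dots> \<le> contraction" unfolding contraction_def
  proof (rule cos_monotone_0_pi_le)
    show "0 \<le> pi / \<theta>\<^sup>2" using \<theta>0 by simp
    show "pi / \<theta>\<^sup>2 \<le> pi * y" using mult_left_mono[OF y(1), of pi] by simp
    show "pi * y \<le> pi" using y by simp
  qed
  finally have "cos_product (lam / \<theta>) \<le> contraction" .
  moreover have "cos_product_up lam * cos_product (lam / \<theta>) \<le> 1 * cos_product (lam / \<theta>)"
    using cos_product_bounds cos_product_up_bounds by (intro mult_right_mono) auto
  ultimately show ?thesis by simp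
qed

text \<open>\<open>L\<close> is fixed first, from the tail of the summable series for
  \<open>lam\<close>. Then \<open>L \<le> m j\<close> holds eventually, and the error with the
  constant \<open>\<theta> ^ L\<close> vanishes by the assumption on \<open>s\<close>.\<close>

lemma cos_product_split_tendsto:
  assumes lam: "lam \<in> pisot_set" and m: "filterlim m at_top sequentially"
    and s: "(\<lambda>j. s j / \<theta> ^ m j) \<longlonglongrightarrow> 0"
  shows "(\<lambda>j. cos_product (lam * \<theta> ^ m j + s j) - cos_product_up lam * cos_product (lam / \<theta>) * cos_product (s j)) \<longlonglongrightarrow> 0"
proof (rule LIMSEQ_I)
  fix r :: real assume r: "0 < r"
  define \<epsilon> where "\<epsilon> = r / (4 * pi)"
  have \<epsilon>: "0 < \<epsilon>" using r by (simp add: \<epsilon>_def)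
  obtain L where L: "norm (\<Sum>l. int_dist (lam * \<theta> ^ (l + L))) < \<epsilon>"
    using suminf_exist_split[OF \<epsilon>, of "\<lambda>l. int_dist (lam * \<theta> ^ l)"] lam by (auto simp: pisot_set_def)
  have "(\<lambda>j. 4 * pi * \<theta> ^ L * \<bar>s j / \<theta> ^ m j\<bar>) \<longlonglongrightarrow> 0"
    by (intro tendsto_mult_right_zero tendsto_rabs_zero s)
  then have 1: "eventually (\<lambda>j. 4 * pi * \<theta> ^ L * \<bar>s j / \<theta> ^ m j\<bar> < r / 2) sequentially"
    by (rule order_tendstoD) (use r in simp)
  have 2: "eventually (\<lambda>j. L \<le> m j) sequentially" using m by (simp add: filterlim_at_top)
  have "eventually (\<lambda>j. norm (cos_product (lam * \<theta> ^ m j + s j) - cos_product_up lam * cos_product (lam / \<theta>) * cos_product (s j) - 0) < r) sequentially"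
    using 1 2
  proof eventually_elim
    case (elim j)
    have "\<bar>cos_product (lam * \<theta> ^ m j + s j) - cos_product_up lam * cos_product (lam / \<theta>) * cos_product (s j)\<bar>
      \<le> 2 * pi * \<epsilon> + 4 * pi * \<bar>s j\<bar> * \<theta> ^ L / \<theta> ^ m j"
      by (rule cos_product_split[OF lam elim(2)]) (use L in simp)
    also have "2 * pi * \<epsilon> = r / 2" by (simp add: \<epsilon>_def)
    also have "4 * pi * \<bar>s j\<bar> * \<theta> ^ L / \<theta> ^ m j = 4 * pi * \<theta> ^ L * \<bar>s j / \<theta> ^ m j\<bar>" using \<theta> by simp
    finally show ?case using elim(1) by simp
  qed
  then show "\<exists>no. \<forall>j\<ge>no. norm (cos_product (lam * \<theta> ^ m j + s j) - cos_product_up lam * cos_product (lam / \<theta>) * cos_product (s j) - 0) < r"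
    by (simp add: eventually_sequentially)
qed

text \<open>The possible limits when \<open>t j / (1 - 1 / \<theta>)\<close> tends to
  \<open>b\<close> modulo 1: \<open>ls\<close> lists the leading coefficients split off, and the
  limit of the bounded rest, divided by \<open>1 - 1 / \<theta>\<close>, is \<open>b\<close> minus
  their drifts up to an integer \<open>q\<close>.\<close>

definition cluster_values :: "real \<Rightarrow> real set" where
  "cluster_values b = (\<lambda>(ls, q). (\<Prod>lam\<leftarrow>ls. cos_product_up lam * cos_product (lam / \<theta>)) *
     cos_product ((1 - 1 / \<theta>) * (b - (\<Sum>lam\<leftarrow>ls. drift lam) + of_int q))) ` (lists pisot_set \<times> UNIV)"

lemma cluster_values_Cons:
  assumes "lam \<in> pisot_set" "c \<in> cluster_values (b - drift lam)"
  shows "cos_product_up lam * cos_product (lam / \<theta>) * c \<in> cluster_values b"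
proof -
  obtain ls q where "ls \<in> lists pisot_set"
    "c = (\<Prod>lam\<leftarrow>ls. cos_product_up lam * cos_product (lam / \<theta>)) *
       cos_product ((1 - 1 / \<theta>) * (b - drift lam - (\<Sum>lam\<leftarrow>ls. drift lam) + of_int q))"
    using assms(2) by (auto simp: cluster_values_def)
  then show ?thesis unfolding cluster_values_def
    using assms(1) by (intro image_eqI[of _ _ "(lam # ls, q)"]) (auto simp: diff_diff_eq mult.assoc)
qed

lemma countable_cluster_values: "countable (cluster_values b)"
  unfolding cluster_values_def by (intro countable_image countable_SIGMA countable_lists countable_pisot_set) auto

text \<open>Each unbounded scale splits off one factor \<open>lam\<close>, which costs a definite factor of the product,
  so the process stops after finitely many steps.\<close>

lemma cos_product_subsequence_limit:
  assumes "contraction ^ N < \<delta>"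
    and "\<And>j. \<delta> \<le> cos_product (t j)"
    and "(\<lambda>j. int_dist (t j / (1 - 1 / \<theta>) - b)) \<longlonglongrightarrow> 0"
  shows "\<exists>r. strict_mono r \<and> (\<exists>c\<in>cluster_values b. (\<lambda>j. cos_product (t (r j))) \<longlonglongrightarrow> c)"
  using assms
proof (induction N arbitrary: \<delta> t b)
  \<comment> \<open>With \<open>N = 0\<close> the lower bound would exceed 1: no further factor can
    be split off.\<close>
  case 0
  then show ?case using cos_product_bounds(2)[of "t 0"] "0"(2)[of 0] by simp
next
  case (Suc N)
  define \<kappa> where "\<kappa> = 1 - 1 / \<theta>"
  have \<kappa>: "0 < \<kappa>" using \<theta> by (simp add: \<kappa>_def)
  have \<delta>: "0 < \<delta>" using Suc(2) contraction_bounds by (meson less_trans zero_less_power)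
  show ?case
  proof (cases "filterlim (\<lambda>j. \<bar>t j\<bar>) at_top sequentially")
    \<comment> \<open>Some subsequence stays bounded. A limit \<open>s\<close> of it satisfies the
      congruence exactly, so the empty list of coefficients works.\<close>
    case False
    then obtain B where "\<exists>\<^sub>F j in sequentially. \<bar>t j\<bar> < B"
      by (auto simp: filterlim_at_top not_eventually not_le)
    then have "infinite {j. \<bar>t j\<bar> < B}" by (simp add: frequently_cofinite flip: cofinite_eq_sequentially)
    then obtain r1 :: "nat \<Rightarrow> nat" where r1: "strict_mono r1" "\<And>j. \<bar>t (r1 j)\<bar> < B"
      using infinite_enumerate by blast
    have "\<forall>j. (t \<circ> r1) j \<in> {-B..B}"
    proof
      fix j show "(t \<circ> r1) j \<in> {-B..B}" using r1(2)[of j] by (auto simp: abs_less_iff)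
    qed
    then obtain s r2 where r2: "strict_mono (r2 :: nat \<Rightarrow> nat)" "((t \<circ> r1) \<circ> r2) \<longlonglongrightarrow> s"
      using seq_compactE[OF compact_imp_seq_compact[OF compact_Icc]] by metis
    define r where "r = r1 \<circ> r2"
    have r: "strict_mono r" "(\<lambda>j. t (r j)) \<longlonglongrightarrow> s"
      using strict_mono_o[OF r1(1) r2(1)] r2(2) by (simp_all add: r_def o_def)
    have "int_dist (s / \<kappa> - b) \<le> 0"
    proof (rule LIMSEQ_le_const[of "\<lambda>j. \<bar>(s - t (r j)) / \<kappa>\<bar> + int_dist (t (r j) / \<kappa> - b)"])
      have "(\<lambda>j. \<bar>(s - t (r j)) / \<kappa>\<bar> + int_dist (t (r j) / \<kappa> - b)) \<longlonglongrightarrow> \<bar>(s - s) / \<kappa>\<bar> + 0"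
        using \<kappa> LIMSEQ_subseq_LIMSEQ[OF Suc(4) r(1)] by (intro tendsto_intros r) (auto simp: o_def \<kappa>_def)
      then show "(\<lambda>j. \<bar>(s - t (r j)) / \<kappa>\<bar> + int_dist (t (r j) / \<kappa> - b)) \<longlonglongrightarrow> 0" by simp
      have "int_dist (s / \<kappa> - b) \<le> \<bar>(s - t (r j)) / \<kappa>\<bar> + int_dist (t (r j) / \<kappa> - b)" for j
      proof -
        have "s / \<kappa> - b = (s - t (r j)) / \<kappa> + (t (r j) / \<kappa> - b)" by (simp add: diff_divide_distrib)
        then show ?thesis using int_dist_add_le int_dist_le_abs by (metis add_mono_thms_linordered_semiring(3) order_trans)
      qed
      then show "\<exists>N. \<forall>n\<ge>N. int_dist (s / \<kappa> - b) \<le> \<bar>(s - t (r n)) / \<kappa>\<bar> + int_dist (t (r n) / \<kappa> - b)" by blast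
    qed
    then have "int_dist (s / \<kappa> - b) = 0" using int_dist_nonneg by (simp add: order_antisym)
    then have "s / \<kappa> - b = of_int (round (s / \<kappa> - b))" by (simp add: int_dist_def)
    then have "s = \<kappa> * (b + of_int (round (s / \<kappa> - b)))" using \<kappa> by (simp add: field_simps)
    then have "cos_product s \<in> cluster_values b" unfolding cluster_values_def
      by (intro image_eqI[of _ _ "([], round (s / \<kappa> - b))"]) (auto simp: \<kappa>_def)
    then show ?thesis using r cos_product_tendsto[OF r(2)] by blast
  next
    case True
    have "eventually (\<lambda>j. 1 \<le> \<bar>t j\<bar>) sequentially" using True by (simp add: filterlim_at_top)
    then obtain J where J: "\<And>j. j \<ge> J \<Longrightarrow> 1 \<le> \<bar>t j\<bar>" by (auto simp: eventually_sequentially)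
    \<comment> \<open>The leading scale: \<open>t j / \<theta> ^ m j\<close> has size between 1 and
      \<theta>, so a subsequence converges to a nonzero leading coefficient
      \<open>lam\<close>.\<close>
    define m where "m j = nat \<lfloor>log \<theta> \<bar>t j\<bar>\<rfloor>" for j
    have m: "1 \<le> \<bar>t j / \<theta> ^ m j\<bar>" "\<bar>t j / \<theta> ^ m j\<bar> \<le> \<theta>" if "j \<ge> J" for j
    proof -
      have t1: "1 \<le> \<bar>t j\<bar>" using J that by simp
      have \<theta>1: "1 < \<theta>" using \<theta> by simp
      have lg: "0 \<le> log \<theta> \<bar>t j\<bar>" using t1 \<theta>1 by simp
      have mj: "real (m j) \<le> log \<theta> \<bar>t j\<bar>" "log \<theta> \<bar>t j\<bar> \<le> real (m j) + 1"
        using lg unfolding m_def by linarith+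
      have tj: "\<theta> powr (log \<theta> \<bar>t j\<bar>) = \<bar>t j\<bar>" using t1 \<theta>1 by simp
      have "\<theta> powr real (m j) \<le> \<bar>t j\<bar>" using powr_mono[OF mj(1), of \<theta>] \<theta>1 tj by simp
      then show "1 \<le> \<bar>t j / \<theta> ^ m j\<bar>" using \<theta>1 by (simp add: powr_realpow field_simps)
      have "\<bar>t j\<bar> \<le> \<theta> powr (real (m j) + 1)" using powr_mono[OF mj(2), of \<theta>] \<theta>1 tj by simp
      also have "\<dots> = \<theta> ^ m j * \<theta>" using \<theta>1 by (simp add: powr_add powr_realpow)
      finally show "\<bar>t j / \<theta> ^ m j\<bar> \<le> \<theta>" using \<theta>1 by (simp add: field_simps)
    qed
    have mlim: "filterlim m at_top sequentially"
    proof (subst filterlim_at_top, intro allI)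
      fix Z
      have "eventually (\<lambda>j. \<theta> ^ Suc Z \<le> \<bar>t j\<bar>) sequentially" using True by (simp only: filterlim_at_top)
      then show "eventually (\<lambda>j. Z \<le> m j) sequentially"
      proof eventually_elim
        case (elim j)
        have "log \<theta> (\<theta> ^ Suc Z) \<le> log \<theta> \<bar>t j\<bar>"
          using elim \<theta> zero_less_power[of \<theta> "Suc Z"] by (intro log_mono) linarith+
        then have "real (Suc Z) \<le> log \<theta> \<bar>t j\<bar>" using \<theta> by (simp only: log_nat_power[of \<theta> \<theta>]) simp
        then show ?case unfolding m_def by linarith
      qed
    qed
    define q where "q j = t (j + J) / \<theta> ^ m (j + J)" for j
    have "\<forall>j. q j \<in> {-\<theta>..\<theta>}"
    proof
      fix j show "q j \<in> {-\<theta>..\<theta>}"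
        using m(2)[of "j + J"] unfolding abs_le_iff q_def by simp
    qed
    then obtain lam r1 where r1: "strict_mono (r1 :: nat \<Rightarrow> nat)" "(q \<circ> r1) \<longlonglongrightarrow> lam"
      by (rule seq_compactE[OF compact_imp_seq_compact[OF compact_Icc]])
    define r2 where "r2 j = r1 j + J" for j
    have r2: "strict_mono r2" "(\<lambda>j. t (r2 j) / \<theta> ^ m (r2 j)) \<longlonglongrightarrow> lam" "\<And>j. r2 j \<ge> J"
      using r1 by (auto simp: r2_def q_def o_def strict_mono_def)
    have lamb: "1 \<le> \<bar>lam\<bar>" "\<bar>lam\<bar> \<le> \<theta>"
      using LIMSEQ_le_const[OF tendsto_rabs[OF r2(2)], of 1] LIMSEQ_le_const2[OF tendsto_rabs[OF r2(2)], of \<theta>]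
        m r2(3) by auto
    have m2: "filterlim (\<lambda>j. m (r2 j)) at_top sequentially"
      using filterlim_compose[OF mlim filterlim_subseq[OF r2(1)]] .
    \<comment> \<open>The lower bound \<open>\<delta>\<close> holds for the product of the factors
      with \<open>k = m - l\<close>, \<open>l < L\<close>, and passes to the limit for each fixed
      \<open>L\<close>.\<close>
    have lam: "lam \<in> pisot_set"
    proof (rule summable_if_cos_product_pos[OF \<delta>])
      fix L
      show "\<delta> \<le> (\<Prod>l<L. abs_cos (lam * \<theta> ^ l))"
      proof (rule tendsto_lowerbound)
        have "isCont (\<lambda>x. \<Prod>l<L. abs_cos (x * \<theta> ^ l)) lam"
          unfolding abs_cos_def by (intro continuous_intros)
        then show "(\<lambda>j. \<Prod>l<L. abs_cos (t (r2 j) / \<theta> ^ m (r2 j) * \<theta> ^ l)) \<longlonglongrightarrow> (\<Prod>l<L. abs_cos (lam * \<theta> ^ l))"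
          by (rule isCont_tendsto_compose[OF _ r2(2)])
        have "eventually (\<lambda>j. L \<le> m (r2 j)) sequentially" using m2 by (simp add: filterlim_at_top)
        then show "eventually (\<lambda>j. \<delta> \<le> (\<Prod>l<L. abs_cos (t (r2 j) / \<theta> ^ m (r2 j) * \<theta> ^ l))) sequentially"
        proof eventually_elim
          case (elim j)
          let ?m = "m (r2 j)"
          have "\<delta> \<le> cos_product (t (r2 j))" by (rule Suc(3))
          also have "\<dots> \<le> (\<Prod>k\<in>(\<lambda>l. ?m - l) ` {..<L}. abs_cos (t (r2 j) / \<theta> ^ k))"
            by (rule cos_product_le) simp
          also have "\<dots> = (\<Prod>l<L. abs_cos (t (r2 j) / \<theta> ^ (?m - l)))"
            by (rule prod.reindex_cong[of "\<lambda>l. ?m - l"]) (use elim in \<open>auto simp: inj_on_def\<close>)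
          also have "\<dots> = (\<Prod>l<L. abs_cos (t (r2 j) / \<theta> ^ ?m * \<theta> ^ l))"
          proof (rule prod.cong[OF refl])
            fix l assume "l \<in> {..<L}"
            then have "\<theta> ^ ?m = \<theta> ^ (?m - l) * \<theta> ^ l" using elim by (simp flip: power_add)
            then show "abs_cos (t (r2 j) / \<theta> ^ (?m - l)) = abs_cos (t (r2 j) / \<theta> ^ ?m * \<theta> ^ l)"
              using \<theta> by simp
          qed
          finally show ?case .
        qed
      qed simp
    qed
    define W where "W = cos_product_up lam * cos_product (lam / \<theta>)"
    have W: "0 \<le> W" "W \<le> contraction"
      unfolding W_def using cluster_factor_le[OF lamb] cos_product_bounds cos_product_up_bounds by auto
    define s where "s j = t (r2 j) - lam * \<theta> ^ m (r2 j)" for j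
    have "(\<lambda>j. t (r2 j) / \<theta> ^ m (r2 j) - lam) \<longlonglongrightarrow> 0" by (rule LIM_zero[OF r2(2)])
    then have s0: "(\<lambda>j. s j / \<theta> ^ m (r2 j)) \<longlonglongrightarrow> 0"
      using \<theta> by (simp add: s_def diff_divide_distrib)
    have split: "(\<lambda>j. cos_product (t (r2 j)) - W * cos_product (s j)) \<longlonglongrightarrow> 0"
      using cos_product_split_tendsto[OF lam m2 s0] by (simp add: s_def W_def)
    \<comment> \<open>The midpoint of \<open>contraction ^ N\<close> and
      \<open>\<delta> / contraction\<close>: large enough for the induction hypothesis, and with
      slack for the splitting error, which is small only eventually.\<close>
    define \<delta>' where "\<delta>' = (\<delta> / contraction + contraction ^ N) / 2"
    have "contraction ^ N < \<delta> / contraction" using Suc(2) contraction_bounds by (simp add: field_simps)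
    then have \<delta>': "contraction ^ N < \<delta>'" "contraction * \<delta>' < \<delta>"
      using contraction_bounds by (auto simp: \<delta>'_def field_simps)
    have "eventually (\<lambda>j. cos_product (t (r2 j)) - W * cos_product (s j) < \<delta> - contraction * \<delta>') sequentially"
      by (rule order_tendstoD(2)[OF split]) (use \<delta>' in simp)
    then obtain J2 where J2: "\<And>j. j \<ge> J2 \<Longrightarrow> cos_product (t (r2 j)) - W * cos_product (s j) < \<delta> - contraction * \<delta>'"
      by (auto simp: eventually_sequentially)
    define s' where "s' j = s (j + J2)" for j
    have low: "\<delta>' \<le> cos_product (s' j)" for j
    proof -
      have "contraction * \<delta>' < W * cos_product (s' j)"
        using J2[of "j + J2"] Suc(3)[of "r2 (j + J2)"] by (simp add: s'_def)
      also have "\<dots> \<le> contraction * cos_product (s' j)" using W cos_product_bounds by (intro mult_right_mono) auto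
      finally show ?thesis using contraction_bounds by simp
    qed
    have "(\<lambda>j. int_dist (t (r2 j) / \<kappa> - b) + int_dist (lam * \<theta> ^ m (r2 j) / \<kappa> - drift lam)) \<longlonglongrightarrow> 0 + 0"
      using LIMSEQ_subseq_LIMSEQ[OF Suc(4) r2(1)] filterlim_compose[OF drift[OF lam] m2]
      by (intro tendsto_add) (auto simp: o_def \<kappa>_def)
    then have "(\<lambda>j. int_dist (t (r2 j) / \<kappa> - b) + int_dist (lam * \<theta> ^ m (r2 j) / \<kappa> - drift lam)) \<longlonglongrightarrow> 0" by simp
    moreover have "int_dist (s j / \<kappa> - (b - drift lam)) \<le> int_dist (t (r2 j) / \<kappa> - b) + int_dist (lam * \<theta> ^ m (r2 j) / \<kappa> - drift lam)" for j
    proof -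
      have "s j / \<kappa> - (b - drift lam) = (t (r2 j) / \<kappa> - b) + - (lam * \<theta> ^ m (r2 j) / \<kappa> - drift lam)"
        by (simp add: s_def diff_divide_distrib)
      then show ?thesis using int_dist_add_le int_dist_minus by metis
    qed
    ultimately have "(\<lambda>j. int_dist (s j / \<kappa> - (b - drift lam))) \<longlonglongrightarrow> 0"
      by (intro Lim_null_comparison[of "\<lambda>j. int_dist (s j / \<kappa> - (b - drift lam))"
            "\<lambda>j. int_dist (t (r2 j) / \<kappa> - b) + int_dist (lam * \<theta> ^ m (r2 j) / \<kappa> - drift lam)"]) simp_all
    then have lim: "(\<lambda>j. int_dist (s' j / (1 - 1 / \<theta>) - (b - drift lam))) \<longlonglongrightarrow> 0"
      unfolding s'_def \<kappa>_def by (rule LIMSEQ_ignore_initial_segment)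
    obtain r3 c where r3: "strict_mono r3" "c \<in> cluster_values (b - drift lam)" "(\<lambda>j. cos_product (s' (r3 j))) \<longlonglongrightarrow> c"
      using Suc(1)[OF \<delta>'(1) low lim] by blast
    define r where "r j = r2 (r3 j + J2)" for j
    have r: "strict_mono r" using r2(1) r3(1) by (auto simp: r_def strict_mono_def)
    have "strict_mono (\<lambda>j. r3 j + J2)" using r3(1) by (auto simp: strict_mono_def)
    from LIMSEQ_subseq_LIMSEQ[OF split this]
    have "(\<lambda>j. cos_product (t (r j)) - W * cos_product (s' (r3 j))) \<longlonglongrightarrow> 0"
      by (simp add: o_def r_def s'_def)
    from tendsto_add[OF this tendsto_mult[OF tendsto_const r3(3), of W]]
    have "(\<lambda>j. cos_product (t (r j))) \<longlonglongrightarrow> W * c" by simp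
    moreover have "W * c \<in> cluster_values b" unfolding W_def by (rule cluster_values_Cons[OF lam r3(2)])
    ultimately show ?thesis using r by blast
  qed
qed

text \<open>Near a nonzero point \<open>x\<close> of the closure the products stay above
  \<open>|x| / 2\<close>, and the arguments divided by \<open>1 - 1 / \<theta>\<close> are integers,
  so the result on subsequences applies with \<open>b = 0\<close>. Only absolute values of the
  \<open>c n\<close> are given, hence both \<open>cluster_values 0\<close> and its negative.\<close>

theorem countable_closure_cos_product:
  fixes c :: "int \<Rightarrow> real"
  assumes c: "\<And>n. \<bar>c n\<bar> = cos_product ((1 - 1 / \<theta>) * of_int n)"
  shows "countable (closure (range c))"
proof -
  have "\<bar>x\<bar> \<in> cluster_values 0" if x: "x \<in> closure (range c)" "x \<noteq> 0" for x
  proof -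
    obtain f where f: "\<And>j. f j \<in> range c" "f \<longlonglongrightarrow> x" using x(1) closure_sequential by blast
    have "\<forall>j. \<exists>n. f j = c n" using f(1) by blast
    then obtain n where n: "\<And>j. f j = c (n j)" by metis
    have lim: "(\<lambda>j. \<bar>c (n j)\<bar>) \<longlonglongrightarrow> \<bar>x\<bar>" using tendsto_rabs[OF f(2)] by (simp add: n)
    have "eventually (\<lambda>j. \<bar>x\<bar> / 2 < \<bar>c (n j)\<bar>) sequentially" by (rule order_tendstoD(1)[OF lim]) (use x in simp)
    then obtain J where J: "\<And>j. j \<ge> J \<Longrightarrow> \<bar>x\<bar> / 2 < \<bar>c (n j)\<bar>" by (auto simp: eventually_sequentially)
    define t where "t j = (1 - 1 / \<theta>) * of_int (n (j + J))" for j
    have ct: "cos_product (t j) = \<bar>c (n (j + J))\<bar>" for j by (simp add: c t_def)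
    have lim': "(\<lambda>j. cos_product (t j)) \<longlonglongrightarrow> \<bar>x\<bar>" unfolding ct by (rule LIMSEQ_ignore_initial_segment[OF lim])
    obtain N where "contraction ^ N < \<bar>x\<bar> / 2"
      using real_arch_pow_inv[of "\<bar>x\<bar> / 2" contraction] contraction_bounds x by auto
    moreover have "\<bar>x\<bar> / 2 \<le> cos_product (t j)" for j using J[of "j + J"] by (simp add: ct)
    moreover have "int_dist (t j / (1 - 1 / \<theta>) - 0) = 0" for j
      using \<theta> by (simp add: t_def int_dist_def)
    then have "(\<lambda>j. int_dist (t j / (1 - 1 / \<theta>) - 0)) \<longlonglongrightarrow> 0" by simp
    ultimately obtain r d where r: "strict_mono r" "d \<in> cluster_values 0" "(\<lambda>j. cos_product (t (r j))) \<longlonglongrightarrow> d"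
      using cos_product_subsequence_limit[of N "\<bar>x\<bar> / 2" t 0] by blast
    have "(\<lambda>j. cos_product (t (r j))) \<longlonglongrightarrow> \<bar>x\<bar>" using LIMSEQ_subseq_LIMSEQ[OF lim' r(1)] by (simp add: o_def)
    then have "d = \<bar>x\<bar>" using r(3) LIMSEQ_unique by blast
    then show ?thesis using r(2) by simp
  qed
  then have "closure (range c) \<subseteq> {0} \<union> cluster_values 0 \<union> uminus ` cluster_values 0"
    by (force simp: abs_if image_iff split: if_splits)
  then show ?thesis
    by (rule countable_subset) (simp add: countable_cluster_values)
qed

end

section \<open>Lebesgue spaces on the circle\<close>

lemma prob_space_circle: "prob_space circle"
  by (rule prob_spaceI) (simp add: circle_def space_restrict_space emeasure_restrict_space)

interpretation circle: prob_space circle by (rule prob_space_circle)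

lemma borel_measurable_id_circle: "(\<lambda>x. x) \<in> borel_measurable circle"
  unfolding circle_def by (rule measurable_restrict_space1) simp

text \<open>Invariance of Haar measure. Replace \<open>y\<close> by \<open>c = frac y\<close>; the
  translated interval \<open>{- c..<1 - c}\<close> is cut at 0 and its negative piece is moved up by
  1, where \<open>G\<close> takes the same values by periodicity.\<close>

lemma nn_integral_circle_rotate:
  fixes g :: "real \<Rightarrow> ennreal"
  assumes g: "g \<in> borel_measurable circle"
  shows "(\<integral>\<^sup>+x. g (frac (x - y)) \<partial>circle) = (\<integral>\<^sup>+x. g x \<partial>circle)"
proof -
  define G where "G x = g (frac x)" for x
  have [measurable]: "G \<in> borel_measurable borel"
    unfolding G_def by (rule measurable_compose[OF measurable_frac_circle g])
  have per: "G (x + of_int k) = G x" for x k by (simp add: G_def frac_def)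
  define c where "c = frac y"
  have c: "0 \<le> c" "c < 1" by (auto simp: c_def frac_lt_1)
  have yc: "G (x - y) = G (x - c)" for x
    using per[of "x - c" "- \<lfloor>y\<rfloor>"] by (simp add: c_def frac_def algebra_simps)
  have shift: "(\<integral>\<^sup>+x. G x * indicator {a..<b} x \<partial>lborel) = (\<integral>\<^sup>+x. G (x - d) * indicator {a + d..<b + d} x \<partial>lborel)" for a b d :: real
  proof -
    have "(\<integral>\<^sup>+x. G x * indicator {a..<b} x \<partial>lborel) = ennreal \<bar>1\<bar> * (\<integral>\<^sup>+x. G (- d + 1 * x) * indicator {a..<b} (- d + 1 * x) \<partial>lborel)"
      by (rule nn_integral_real_affine) auto
    also have "\<dots> = (\<integral>\<^sup>+x. G (x - d) * indicator {a + d..<b + d} x \<partial>lborel)"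
      by (auto intro!: nn_integral_cong split: split_indicator)
    finally show ?thesis .
  qed
  have cat: "(\<integral>\<^sup>+x. H x * indicator {a..<b} x \<partial>lborel) + (\<integral>\<^sup>+x. H x * indicator {b..<d} x \<partial>lborel)
      = (\<integral>\<^sup>+x. H x * indicator {a..<d} x \<partial>lborel)" if "a \<le> b" "b \<le> d" and [measurable]: "H \<in> borel_measurable borel"
    for a b d :: real and H :: "real \<Rightarrow> ennreal"
    using that by (subst nn_integral_add[symmetric]) (auto intro!: nn_integral_cong split: split_indicator)
  have "(\<integral>\<^sup>+x. g (frac (x - y)) \<partial>circle) = (\<integral>\<^sup>+x. G (x - c) * indicator {0..<1} x \<partial>lborel)"
    unfolding circle_def by (subst nn_integral_restrict_space) (auto simp: yc[unfolded G_def] G_def)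
  also have "\<dots> = (\<integral>\<^sup>+x. G x * indicator {- c..<1 - c} x \<partial>lborel)"
    using shift[of "- c" "1 - c" c] by simp
  also have "\<dots> = (\<integral>\<^sup>+x. G x * indicator {- c..<0} x \<partial>lborel) + (\<integral>\<^sup>+x. G x * indicator {0..<1 - c} x \<partial>lborel)"
    using c by (intro cat[symmetric]) auto
  also have "(\<integral>\<^sup>+x. G x * indicator {- c..<0} x \<partial>lborel) = (\<integral>\<^sup>+x. G x * indicator {1 - c..<1} x \<partial>lborel)"
    using shift[of "- c" 0 1] per[of _ "-1"] by simp
  also have "\<dots> + (\<integral>\<^sup>+x. G x * indicator {0..<1 - c} x \<partial>lborel) = (\<integral>\<^sup>+x. G x * indicator {0..<1} x \<partial>lborel)"
    using c by (subst add.commute) (intro cat, auto)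
  also have "\<dots> = (\<integral>\<^sup>+x. g x \<partial>circle)"
    unfolding circle_def
    by (subst nn_integral_restrict_space)
      (auto intro!: nn_integral_cong simp: G_def frac_eq split: split_indicator)
  finally show ?thesis .
qed

text \<open>The supporting line of the convex power at \<open>b\<close>, obtained from Young's
  inequality with the exponents \<open>p\<close> and \<open>p / (p - 1)\<close>. Convexity and
  Jensen's inequality below both follow from it.\<close>

lemma powr_tangent:
  fixes x b p :: real
  assumes "0 \<le> x" "0 < b" "1 \<le> p"
  shows "b powr p + p * b powr (p - 1) * (x - b) \<le> x powr p"
proof (cases "p = 1")
  case True
  then show ?thesis using assms by simp
next
  case False
  then have p: "p > 1" using assms by simp
  define q where "q = p / (p - 1)"
  have q: "q > 1" "1 / p + 1 / q = 1" using p by (auto simp: q_def field_simps)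
  have "x * b powr (p - 1) \<le> x powr p / p + (b powr (p - 1)) powr q / q"
    using p q assms by (intro Youngs_inequality) auto
  also have "(b powr (p - 1)) powr q = b powr p" using p by (simp add: powr_powr q_def)
  finally have "p * (x * b powr (p - 1)) \<le> p * (x powr p / p + b powr p / q)" using p by (intro mult_left_mono) auto
  also have "\<dots> = x powr p + (p - 1) * b powr p" using p by (simp add: q_def field_simps)
  finally have "p * (x * b powr (p - 1)) \<le> x powr p + (p - 1) * b powr p" .
  moreover have "b powr p = b powr (p - 1) * b" using assms by (simp add: powr_diff)
  ultimately show ?thesis by (simp add: algebra_simps)
qed

lemma powr_convex:
  fixes u v l p :: real
  assumes "0 \<le> u" "0 \<le> v" "0 \<le> l" "l \<le> 1" "1 \<le> p"
  shows "(l * u + (1 - l) * v) powr p \<le> l * u powr p + (1 - l) * v powr p"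
proof (cases "l * u + (1 - l) * v = 0")
  case True then show ?thesis using assms by simp
next
  case False
  define b where "b = l * u + (1 - l) * v"
  have b: "b > 0" using False assms by (simp add: b_def add_nonneg_nonneg order_less_le)
  have "l * (b powr p + p * b powr (p - 1) * (u - b)) + (1 - l) * (b powr p + p * b powr (p - 1) * (v - b))
      \<le> l * u powr p + (1 - l) * v powr p"
    using assms b by (intro add_mono mult_left_mono powr_tangent) auto
  also have "l * (b powr p + p * b powr (p - 1) * (u - b)) + (1 - l) * (b powr p + p * b powr (p - 1) * (v - b))
      = b powr p + p * b powr (p - 1) * (l * u + (1 - l) * v - b)" by (simp add: algebra_simps)
  finally show ?thesis by (simp add: b_def)
qed

lemma powr_le_one_plus_powr:
  fixes x p r :: real
  assumes "0 \<le> x" "0 \<le> p" "p \<le> r" shows "x powr p \<le> 1 + x powr r"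
proof (cases "x \<le> 1")
  case True
  then have "x powr p \<le> 1" using assms by (intro powr_le1) auto
  then show ?thesis using powr_ge_zero[of x r] by linarith
next
  case False
  then have "x powr p \<le> x powr r" using assms by (intro powr_mono) auto
  then show ?thesis by simp
qed

text \<open>Jensen: when the supporting line at \<open>b\<close>, the mean of
  \<open>norm (h x)\<close>, is integrated, the linear term drops out. If the right side is finite,
  the bound by \<open>1 + norm (h x) powr p\<close> supplies integrability of
  \<open>h\<close>.\<close>

lemma (in prob_space) norm_integral_powr_le:
  fixes h :: "'a \<Rightarrow> complex"
  assumes [measurable]: "h \<in> borel_measurable M" and p: "1 \<le> p"
  shows "ennreal (norm (integral\<^sup>L M h) powr p) \<le> (\<integral>\<^sup>+x. ennreal (norm (h x) powr p) \<partial>M)"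
proof (cases "(\<integral>\<^sup>+x. ennreal (norm (h x) powr p) \<partial>M) = \<infinity>")
  case False
  have ip: "integrable M (\<lambda>x. norm (h x) powr p)"
    by (rule integrableI_nonneg) (use False in \<open>auto simp: less_top[symmetric]\<close>)
  have i1: "integrable M (\<lambda>x. norm (h x))"
  proof (rule Bochner_Integration.integrable_bound)
    show "integrable M (\<lambda>x. 1 + norm (h x) powr p)" using ip by simp
    show "AE x in M. norm (norm (h x)) \<le> norm (1 + norm (h x) powr p)"
    proof (rule AE_I2)
      fix x
      have "norm (h x) powr 1 \<le> 1 + norm (h x) powr p" using p by (intro powr_le_one_plus_powr) auto
      then show "norm (norm (h x)) \<le> norm (1 + norm (h x) powr p)" by simp
    qed
  qed simp
  define b where "b = (\<integral>x. norm (h x) \<partial>M)"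
  have nb: "norm (integral\<^sup>L M h) \<le> b" unfolding b_def by (rule integral_norm_bound)
  have "norm (integral\<^sup>L M h) powr p \<le> b powr p" using nb p by (intro powr_mono2) auto
  also have "b powr p \<le> (\<integral>x. norm (h x) powr p \<partial>M)"
  proof (cases "b = 0")
    case True then show ?thesis by (simp add: integral_nonneg)
  next
    case False
    then have b: "b > 0" using nb norm_ge_zero by (metis order_less_le order_trans)
    have "b powr p = (\<integral>x. b powr p + p * b powr (p - 1) * (norm (h x) - b) \<partial>M)"
      using i1 by (simp add: b_def prob_space)
    also have "\<dots> \<le> (\<integral>x. norm (h x) powr p \<partial>M)"
      using i1 ip b p by (intro integral_mono powr_tangent) auto
    finally show ?thesis .
  qed
  also have "ennreal (\<integral>x. norm (h x) powr p \<partial>M) = (\<integral>\<^sup>+x. ennreal (norm (h x) powr p) \<partial>M)"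
    using ip by (intro nn_integral_eq_integral[symmetric]) auto
  finally show ?thesis by (simp add: ennreal_leI)
qed auto

section \<open>Norm, triangle inequality and completeness\<close>

lemma circle_fun_cases:
  obtains f where "f \<in> borel_measurable circle" "F = abs_circle_fun f"
proof
  show "rep_circle_fun F \<in> borel_measurable circle"
    using Quotient3_rep_reflp[OF Quotient3_circle_fun, of F] by simp
  show "F = abs_circle_fun (rep_circle_fun F)"
    using Quotient3_abs_rep[OF Quotient3_circle_fun, of F] by simp
qed

lemma abs_circle_fun_eq_iff:
  assumes "f \<in> borel_measurable circle" "g \<in> borel_measurable circle"
  shows "abs_circle_fun f = abs_circle_fun g \<longleftrightarrow> (AE x in circle. f x = g x)"
  using Quotient3_rel[OF Quotient3_circle_fun, of f g] assms by simp

lemma abs_circle_fun_add: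
  "f \<in> borel_measurable circle \<Longrightarrow> g \<in> borel_measurable circle \<Longrightarrow>
    abs_circle_fun f + abs_circle_fun g = abs_circle_fun (\<lambda>x. f x + g x)"
  by (rule plus_circle_fun.abs_eq) auto

lemma abs_circle_fun_diff:
  "f \<in> borel_measurable circle \<Longrightarrow> g \<in> borel_measurable circle \<Longrightarrow>
    abs_circle_fun f - abs_circle_fun g = abs_circle_fun (\<lambda>x. f x - g x)"
  by (rule minus_circle_fun.abs_eq) auto

lemma abs_circle_fun_scale:
  "f \<in> borel_measurable circle \<Longrightarrow> c *\<^sub>c abs_circle_fun f = abs_circle_fun (\<lambda>x. c * f x)"
  by (rule scale_circle_fun.abs_eq) auto

lemma zero_circle_fun_abs: "0 = abs_circle_fun (\<lambda>_. 0)"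
  by (simp add: zero_circle_fun_def)

lemma abs_in_Lp_iff:
  "f \<in> borel_measurable circle \<Longrightarrow> abs_circle_fun f \<in> Lp p \<longleftrightarrow> integrable circle (\<lambda>x. norm (f x) powr p)"
  unfolding Lp_def mem_Collect_eq by (rule in_Lp.abs_eq) auto

lemma Lp_norm_abs:
  "f \<in> borel_measurable circle \<Longrightarrow>
    Lp_norm p (abs_circle_fun f) = (integral\<^sup>L circle (\<lambda>x. norm (f x) powr p)) powr (1 / p)"
  by (rule Lp_norm.abs_eq) auto

lemma Lp_norm_nonneg [simp]: "0 \<le> Lp_norm p F"
  by (rule circle_fun_cases[of F]) (simp add: Lp_norm_abs)

lemma nn_integral_powr_eq_Lp_norm:
  assumes f: "f \<in> borel_measurable circle" "abs_circle_fun f \<in> Lp p" and p: "0 < p"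
  shows "(\<integral>\<^sup>+x. ennreal (norm (f x) powr p) \<partial>circle) = ennreal (Lp_norm p (abs_circle_fun f) powr p)"
proof -
  have i: "integrable circle (\<lambda>x. norm (f x) powr p)" using f by (simp add: abs_in_Lp_iff)
  have "(\<integral>\<^sup>+x. ennreal (norm (f x) powr p) \<partial>circle) = ennreal (\<integral>x. norm (f x) powr p \<partial>circle)"
    using i by (intro nn_integral_eq_integral) auto
  also have "(\<integral>x. norm (f x) powr p \<partial>circle) = Lp_norm p (abs_circle_fun f) powr p"
    using f p by (simp add: Lp_norm_abs powr_powr)
  finally show ?thesis .
qed

text \<open>Membership and norm bound come together from one estimate of a nonnegative integral, so
  operators can be estimated before integrability of the image is known.\<close>

lemma Lp_norm_leI:
  assumes f: "f \<in> borel_measurable circle" and p: "0 < p" and C: "0 \<le> C"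
    and le: "(\<integral>\<^sup>+x. ennreal (norm (f x) powr p) \<partial>circle) \<le> ennreal (C powr p)"
  shows "abs_circle_fun f \<in> Lp p" "Lp_norm p (abs_circle_fun f) \<le> C"
proof -
  have i: "integrable circle (\<lambda>x. norm (f x) powr p)"
    using f le by (intro integrableI_nonneg) (auto intro: le_less_trans)
  then show m: "abs_circle_fun f \<in> Lp p" using f by (simp add: abs_in_Lp_iff)
  have "ennreal (Lp_norm p (abs_circle_fun f) powr p) \<le> ennreal (C powr p)"
    using nn_integral_powr_eq_Lp_norm[OF f m p] le by simp
  then have "Lp_norm p (abs_circle_fun f) powr p \<le> C powr p" by simp
  then show "Lp_norm p (abs_circle_fun f) \<le> C"
    using p C by (meson Lp_norm_nonneg linorder_not_le powr_less_mono2)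
qed

lemma Lp_norm_powr_leI:
  assumes f: "f \<in> borel_measurable circle" and p: "0 < p" and C: "0 \<le> C"
    and le: "(\<integral>\<^sup>+x. ennreal (norm (f x) powr p) \<partial>circle) \<le> ennreal C"
  shows "abs_circle_fun f \<in> Lp p" "Lp_norm p (abs_circle_fun f) powr p \<le> C"
proof -
  have "(\<integral>\<^sup>+x. ennreal (norm (f x) powr p) \<partial>circle) \<le> ennreal ((C powr (1 / p)) powr p)"
    using le C p by (simp add: powr_powr)
  note l = Lp_norm_leI[OF f p _ this]
  show "abs_circle_fun f \<in> Lp p" by (rule l) simp
  have "Lp_norm p (abs_circle_fun f) \<le> C powr (1 / p)" by (rule l) simp
  then have "Lp_norm p (abs_circle_fun f) powr p \<le> (C powr (1 / p)) powr p" using p by (intro powr_mono2) auto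
  then show "Lp_norm p (abs_circle_fun f) powr p \<le> C" using C p by (simp add: powr_powr)
qed

lemma Lp_zero [simp]: "0 < p \<Longrightarrow> 0 \<in> Lp p" and Lp_norm_zero [simp]: "0 < p \<Longrightarrow> Lp_norm p 0 = 0"
  by (simp_all add: zero_circle_fun_abs abs_in_Lp_iff Lp_norm_abs)

lemma Lp_norm_eq_0:
  assumes "F \<in> Lp p" "0 < p" "Lp_norm p F = 0" shows "F = 0"
proof -
  obtain f where f: "f \<in> borel_measurable circle" "F = abs_circle_fun f" by (rule circle_fun_cases)
  have "(\<integral>\<^sup>+x. ennreal (norm (f x) powr p) \<partial>circle) = 0"
    using nn_integral_powr_eq_Lp_norm[OF f(1)] assms f by simp
  then have "AE x in circle. ennreal (norm (f x) powr p) = 0"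
    using f by (subst (asm) nn_integral_0_iff_AE) auto
  then have "AE x in circle. f x = 0" by eventually_elim simp
  then show ?thesis using f by (simp add: zero_circle_fun_abs abs_circle_fun_eq_iff)
qed

lemma Lp_scale:
  assumes "F \<in> Lp p" "0 < p" shows "c *\<^sub>c F \<in> Lp p" "Lp_norm p (c *\<^sub>c F) = norm c * Lp_norm p F"
proof -
  obtain f where f: "f \<in> borel_measurable circle" "F = abs_circle_fun f" by (rule circle_fun_cases)
  then show "c *\<^sub>c F \<in> Lp p" using assms by (simp add: abs_circle_fun_scale abs_in_Lp_iff norm_mult powr_mult)
  show "Lp_norm p (c *\<^sub>c F) = norm c * Lp_norm p F"
    using f assms by (simp add: abs_circle_fun_scale Lp_norm_abs norm_mult powr_mult powr_powr)
qed

text \<open>Minkowski by convexity: \<open>f + g\<close> is \<open>a + b\<close> times the convex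
  combination of \<open>f / a\<close> and \<open>g / b\<close> with weights
  \<open>a / (a + b)\<close> and \<open>b / (a + b)\<close>. Strict upper bounds \<open>a\<close>
  and \<open>b\<close> for the norms avoid division by a vanishing norm and are then lowered to the
  norms.\<close>

lemma Lp_add:
  assumes F: "F \<in> Lp p" and G: "G \<in> Lp p" and p: "1 \<le> p"
  shows "F + G \<in> Lp p" "Lp_norm p (F + G) \<le> Lp_norm p F + Lp_norm p G"
proof -
  obtain f where f: "f \<in> borel_measurable circle" "F = abs_circle_fun f" by (rule circle_fun_cases)
  obtain g where g: "g \<in> borel_measurable circle" "G = abs_circle_fun g" by (rule circle_fun_cases)
  note [measurable] = f(1) g(1)
  have main: "F + G \<in> Lp p \<and> Lp_norm p (F + G) \<le> a + b" if a: "Lp_norm p F < a" and b: "Lp_norm p G < b" for a b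
  proof -
    have a0: "0 < a" and b0: "0 < b" using that Lp_norm_nonneg by (metis le_less_trans)+
    define l where "l = a / (a + b)"
    have l: "0 \<le> l" "l \<le> 1" "1 - l = b / (a + b)" using a0 b0 by (auto simp: l_def field_simps)
    have pt: "norm (f x + g x) powr p \<le> (a + b) powr p * (l * (norm (f x) powr p / a powr p) + (1 - l) * (norm (g x) powr p / b powr p))" for x
    proof -
      have "norm (f x + g x) powr p \<le> (norm (f x) + norm (g x)) powr p"
        using p by (intro powr_mono2 norm_triangle_ineq) auto
      also have "norm (f x) + norm (g x) = (a + b) * (l * (norm (f x) / a) + (1 - l) * (norm (g x) / b))"
        unfolding l(3) using a0 b0 by (simp add: l_def distrib_left)
      also have "\<dots> powr p = (a + b) powr p * (l * (norm (f x) / a) + (1 - l) * (norm (g x) / b)) powr p"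
        using a0 b0 l by (intro powr_mult)
      also have "\<dots> \<le> (a + b) powr p * (l * (norm (f x) / a) powr p + (1 - l) * (norm (g x) / b) powr p)"
        using a0 b0 l p by (intro mult_left_mono powr_convex) auto
      finally show ?thesis using a0 b0 by (simp add: powr_divide)
    qed
    have fi: "integrable circle (\<lambda>x. norm (f x) powr p)" and gi: "integrable circle (\<lambda>x. norm (g x) powr p)"
      using F G f g by (auto simp: abs_in_Lp_iff)
    have I: "(\<integral>x. norm (f x) powr p \<partial>circle) \<le> a powr p" "(\<integral>x. norm (g x) powr p \<partial>circle) \<le> b powr p"
    proof -
      have "(\<integral>x. norm (f x) powr p \<partial>circle) = Lp_norm p F powr p" using f p by (simp add: Lp_norm_abs powr_powr)
      also have "\<dots> \<le> a powr p" using a p by (intro powr_mono2) auto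
      finally show "(\<integral>x. norm (f x) powr p \<partial>circle) \<le> a powr p" .
      have "(\<integral>x. norm (g x) powr p \<partial>circle) = Lp_norm p G powr p" using g p by (simp add: Lp_norm_abs powr_powr)
      also have "\<dots> \<le> b powr p" using b p by (intro powr_mono2) auto
      finally show "(\<integral>x. norm (g x) powr p \<partial>circle) \<le> b powr p" .
    qed
    let ?R = "\<lambda>x. (a + b) powr p * (l * (norm (f x) powr p / a powr p) + (1 - l) * (norm (g x) powr p / b powr p))"
    have Ri: "integrable circle ?R" using fi gi by simp
    have "(\<integral>\<^sup>+x. ennreal (norm (f x + g x) powr p) \<partial>circle) \<le> (\<integral>\<^sup>+x. ennreal (?R x) \<partial>circle)"
      by (intro nn_integral_mono ennreal_leI pt)
    also have "\<dots> = ennreal (\<integral>x. ?R x \<partial>circle)"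
      using Ri l a0 b0 by (intro nn_integral_eq_integral) auto
    also have "(\<integral>x. ?R x \<partial>circle) = (a + b) powr p * (l * ((\<integral>x. norm (f x) powr p \<partial>circle) / a powr p)
        + (1 - l) * ((\<integral>x. norm (g x) powr p \<partial>circle) / b powr p))"
      using fi gi by simp
    also have "ennreal \<dots> \<le> ennreal ((a + b) powr p * (l * 1 + (1 - l) * 1))"
      using I a0 b0 l by (intro ennreal_leI mult_left_mono add_mono) (auto simp: divide_le_eq)
    also have "\<dots> = ennreal ((a + b) powr p)" by simp
    finally have le: "(\<integral>\<^sup>+x. ennreal (norm (f x + g x) powr p) \<partial>circle) \<le> ennreal ((a + b) powr p)" .
    have "(\<lambda>x. f x + g x) \<in> borel_measurable circle" by measurable
    from Lp_norm_leI[OF this _ _ le] show ?thesis using p a0 b0 f g by (simp add: abs_circle_fun_add)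
  qed
  show "F + G \<in> Lp p" using main[of "Lp_norm p F + 1" "Lp_norm p G + 1"] by simp
  show "Lp_norm p (F + G) \<le> Lp_norm p F + Lp_norm p G"
  proof (rule field_le_epsilon)
    fix e :: real assume "0 < e"
    then show "Lp_norm p (F + G) \<le> Lp_norm p F + Lp_norm p G + e"
      using main[of "Lp_norm p F + e / 2" "Lp_norm p G + e / 2"] by simp
  qed
qed

lemma circle_fun_diff_conv: "F - G = F + (- 1) *\<^sub>c (G :: circle_fun)"
  by (simp add: circle_fun.scale_minus_left)

lemma Lp_diff:
  assumes F: "F \<in> Lp p" and G: "G \<in> Lp p" and p: "1 \<le> p"
  shows "F - G \<in> Lp p" "Lp_norm p (F - G) \<le> Lp_norm p F + Lp_norm p G"
proof -
  have p0: "0 < p" using p by simp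
  have e: "Lp_norm p ((- 1) *\<^sub>c G) = Lp_norm p G"
    using Lp_scale(2)[OF G p0, of "- 1"] by (simp del: circle_fun.scale_minus_left)
  show "F - G \<in> Lp p" unfolding circle_fun_diff_conv[of F G]
    by (rule Lp_add(1)[OF F Lp_scale(1)[OF G p0] p])
  show "Lp_norm p (F - G) \<le> Lp_norm p F + Lp_norm p G" unfolding circle_fun_diff_conv[of F G]
    using Lp_add(2)[OF F Lp_scale(1)[OF G p0, of "- 1"] p] unfolding e .
qed

lemma Lp_sum:
  assumes "finite I" "\<And>i. i \<in> I \<Longrightarrow> F i \<in> Lp p" "1 \<le> p"
  shows "(\<Sum>i\<in>I. F i) \<in> Lp p \<and> Lp_norm p (\<Sum>i\<in>I. F i) \<le> (\<Sum>i\<in>I. Lp_norm p (F i))"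
  using assms
proof (induction I rule: finite_induct)
  case (insert j I)
  then show ?case using Lp_add[of "F j" p "\<Sum>i\<in>I. F i"] by fastforce
qed simp

lemma Lp_mono:
  assumes F: "F \<in> Lp r" and p: "1 \<le> p" "p \<le> r"
  shows "F \<in> Lp p"
proof -
  obtain f where f: "f \<in> borel_measurable circle" "F = abs_circle_fun f" by (rule circle_fun_cases)
  note [measurable] = f(1)
  have "integrable circle (\<lambda>x. norm (f x) powr p)"
  proof (rule Bochner_Integration.integrable_bound)
    show "integrable circle (\<lambda>x. 1 + norm (f x) powr r)" using F f by (simp add: abs_in_Lp_iff)
    show "AE x in circle. norm (norm (f x) powr p) \<le> norm (1 + norm (f x) powr r)"
      using p by (auto intro!: AE_I2 powr_le_one_plus_powr)
  qed simp
  then show ?thesis using f by (simp add: abs_in_Lp_iff)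
qed

text \<open>Replaces an essential supremum: one representative is bounded everywhere, so the bound
  passes pointwise through the integral defining the convolution.\<close>

definition sup_bounded :: "real \<Rightarrow> circle_fun \<Rightarrow> bool" where
  "sup_bounded b F \<longleftrightarrow> (\<exists>f. f \<in> borel_measurable circle \<and> F = abs_circle_fun f \<and> (\<forall>x. norm (f x) \<le> b))"

lemma sup_bounded_AE:
  assumes "sup_bounded b F" "f \<in> borel_measurable circle" "F = abs_circle_fun f"
  shows "AE x in circle. norm (f x) \<le> b"
proof -
  obtain g where g: "g \<in> borel_measurable circle" "F = abs_circle_fun g" "\<And>x. norm (g x) \<le> b"
    using assms(1) by (auto simp: sup_bounded_def)
  then have "AE x in circle. f x = g x" using assms by (simp add: abs_circle_fun_eq_iff[symmetric])
  then show ?thesis by eventually_elim (simp add: g(3))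
qed

lemma sup_bounded_Lp:
  assumes "sup_bounded b F" "0 < p" shows "F \<in> Lp p"
proof -
  obtain g where g: "g \<in> borel_measurable circle" "F = abs_circle_fun g" "\<And>x. norm (g x) \<le> b"
    using assms(1) by (auto simp: sup_bounded_def)
  note [measurable] = g(1)
  have "integrable circle (\<lambda>x. norm (g x) powr p)"
    using assms g(3) by (intro circle.integrable_const_bound[of _ "b powr p"]) (auto intro!: AE_I2 powr_mono2)
  then show ?thesis using g by (simp add: abs_in_Lp_iff)
qed

lemma sup_bounded_mono:
  assumes "sup_bounded a F" "a \<le> b" shows "sup_bounded b F"
proof -
  obtain f where "f \<in> borel_measurable circle" "F = abs_circle_fun f" "\<And>x. norm (f x) \<le> a"
    using assms(1) by (auto simp: sup_bounded_def)
  then show ?thesis unfolding sup_bounded_def using assms(2) by (intro exI[of _ f]) (auto intro: order_trans)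
qed

lemma sup_bounded_diff_scale:
  assumes "sup_bounded a F" "sup_bounded b G" shows "sup_bounded (a + norm c * b) (F - c *\<^sub>c G)"
proof -
  obtain f where f: "f \<in> borel_measurable circle" "F = abs_circle_fun f" "\<And>x. norm (f x) \<le> a"
    using assms(1) by (auto simp: sup_bounded_def)
  obtain g where g: "g \<in> borel_measurable circle" "G = abs_circle_fun g" "\<And>x. norm (g x) \<le> b"
    using assms(2) by (auto simp: sup_bounded_def)
  note [measurable] = f(1) g(1)
  have "norm (f x - c * g x) \<le> a + norm c * b" for x
    using norm_triangle_ineq4[of "f x" "c * g x"] f(3)[of x] mult_left_mono[OF g(3)[of x], of "norm c"]
    by (simp add: norm_mult)
  then show ?thesis unfolding sup_bounded_def
    by (intro exI[of _ "\<lambda>x. f x - c * g x"]) (simp add: f g abs_circle_fun_scale abs_circle_fun_diff)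
qed

text \<open>Riesz-Fischer in the form used for Neumann series. The series of \<open>L^1\<close>
  norms converges, so the representatives are absolutely summable almost everywhere; Fatou's lemma
  bounds the \<open>p\<close>-norm of the tail by the sum of the norms.\<close>

lemma Lp_complete:
  assumes F: "\<And>k. F k \<in> Lp p" and p: "1 \<le> p" and sm: "summable (\<lambda>k. Lp_norm p (F k))"
  shows "\<exists>G\<in>Lp p. \<forall>n. Lp_norm p (G - (\<Sum>k<n. F k)) \<le> (\<Sum>k. Lp_norm p (F (k + n)))"
proof -
  have "\<exists>f. \<forall>k. f k \<in> borel_measurable circle \<and> F k = abs_circle_fun (f k)"
    by (intro choice allI) (metis circle_fun_cases)
  then obtain f where f: "\<And>k. f k \<in> borel_measurable circle" "\<And>k. F k = abs_circle_fun (f k)" by blast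
  note [measurable] = f(1)
  have sums: "(\<Sum>k\<in>I. F k) = abs_circle_fun (\<lambda>x. \<Sum>k\<in>I. f k x)" if "finite I" for I
    using that by (induction I rule: finite_induct) (simp_all add: zero_circle_fun_abs f(2) abs_circle_fun_add)
  have norm1: "Lp_norm 1 (F k) \<le> Lp_norm p (F k)" for k
  proof -
    have "ennreal (norm (integral\<^sup>L circle (\<lambda>x. complex_of_real (norm (f k x)))) powr p)
        \<le> (\<integral>\<^sup>+x. ennreal (norm (complex_of_real (norm (f k x))) powr p) \<partial>circle)"
      by (rule circle.norm_integral_powr_le) (use p in auto)
    then have "ennreal (Lp_norm 1 (F k) powr p) \<le> ennreal (Lp_norm p (F k) powr p)"
      using nn_integral_powr_eq_Lp_norm[OF f(1), of k p] F[of k] p by (simp add: f(2) Lp_norm_abs)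
    then have "Lp_norm 1 (F k) powr p \<le> Lp_norm p (F k) powr p" by simp
    then show ?thesis using p by (meson Lp_norm_nonneg linorder_not_le powr_less_mono2 less_le_trans zero_less_one)
  qed
  have "(\<integral>\<^sup>+x. (\<Sum>k. ennreal (norm (f k x))) \<partial>circle) = (\<Sum>k. \<integral>\<^sup>+x. ennreal (norm (f k x)) \<partial>circle)"
    by (rule nn_integral_suminf) simp
  also have "\<dots> = (\<Sum>k. ennreal (Lp_norm 1 (F k)))"
  proof (rule suminf_cong)
    fix k
    show "(\<integral>\<^sup>+x. ennreal (norm (f k x)) \<partial>circle) = ennreal (Lp_norm 1 (F k))"
      using nn_integral_powr_eq_Lp_norm[OF f(1), of k 1] Lp_mono[OF F[of k], of 1] p by (simp add: f(2))
  qed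
  also have "\<dots> < \<infinity>"
  proof -
    have "summable (\<lambda>k. Lp_norm 1 (F k))"
      by (rule summable_comparison_test'[OF sm, of 0]) (simp add: norm1)
    then show ?thesis by (simp add: suminf_ennreal2)
  qed
  finally have "AE x in circle. (\<Sum>k. ennreal (norm (f k x))) \<noteq> \<infinity>"
    by (intro nn_integral_PInf_AE) auto
  then have conv: "AE x in circle. summable (\<lambda>k. f k x)"
  proof eventually_elim
    case (elim x)
    then have "summable (\<lambda>k. norm (f k x))" by (intro summable_suminf_not_top) auto
    then show ?case by (rule summable_norm_cancel)
  qed
  define g where "g x = (\<Sum>k. f k x)" for x
  have [measurable]: "g \<in> borel_measurable circle" unfolding g_def by measurable
  have tail: "abs_circle_fun (\<lambda>x. g x - (\<Sum>k<n. f k x)) \<in> Lp p \<and>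
      Lp_norm p (abs_circle_fun (\<lambda>x. g x - (\<Sum>k<n. f k x))) \<le> (\<Sum>k. Lp_norm p (F (k + n)))" for n
  proof -
    define C where "C = (\<Sum>k. Lp_norm p (F (k + n)))"
    have smn: "summable (\<lambda>k. Lp_norm p (F (k + n)))" using sm by (simp add: summable_iff_shift[of "\<lambda>k. Lp_norm p (F k)"])
    have C0: "0 \<le> C" unfolding C_def by (intro suminf_nonneg smn) simp
    have "(\<integral>\<^sup>+x. ennreal (norm (g x - (\<Sum>k<n. f k x)) powr p) \<partial>circle)
        = (\<integral>\<^sup>+x. liminf (\<lambda>m. ennreal (norm ((\<Sum>k<m. f (k + n) x)) powr p)) \<partial>circle)"
    proof (rule nn_integral_cong_AE, use conv in eventually_elim)
      case (elim x)
      have "(\<lambda>m. \<Sum>k<m. f (k + n) x) \<longlonglongrightarrow> (\<Sum>k. f (k + n) x)"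
        using elim by (intro summable_LIMSEQ) (simp add: summable_iff_shift[of "\<lambda>k. f k x"])
      also have "(\<Sum>k. f (k + n) x) = g x - (\<Sum>k<n. f k x)"
        unfolding g_def using suminf_minus_initial_segment[OF elim] by simp
      finally have "(\<lambda>m. ennreal (norm (\<Sum>k<m. f (k + n) x) powr p)) \<longlonglongrightarrow> ennreal (norm (g x - (\<Sum>k<n. f k x)) powr p)"
        using p by (intro tendsto_ennrealI tendsto_powr2 tendsto_norm tendsto_const) auto
      then show ?case by (intro lim_imp_Liminf[symmetric]) auto
    qed
    also have "\<dots> \<le> liminf (\<lambda>m. \<integral>\<^sup>+x. ennreal (norm (\<Sum>k<m. f (k + n) x) powr p) \<partial>circle)"
      by (rule nn_integral_liminf) simp
    also have "\<dots> \<le> liminf (\<lambda>m. ennreal (C powr p))"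
    proof (rule Liminf_mono, rule always_eventually, rule allI)
      fix m
      have "(\<Sum>k<m. F (k + n)) = abs_circle_fun (\<lambda>x. \<Sum>k<m. f (k + n) x)"
        by (induction m) (simp_all add: zero_circle_fun_abs f(2) abs_circle_fun_add)
      moreover have L: "(\<Sum>k<m. F (k + n)) \<in> Lp p \<and> Lp_norm p (\<Sum>k<m. F (k + n)) \<le> (\<Sum>k<m. Lp_norm p (F (k + n)))"
        by (rule Lp_sum) (use F p in auto)
      moreover have "(\<Sum>k<m. Lp_norm p (F (k + n))) \<le> C" unfolding C_def by (intro sum_le_suminf smn) auto
      moreover have "(\<lambda>x. \<Sum>k<m. f (k + n) x) \<in> borel_measurable circle" by measurable
      ultimately show "(\<integral>\<^sup>+x. ennreal (norm (\<Sum>k<m. f (k + n) x) powr p) \<partial>circle) \<le> ennreal (C powr p)"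
        using p by (subst nn_integral_powr_eq_Lp_norm) (auto intro!: ennreal_leI powr_mono2)
    qed
    also have "\<dots> = ennreal (C powr p)" by (simp add: Liminf_const)
    finally have le: "(\<integral>\<^sup>+x. ennreal (norm (g x - (\<Sum>k<n. f k x)) powr p) \<partial>circle) \<le> ennreal (C powr p)" .
    have "(\<lambda>x. g x - (\<Sum>k<n. f k x)) \<in> borel_measurable circle" by measurable
    from Lp_norm_leI[OF this _ C0 le] show ?thesis using p by (simp add: C_def)
  qed
  show ?thesis
  proof (intro bexI allI)
    show "abs_circle_fun g \<in> Lp p" using tail[of 0] by simp
    fix n
    have "abs_circle_fun g - (\<Sum>k<n. F k) = abs_circle_fun (\<lambda>x. g x - (\<Sum>k<n. f k x))"
      by (simp add: sums abs_circle_fun_diff)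
    then show "Lp_norm p (abs_circle_fun g - (\<Sum>k<n. F k)) \<le> (\<Sum>k. Lp_norm p (F (k + n)))"
      using tail[of n] by simp
  qed
qed

section \<open>Convolution operators\<close>

locale circle_measure = prob_space \<nu> for \<nu> :: "real measure" +
  assumes sets_eq: "sets \<nu> = sets circle"
begin

abbreviation T :: "circle_fun \<Rightarrow> circle_fun" where "T \<equiv> convolution_operator \<nu>"

definition conv :: "(real \<Rightarrow> complex) \<Rightarrow> real \<Rightarrow> complex" where
  "conv f x = (\<integral>y. f (frac (x - y)) \<partial>\<nu>)"

sublocale pair_sigma_finite circle \<nu>
  by (intro pair_sigma_finite.intro sigma_finite_circle sigma_finite_measure_axioms)

lemma borel_measurable_id_nu: "(\<lambda>x. x) \<in> borel_measurable \<nu>"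
  using borel_measurable_id_circle measurable_cong_sets[OF sets_eq refl] by blast

lemma measurable_frac_diff: "(\<lambda>z. frac (fst z - snd z)) \<in> circle \<Otimes>\<^sub>M \<nu> \<rightarrow>\<^sub>M circle"
proof -
  have "(\<lambda>z. fst z - snd z) \<in> borel_measurable (circle \<Otimes>\<^sub>M \<nu>)"
    by (intro borel_measurable_diff measurable_compose[OF measurable_fst] measurable_compose[OF measurable_snd]
        borel_measurable_id_circle borel_measurable_id_nu)
  then show ?thesis by (rule measurable_compose[OF _ measurable_frac_circle])
qed

lemma measurable_translate:
  assumes "f \<in> borel_measurable circle"
  shows "(\<lambda>y. f (frac (x - y))) \<in> borel_measurable \<nu>"
proof -
  have "(\<lambda>y. x - y) \<in> borel_measurable \<nu>" using borel_measurable_id_nu by simp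
  then show ?thesis
    by (intro measurable_compose[OF _ assms] measurable_compose[OF _ measurable_frac_circle])
qed

lemma measurable_conv [measurable]: "f \<in> borel_measurable circle \<Longrightarrow> conv f \<in> borel_measurable circle"
  unfolding conv_def[abs_def] using convolution_respects(1)[OF prob_space_axioms sets_eq, of f f] by simp

lemma T_abs: "f \<in> borel_measurable circle \<Longrightarrow> T (abs_circle_fun f) = abs_circle_fun (conv f)"
  unfolding conv_def[abs_def] by (rule convolution_operator_abs[OF prob_space_axioms sets_eq])

text \<open>Averaging over rotations with total weight 1 preserves the integral, by Tonelli and
  rotation invariance.\<close>

lemma nn_integral_convolution:
  fixes g :: "real \<Rightarrow> ennreal"
  assumes g: "g \<in> borel_measurable circle"
  shows "(\<integral>\<^sup>+x. \<integral>\<^sup>+y. g (frac (x - y)) \<partial>\<nu> \<partial>circle) = (\<integral>\<^sup>+x. g x \<partial>circle)"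
proof -
  have m: "(\<lambda>(x, y). g (frac (x - y))) \<in> borel_measurable (circle \<Otimes>\<^sub>M \<nu>)"
    using measurable_compose[OF measurable_frac_diff g] by (simp add: case_prod_beta')
  have "(\<integral>\<^sup>+x. \<integral>\<^sup>+y. g (frac (x - y)) \<partial>\<nu> \<partial>circle) = (\<integral>\<^sup>+y. \<integral>\<^sup>+x. g (frac (x - y)) \<partial>circle \<partial>\<nu>)"
    by (rule Fubini'[OF m, symmetric])
  also have "\<dots> = (\<integral>\<^sup>+y. \<integral>\<^sup>+x. g x \<partial>circle \<partial>\<nu>)" by (simp add: nn_integral_circle_rotate[OF g])
  also have "\<dots> = (\<integral>\<^sup>+x. g x \<partial>circle)" by (simp add: emeasure_space_1)
  finally show ?thesis .
qed

text \<open>Young's inequality for a probability measure: Jensen inside the integral over \<nu>,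
  then \<open>nn_integral_convolution\<close>.\<close>

lemma T_Lp:
  assumes F: "F \<in> Lp p" and p: "1 \<le> p"
  shows "T F \<in> Lp p" "Lp_norm p (T F) \<le> Lp_norm p F"
proof -
  obtain f where f: "f \<in> borel_measurable circle" "F = abs_circle_fun f" by (rule circle_fun_cases)
  note [measurable] = f(1)
  have "(\<integral>\<^sup>+x. ennreal (norm (conv f x) powr p) \<partial>circle)
      \<le> (\<integral>\<^sup>+x. \<integral>\<^sup>+y. ennreal (norm (f (frac (x - y))) powr p) \<partial>\<nu> \<partial>circle)"
    unfolding conv_def by (intro nn_integral_mono norm_integral_powr_le measurable_translate f p)
  also have "\<dots> = (\<integral>\<^sup>+x. ennreal (norm (f x) powr p) \<partial>circle)"
    by (rule nn_integral_convolution) simp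
  also have "\<dots> = ennreal (Lp_norm p F powr p)"
    using nn_integral_powr_eq_Lp_norm[OF f(1)] F f p by simp
  finally have le: "(\<integral>\<^sup>+x. ennreal (norm (conv f x) powr p) \<partial>circle) \<le> ennreal (Lp_norm p F powr p)" .
  have "conv f \<in> borel_measurable circle" by measurable
  from Lp_norm_leI[OF this _ _ le] p show "T F \<in> Lp p" "Lp_norm p (T F) \<le> Lp_norm p F"
    by (simp_all add: f T_abs)
qed

text \<open>A Bochner integral that does not exist has the value 0, so pointwise additivity of the
  convolution is guaranteed only where both integrals exist; for \<open>L^1\<close> functions this
  is almost everywhere.\<close>

lemma AE_integrable_translate:
  assumes F: "abs_circle_fun f \<in> Lp 1" and f: "f \<in> borel_measurable circle"
  shows "AE x in circle. integrable \<nu> (\<lambda>y. f (frac (x - y)))"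
proof -
  note [measurable] = f
  have "(\<integral>\<^sup>+x. \<integral>\<^sup>+y. ennreal (norm (f (frac (x - y)))) \<partial>\<nu> \<partial>circle) = (\<integral>\<^sup>+x. ennreal (norm (f x)) \<partial>circle)"
    by (rule nn_integral_convolution) simp
  also have "\<dots> < \<infinity>" using nn_integral_powr_eq_Lp_norm[OF f F] by simp
  finally have "(\<integral>\<^sup>+x. \<integral>\<^sup>+y. ennreal (norm (f (frac (x - y)))) \<partial>\<nu> \<partial>circle) \<noteq> \<infinity>" by simp
  moreover have "(\<lambda>x. \<integral>\<^sup>+y. ennreal (norm (f (frac (x - y)))) \<partial>\<nu>) \<in> borel_measurable circle"
  proof (rule sigma_finite_measure.borel_measurable_nn_integral[OF prob_space_imp_sigma_finite[OF prob_space_axioms]])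
    show "(\<lambda>(x, y). ennreal (norm (f (frac (x - y))))) \<in> borel_measurable (circle \<Otimes>\<^sub>M \<nu>)"
      using measurable_compose[OF measurable_compose[OF measurable_frac_diff f], of "\<lambda>x. ennreal (norm x)" borel] by (simp add: case_prod_beta')
  qed
  ultimately have "AE x in circle. (\<integral>\<^sup>+y. ennreal (norm (f (frac (x - y)))) \<partial>\<nu>) \<noteq> \<infinity>"
    by (intro nn_integral_PInf_AE)
  then show ?thesis
  proof eventually_elim
    case (elim x)
    then show ?case by (intro integrableI_bounded measurable_translate f) (simp add: less_top)
  qed
qed

lemma T_add:
  assumes F: "F \<in> Lp 1" and G: "G \<in> Lp 1" shows "T (F + G) = T F + T G"
proof -
  obtain f where f: "f \<in> borel_measurable circle" "F = abs_circle_fun f" by (rule circle_fun_cases)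
  obtain g where g: "g \<in> borel_measurable circle" "G = abs_circle_fun g" by (rule circle_fun_cases)
  note [measurable] = f(1) g(1)
  have "AE x in circle. integrable \<nu> (\<lambda>y. f (frac (x - y)))" "AE x in circle. integrable \<nu> (\<lambda>y. g (frac (x - y)))"
    using F G f g by (auto intro!: AE_integrable_translate)
  then have "AE x in circle. conv (\<lambda>x. f x + g x) x = conv f x + conv g x"
    by eventually_elim (simp add: conv_def)
  then show ?thesis by (simp add: f g abs_circle_fun_add T_abs abs_circle_fun_eq_iff)
qed

lemma T_scale: "T (c *\<^sub>c F) = c *\<^sub>c T F"
proof -
  obtain f where f: "f \<in> borel_measurable circle" "F = abs_circle_fun f" by (rule circle_fun_cases)
  note [measurable] = f(1)
  have "conv (\<lambda>x. c * f x) = (\<lambda>x. c * conv f x)" by (simp add: conv_def fun_eq_iff)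
  then show ?thesis using f by (simp add: abs_circle_fun_scale T_abs)
qed

lemma T_sup_bounded:
  assumes "sup_bounded b F" shows "sup_bounded b (T F)"
proof -
  obtain f where f: "f \<in> borel_measurable circle" "F = abs_circle_fun f" "\<And>x. norm (f x) \<le> b"
    using assms by (auto simp: sup_bounded_def)
  have b: "0 \<le> b" using f(3)[of 0] norm_ge_zero order_trans by blast
  have "norm (conv f x) \<le> b" for x
  proof -
    have i: "integrable \<nu> (\<lambda>y. f (frac (x - y)))"
      by (rule integrable_const_bound[of _ b]) (use f measurable_translate in auto)
    have "norm (conv f x) \<le> (\<integral>y. norm (f (frac (x - y))) \<partial>\<nu>)" unfolding conv_def by (rule integral_norm_bound)
    also have "\<dots> \<le> (\<integral>y. b \<partial>\<nu>)" using i f(3) by (intro integral_mono) auto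
    finally show ?thesis by (simp add: prob_space)
  qed
  then show ?thesis unfolding sup_bounded_def using f by (intro exI[of _ "conv f"]) (simp add: T_abs)
qed

text \<open>\<open>root_product ws\<close> is \<open>q(T)\<close> for the polynomial \<open>q = (\<Prod>w\<leftarrow>ws. X - w)\<close>.\<close>

fun root_product :: "complex list \<Rightarrow> circle_fun \<Rightarrow> circle_fun" where
  "root_product [] F = F"
| "root_product (w # ws) F = T (root_product ws F) - w *\<^sub>c root_product ws F"

lemma root_product_append: "root_product (us @ ws) F = root_product us (root_product ws F)"
  by (induction us) auto

lemma root_product_Lp:
  assumes F: "F \<in> Lp p" and p: "1 \<le> p"
  shows "root_product ws F \<in> Lp p \<and> Lp_norm p (root_product ws F) \<le> (\<Prod>w\<leftarrow>ws. 1 + norm w) * Lp_norm p F"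
proof (induction ws)
  case Nil then show ?case using F by simp
next
  case (Cons w ws)
  let ?G = "root_product ws F"
  have G: "?G \<in> Lp p" "Lp_norm p ?G \<le> (\<Prod>w\<leftarrow>ws. 1 + norm w) * Lp_norm p F" using Cons by auto
  have S: "w *\<^sub>c ?G \<in> Lp p" "Lp_norm p (w *\<^sub>c ?G) = norm w * Lp_norm p ?G" using Lp_scale[OF G(1)] p by auto
  have "Lp_norm p (T ?G - w *\<^sub>c ?G) \<le> Lp_norm p (T ?G) + Lp_norm p (w *\<^sub>c ?G)"
    by (rule Lp_diff(2)[OF T_Lp(1)[OF G(1) p] S(1) p])
  also have "\<dots> \<le> Lp_norm p ?G + norm w * Lp_norm p ?G" using T_Lp(2)[OF G(1) p] S(2) by simp
  also have "\<dots> = (1 + norm w) * Lp_norm p ?G" by (simp add: algebra_simps)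
  also have "\<dots> \<le> (1 + norm w) * ((\<Prod>w\<leftarrow>ws. 1 + norm w) * Lp_norm p F)"
    using G(2) by (intro mult_left_mono) auto
  finally show ?case using Lp_diff(1)[OF T_Lp(1)[OF G(1) p] S(1) p] by (simp add: mult.assoc)
qed

lemma root_product_add:
  assumes F: "F \<in> Lp 1" and G: "G \<in> Lp 1"
  shows "root_product ws (F + G) = root_product ws F + root_product ws G"
proof (induction ws)
  case (Cons w ws)
  then show ?case
    using root_product_Lp[OF F, of ws] root_product_Lp[OF G, of ws]
    by (simp add: T_add circle_fun.scale_right_distrib)
qed simp

lemma root_product_scale: "root_product ws (c *\<^sub>c F) = c *\<^sub>c root_product ws F"
  by (induction ws) (simp_all add: T_scale circle_fun.scale_right_diff_distrib circle_fun.scale_left_commute)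

lemma root_product_diff:
  assumes F: "F \<in> Lp 1" and G: "G \<in> Lp 1"
  shows "root_product ws (F - G) = root_product ws F - root_product ws G"
  unfolding circle_fun_diff_conv[of F G] circle_fun_diff_conv[of "root_product ws F"]
  by (simp only: root_product_add[OF F Lp_scale(1)[OF G zero_less_one]] root_product_scale)

lemma root_product_sup_bounded:
  "sup_bounded b F \<Longrightarrow> sup_bounded ((\<Prod>w\<leftarrow>ws. 1 + norm w) * b) (root_product ws F)"
proof (induction ws)
  case (Cons w ws)
  let ?B = "(\<Prod>w\<leftarrow>ws. 1 + norm w) * b"
  have "sup_bounded (?B + norm w * ?B) (T (root_product ws F) - w *\<^sub>c root_product ws F)"
    using Cons by (intro sup_bounded_diff_scale T_sup_bounded) auto
  then show ?case by (simp add: algebra_simps)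
qed simp

definition fourier_coeff :: "int \<Rightarrow> complex" where
  "fourier_coeff n = (\<integral>y. cis (- 2 * pi * of_int n * y) \<partial>\<nu>)"

end

section \<open>Density of trigonometric polynomials\<close>

text \<open>The inverse of the parametrisation jumps at the point 1, so continuity is checked
  through closed sets: the preimage of a closed set is the image of a compact subset of
  [0, 1].\<close>

lemma continuous_on_circle_lift:
  fixes f :: "real \<Rightarrow> complex"
  assumes f: "continuous_on {0..1} f" and per: "f 0 = f 1"
  shows "\<exists>F. continuous_on (sphere 0 1) F \<and> (\<forall>x\<in>{0..1}. F (cis (2 * pi * x)) = f x)"
proof -
  define F where "F z = f (Arg2pi z / (2 * pi))" for z
  have F1: "F (cis (2 * pi * x)) = f x" if x: "x \<in> {0..1}" for x
  proof (cases "x = 1")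
    case True
    then show ?thesis using per by (simp add: F_def Arg2pi_of_real[of 1, simplified])
  next
    case False
    then have "Arg2pi (cis (2 * pi * x)) = 2 * pi * x"
      using x by (intro Arg2pi_unique[of 1]) (auto simp: cis_conv_exp)
    then show ?thesis by (simp add: F_def)
  qed
  have ex: "\<exists>x\<in>{0..1}. z = cis (2 * pi * x)" if "norm z = 1" for z
  proof
    have "z = exp (\<i> * of_real (Arg2pi z))" using Arg2pi_eq[of z] that by simp
    then show "z = cis (2 * pi * (Arg2pi z / (2 * pi)))" by (simp add: cis_conv_exp)
    show "Arg2pi z / (2 * pi) \<in> {0..1}" using Arg2pi[of z] by simp
  qed
  have "continuous_on (sphere 0 1) F"
  proof (subst continuous_on_closed_vimage, simp, intro allI impI)
    fix C :: "complex set" assume C: "closed C"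
    have "F -` C \<inter> sphere 0 1 = (\<lambda>x. cis (2 * pi * x)) ` (f -` C \<inter> {0..1})"
      using ex F1 by (force simp: image_iff)
    moreover have "compact ((\<lambda>x. cis (2 * pi * x)) ` (f -` C \<inter> {0..1}))"
    proof (rule compact_continuous_image)
      show "continuous_on (f -` C \<inter> {0..1}) (\<lambda>x. cis (2 * pi * x))" by (intro continuous_intros)
      have "closed (f -` C \<inter> {0..1})" using f C continuous_on_closed_vimage[of "{0..1}" f] by simp
      then show "compact (f -` C \<inter> {0..1})" using compact_Int_closed[OF compact_Icc, of _ 0 1] by (metis inf.right_idem inf_commute)
    qed
    ultimately show "closed (F -` C \<inter> sphere 0 1)" by (simp add: compact_imp_closed)
  qed
  then show ?thesis using F1 by blast
qed

definition trig_poly :: "int set \<Rightarrow> (int \<Rightarrow> complex) \<Rightarrow> real \<Rightarrow> complex" where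
  "trig_poly I c x = (\<Sum>n\<in>I. c n * cis (2 * pi * of_int n * x))"

definition is_trig_poly :: "(real \<Rightarrow> complex) \<Rightarrow> bool" where
  "is_trig_poly f \<longleftrightarrow> (\<exists>I c. finite I \<and> f = trig_poly I c)"

lemma is_trig_poly_add:
  assumes "is_trig_poly f" "is_trig_poly g" shows "is_trig_poly (\<lambda>x. f x + g x)"
proof -
  obtain I c J d where f: "finite I" "f = trig_poly I c" and g: "finite J" "g = trig_poly J d"
    using assms by (auto simp: is_trig_poly_def)
  have "trig_poly I c x = trig_poly (I \<union> J) (\<lambda>n. if n \<in> I then c n else 0) x" for x
    unfolding trig_poly_def using f g by (intro sum.mono_neutral_cong_left) auto
  moreover have "trig_poly J d x = trig_poly (I \<union> J) (\<lambda>n. if n \<in> J then d n else 0) x" for x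
    unfolding trig_poly_def using f g by (intro sum.mono_neutral_cong_left) auto
  ultimately have "(\<lambda>x. f x + g x) = trig_poly (I \<union> J) (\<lambda>n. (if n \<in> I then c n else 0) + (if n \<in> J then d n else 0))"
    unfolding f g by (simp add: fun_eq_iff trig_poly_def sum.distrib distrib_right)
  then show ?thesis using f g unfolding is_trig_poly_def by blast
qed

lemma is_trig_poly_monom: "is_trig_poly (\<lambda>x. c * cis (2 * pi * of_int n * x))"
  unfolding is_trig_poly_def by (intro exI[of _ "{n}"] exI[of _ "\<lambda>_. c"]) (simp add: trig_poly_def fun_eq_iff)

lemma is_trig_poly_const: "is_trig_poly (\<lambda>x. c)"
  using is_trig_poly_monom[of c 0] by simp

lemma is_trig_poly_sum: "finite I \<Longrightarrow> (\<And>i. i \<in> I \<Longrightarrow> is_trig_poly (f i)) \<Longrightarrow> is_trig_poly (\<lambda>x. \<Sum>i\<in>I. f i x)"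
  by (induction I rule: finite_induct) (auto intro: is_trig_poly_const is_trig_poly_add)

lemma is_trig_poly_mult:
  assumes "is_trig_poly f" "is_trig_poly g" shows "is_trig_poly (\<lambda>x. f x * g x)"
proof -
  obtain I c J d where f: "finite I" "f = trig_poly I c" and g: "finite J" "g = trig_poly J d"
    using assms by (auto simp: is_trig_poly_def)
  have eq: "(\<lambda>x. f x * g x) = (\<lambda>x. \<Sum>i\<in>I. \<Sum>j\<in>J. (c i * d j) * cis (2 * pi * of_int (i + j) * x))"
    unfolding f g trig_poly_def sum_product
    by (intro ext sum.cong refl) (simp add: algebra_simps flip: cis_mult)
  show ?thesis unfolding eq by (intro is_trig_poly_sum f g is_trig_poly_monom)
qed

lemma is_trig_poly_real_polynomial:
  assumes "real_polynomial_function p" shows "is_trig_poly (\<lambda>x. of_real (p (cis (2 * pi * x))))"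
  using assms
proof (induction p rule: real_polynomial_function.induct)
  case (linear f)
  \<comment> \<open>On the circle a real linear functional is a combination of cosine and sine, that
    is, of the characters with frequencies 1 and -1.\<close>
  have eq: "of_real (f (cis (2 * pi * x))) = (complex_of_real (f 1) - \<i> * of_real (f \<i>)) / 2 * cis (2 * pi * of_int 1 * x)
      + (complex_of_real (f 1) + \<i> * of_real (f \<i>)) / 2 * cis (2 * pi * of_int (- 1) * x)" for x
  proof -
    have "cis (2 * pi * x) = Re (cis (2 * pi * x)) *\<^sub>R 1 + Im (cis (2 * pi * x)) *\<^sub>R \<i>"
      by (simp add: complex_eq_iff)
    then have "f (cis (2 * pi * x)) = f (cos (2 * pi * x) *\<^sub>R 1 + sin (2 * pi * x) *\<^sub>R \<i>)" by simp
    also have "\<dots> = cos (2 * pi * x) * f 1 + sin (2 * pi * x) * f \<i>"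
      using linear by (simp only: linear_simps real_scaleR_def)
    finally show ?thesis by (simp add: complex_eq_iff field_simps)
  qed
  show ?case unfolding eq by (intro is_trig_poly_add is_trig_poly_monom)
next
  case (const c)
  then show ?case by (rule is_trig_poly_const)
qed (simp_all add: is_trig_poly_add is_trig_poly_mult)

lemma trig_poly_uniform_approx:
  fixes f :: "real \<Rightarrow> complex"
  assumes "continuous_on {0..1} f" "f 0 = f 1" "0 < e"
  shows "\<exists>g. is_trig_poly g \<and> (\<forall>x\<in>{0..1}. norm (f x - g x) < e)"
proof -
  obtain F where F: "continuous_on (sphere 0 1) F" "\<And>x. x \<in> {0..1} \<Longrightarrow> F (cis (2 * pi * x)) = f x"
    using continuous_on_circle_lift[OF assms(1,2)] by blast
  obtain g where g: "polynomial_function g" "\<And>z. z \<in> sphere 0 1 \<Longrightarrow> norm (F z - g z) < e"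
    using Stone_Weierstrass_polynomial_function[OF compact_sphere F(1) assms(3)] by blast
  have "real_polynomial_function (Re \<circ> g)" "real_polynomial_function (Im \<circ> g)"
    using g(1) bounded_linear_Re bounded_linear_Im unfolding polynomial_function_def by blast+
  then have "is_trig_poly (\<lambda>x. of_real ((Re \<circ> g) (cis (2 * pi * x))) + \<i> * of_real ((Im \<circ> g) (cis (2 * pi * x))))"
    by (intro is_trig_poly_add is_trig_poly_mult is_trig_poly_const is_trig_poly_real_polynomial)
  then have "is_trig_poly (\<lambda>x. g (cis (2 * pi * x)))"
    by (simp add: complex_eq_iff[symmetric] flip: complex_eq)
  moreover have "norm (f x - g (cis (2 * pi * x))) < e" if "x \<in> {0..1}" for x
    using g(2)[of "cis (2 * pi * x)"] F(2)[OF that] by simp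
  ultimately show ?thesis by blast
qed

lemma measurable_trig_poly [measurable]: "trig_poly I c \<in> borel_measurable circle"
proof -
  note [measurable] = borel_measurable_id_circle
  show ?thesis unfolding trig_poly_def[abs_def] cis_conv_exp by measurable
qed

section \<open>Orthogonality of the characters\<close>

lemma distr_circle_rotate: "distr circle circle (\<lambda>x. frac (x - y)) = circle"
proof (rule measure_eqI)
  note [measurable] = borel_measurable_id_circle
  have m: "(\<lambda>x. frac (x - y)) \<in> circle \<rightarrow>\<^sub>M circle"
    by (rule measurable_compose[OF _ measurable_frac_circle]) measurable
  fix A assume "A \<in> sets (distr circle circle (\<lambda>x. frac (x - y)))"
  then have A: "A \<in> sets circle" by simp
  have "emeasure (distr circle circle (\<lambda>x. frac (x - y))) A = (\<integral>\<^sup>+x. indicator A x \<partial>distr circle circle (\<lambda>x. frac (x - y)))"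
    using A by simp
  also have "\<dots> = (\<integral>\<^sup>+x. indicator A (frac (x - y)) \<partial>circle)"
    using A m by (intro nn_integral_distr) auto
  also have "\<dots> = (\<integral>\<^sup>+x. indicator A x \<partial>circle)" using A by (intro nn_integral_circle_rotate) auto
  finally show "emeasure (distr circle circle (\<lambda>x. frac (x - y))) A = emeasure circle A" using A by simp
qed simp

lemma cis_int_frac: "cis (2 * pi * of_int n * frac x) = cis (2 * pi * of_int n * x)"
proof -
  have "2 * pi * of_int n * frac x = 2 * pi * of_int n * x - 2 * pi * of_int (n * \<lfloor>x\<rfloor>)"
    by (simp add: frac_def algebra_simps)
  then show ?thesis by (simp only: cis_divide[symmetric] cis_multiple_2pi[OF Ints_of_int]) simp
qed

text \<open>For \<open>n \<noteq> 0\<close>, rotation by \<open>1 / (2 * n)\<close> changes the sign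
  of the character but preserves its integral.\<close>

lemma integral_cis_circle: "(\<integral>x. cis (2 * pi * of_int n * x) \<partial>circle) = (if n = 0 then 1 else 0)"
proof (cases "n = 0")
  case True then show ?thesis by (simp add: circle.prob_space)
next
  case False
  note [measurable] = borel_measurable_id_circle
  have m: "(\<lambda>x. frac (x - y)) \<in> circle \<rightarrow>\<^sub>M circle" for y
    by (rule measurable_compose[OF _ measurable_frac_circle]) measurable
  have mc: "(\<lambda>x. cis (2 * pi * of_int n * x)) \<in> borel_measurable circle" unfolding cis_conv_exp by measurable
  define y where "y = 1 / (2 * real_of_int n)"
  let ?I = "\<integral>x. cis (2 * pi * of_int n * x) \<partial>circle"
  have "?I = (\<integral>x. cis (2 * pi * of_int n * x) \<partial>distr circle circle (\<lambda>x. frac (x - y)))"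
    by (simp only: distr_circle_rotate)
  also have "\<dots> = (\<integral>x. cis (2 * pi * of_int n * frac (x - y)) \<partial>circle)"
    by (rule integral_distr[OF m mc])
  also have "\<dots> = (\<integral>x. - cis (2 * pi * of_int n * x) \<partial>circle)"
  proof (rule Bochner_Integration.integral_cong[OF refl])
    fix x
    have "2 * pi * of_int n * (x - y) = 2 * pi * of_int n * x - pi" using False by (simp add: y_def algebra_simps)
    then show "cis (2 * pi * of_int n * frac (x - y)) = - cis (2 * pi * of_int n * x)"
      by (simp only: cis_int_frac cis_divide[symmetric] cis_pi) simp
  qed
  also have "\<dots> = - ?I" by simp
  finally show ?thesis using False by (simp add: eq_neg_iff_add_eq_0)
qed

lemma Lp_norm_trig_poly:
  assumes I: "finite I"
  shows "abs_circle_fun (trig_poly I c) \<in> Lp 2"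
    and "(Lp_norm 2 (abs_circle_fun (trig_poly I c)))\<^sup>2 = (\<Sum>n\<in>I. (norm (c n))\<^sup>2)"
proof -
  note [measurable] = borel_measurable_id_circle
  have bd: "norm (trig_poly I c x) \<le> (\<Sum>n\<in>I. norm (c n))" for x
    unfolding trig_poly_def by (rule order_trans[OF norm_sum]) (simp add: norm_mult)
  then show L: "abs_circle_fun (trig_poly I c) \<in> Lp 2"
    by (intro sup_bounded_Lp[of "\<Sum>n\<in>I. norm (c n)"]) (use measurable_trig_poly in \<open>auto simp only: sup_bounded_def\<close>)
  have int: "integrable circle (\<lambda>x. c n * cnj (c m) * cis (2 * pi * of_int (n - m) * x))" for n m
    by (rule circle.integrable_const_bound[of _ "norm (c n * cnj (c m))"])
      (auto simp: norm_mult cis_conv_exp)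
  have pt: "complex_of_real ((norm (trig_poly I c x))\<^sup>2)
      = (\<Sum>n\<in>I. \<Sum>m\<in>I. c n * cnj (c m) * cis (2 * pi * of_int (n - m) * x))" for x
  proof -
    have "cis (2 * pi * of_int (n - m) * x) = cis (2 * pi * of_int n * x) * cnj (cis (2 * pi * of_int m * x))" for n m
      by (simp add: cis_cnj cis_mult algebra_simps)
    then show ?thesis unfolding complex_norm_square trig_poly_def cnj_sum sum_product by (simp add: mult_ac)
  qed
  have "complex_of_real (\<integral>x. (norm (trig_poly I c x))\<^sup>2 \<partial>circle) = (\<integral>x. complex_of_real ((norm (trig_poly I c x))\<^sup>2) \<partial>circle)"
    by (rule integral_complex_of_real[symmetric])
  also have "\<dots> = (\<Sum>n\<in>I. \<Sum>m\<in>I. (\<integral>x. c n * cnj (c m) * cis (2 * pi * of_int (n - m) * x) \<partial>circle))"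
    unfolding pt using int by (simp add: Bochner_Integration.integral_sum)
  also have "\<dots> = (\<Sum>n\<in>I. \<Sum>m\<in>I. if m = n then c n * cnj (c m) else 0)"
  proof (intro sum.cong refl)
    fix n m
    show "(\<integral>x. c n * cnj (c m) * cis (2 * pi * of_int (n - m) * x) \<partial>circle) = (if m = n then c n * cnj (c m) else 0)"
      using integral_cis_circle[of "n - m"] by simp
  qed
  also have "\<dots> = of_real (\<Sum>n\<in>I. (norm (c n))\<^sup>2)" using I by (simp add: complex_norm_square of_real_sum del: of_real_power)
  finally have "(\<integral>x. (norm (trig_poly I c x))\<^sup>2 \<partial>circle) = (\<Sum>n\<in>I. (norm (c n))\<^sup>2)" by (simp only: of_real_eq_iff)
  then show "(Lp_norm 2 (abs_circle_fun (trig_poly I c)))\<^sup>2 = (\<Sum>n\<in>I. (norm (c n))\<^sup>2)"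
    by (simp add: Lp_norm_abs powr_half_sqrt sum_nonneg)
qed

section \<open>Density in \<open>L^2\<close>\<close>

lemma Lp_norm_diff_small:
  assumes [measurable]: "f \<in> borel_measurable circle" "\<And>n. g n \<in> borel_measurable circle" "w \<in> borel_measurable circle"
    and lim: "AE x in circle. (\<lambda>n. g n x) \<longlonglongrightarrow> f x"
    and dom: "\<And>n. AE x in circle. (norm (f x - g n x))\<^sup>2 \<le> w x" and w: "integrable circle w" and e: "0 < e"
  shows "\<exists>n. abs_circle_fun f - abs_circle_fun (g n) \<in> Lp 2 \<and> Lp_norm 2 (abs_circle_fun f - abs_circle_fun (g n)) < e"
proof -
  have "(\<lambda>n. \<integral>x. (norm (f x - g n x))\<^sup>2 \<partial>circle) \<longlonglongrightarrow> (\<integral>x. 0 \<partial>circle)"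
  proof (rule integral_dominated_convergence[OF _ _ w])
    show "AE x in circle. (\<lambda>n. (norm (f x - g n x))\<^sup>2) \<longlonglongrightarrow> 0"
      using lim
    proof eventually_elim
      case (elim x)
      have "(\<lambda>n. (norm (f x - g n x))\<^sup>2) \<longlonglongrightarrow> (norm (f x - f x))\<^sup>2" by (intro tendsto_intros elim)
      then show ?case by simp
    qed
  qed (use dom in auto)
  then have "eventually (\<lambda>n. (\<integral>x. (norm (f x - g n x))\<^sup>2 \<partial>circle) < e\<^sup>2) sequentially"
    using e by (intro order_tendstoD(2)) auto
  then obtain n where n: "(\<integral>x. (norm (f x - g n x))\<^sup>2 \<partial>circle) < e\<^sup>2" by (auto simp: eventually_sequentially)
  have i: "integrable circle (\<lambda>x. (norm (f x - g n x))\<^sup>2)"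
    by (rule Bochner_Integration.integrable_bound[OF w]) (use dom[of n] in \<open>auto elim!: eventually_mono\<close>)
  have "sqrt (\<integral>x. (norm (f x - g n x))\<^sup>2 \<partial>circle) < e"
    using n e by (metis real_sqrt_less_iff real_sqrt_abs abs_of_pos)
  then show ?thesis using i
    by (intro exI[of _ n]) (simp add: abs_circle_fun_diff abs_in_Lp_iff Lp_norm_abs powr_half_sqrt)
qed

lemma bounded_approx_continuous:
  fixes f :: "real \<Rightarrow> complex"
  assumes f: "f \<in> borel_measurable circle" and B: "0 < B" "\<And>x. norm (f x) \<le> B"
  shows "\<exists>g. (\<forall>n. continuous_on UNIV (g n) \<and> g n 0 = g n 1 \<and> (\<forall>x. norm (g n x) \<le> B)) \<and>
     (AE x in circle. (\<lambda>n::nat. g n x) \<longlonglongrightarrow> f x)"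
proof -
  define h where "h x = (if x \<in> {0..<1} then f x else 0)" for x
  have hb: "h \<in> borel_measurable lborel"
  proof -
    have "h = (\<lambda>x. indicator {0..<1} x *\<^sub>R f x)" by (auto simp: h_def fun_eq_iff)
    then show ?thesis
      using f unfolding circle_def by (subst (asm) borel_measurable_restrict_space_iff) auto
  qed
  then have "h \<in> borel_measurable lebesgue" by (simp add: measurable_completion)
  then have "h measurable_on UNIV" by (rule lebesgue_measurable_imp_measurable_on) simp
  then obtain N k where N: "negligible N" "\<And>n. continuous_on UNIV (k n)" "\<And>x. x \<notin> N \<Longrightarrow> (\<lambda>n. k n x) \<longlonglongrightarrow> h x"
    unfolding measurable_on_def by auto
  \<comment> \<open>The first factor is a cut-off vanishing at 0 and 1, which gives equal boundary
    values; the second clips the norm at \<open>B\<close>. At interior points outside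
    \<open>N\<close> the cut-off is eventually 1 and the clipping factor tends to 1.\<close>
  define g where "g n x = (max 0 (min 1 (min (real n * x) (real n * (1 - x)))) * (B / max B (norm (k n x)))) *\<^sub>R k n x" for n x
  have cont: "continuous_on UNIV (g n)" for n
    unfolding g_def using N(2) B by (intro continuous_intros) (auto simp: max_def)
  have g01: "g n 0 = g n 1" for n by (simp add: g_def)
  have gb: "norm (g n x) \<le> B" for n x
  proof -
    have "norm (g n x) = max 0 (min 1 (min (real n * x) (real n * (1 - x)))) * (B / max B (norm (k n x)) * norm (k n x))"
      using B by (simp add: g_def abs_mult)
    also have "\<dots> \<le> 1 * B"
    proof (intro mult_mono)
      show "B / max B (norm (k n x)) * norm (k n x) \<le> B"
        using B by (simp add: divide_le_eq max_def mult_left_mono)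
    qed (use B in auto)
    finally show ?thesis by simp
  qed
  have lim: "(\<lambda>n. g n x) \<longlonglongrightarrow> f x" if x: "x \<in> {0<..<1}" "x \<notin> N" for x
  proof -
    have kl: "(\<lambda>n. k n x) \<longlonglongrightarrow> f x" using N(3)[OF x(2)] x by (simp add: h_def)
    have "(\<lambda>n. (B / max B (norm (k n x))) *\<^sub>R k n x) \<longlonglongrightarrow> (B / max B (norm (f x))) *\<^sub>R f x"
      using B by (intro tendsto_intros kl) (auto simp: max_def)
    also have "(B / max B (norm (f x))) *\<^sub>R f x = f x" using B by (simp add: max_absorb1)
    finally have l: "(\<lambda>n. (B / max B (norm (k n x))) *\<^sub>R k n x) \<longlonglongrightarrow> f x" .
    obtain m where m: "1 / min x (1 - x) < real m" using reals_Archimedean2 by blast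
    have "eventually (\<lambda>n. g n x = (B / max B (norm (k n x))) *\<^sub>R k n x) sequentially"
      using eventually_ge_at_top[of m]
    proof eventually_elim
      case (elim n)
      have p: "0 < min x (1 - x)" using x by simp
      then have "1 < real m * min x (1 - x)" using m by (simp add: divide_less_eq)
      also have "\<dots> \<le> real n * min x (1 - x)" using elim p by (intro mult_right_mono) auto
      finally have "1 < real n * min x (1 - x)" .
      moreover have "real n * min x (1 - x) \<le> real n * x" "real n * min x (1 - x) \<le> real n * (1 - x)"
        by (intro mult_left_mono; simp)+
      ultimately show ?case by (simp add: g_def)
    qed
    then show ?thesis using l by (subst tendsto_cong)
  qed
  have "negligible (insert 0 N)" using N(1) by simp
  then have "insert 0 N \<in> null_sets lebesgue" by (simp add: negligible_iff_null_sets)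
  then have "AE x in lebesgue. x \<notin> insert 0 N" by (rule AE_not_in)
  then have "AE x in lborel. x \<notin> insert 0 N" by (simp add: AE_completion_iff)
  then have "AE x in circle. (\<lambda>n. g n x) \<longlonglongrightarrow> f x"
    unfolding AE_circle_iff by eventually_elim (auto intro!: lim)
  then show ?thesis using cont g01 gb by blast
qed

lemma trig_poly_dense_L2:
  assumes F: "F \<in> Lp 2" and e: "0 < e"
  shows "\<exists>I c. finite I \<and> Lp_norm 2 (F - abs_circle_fun (trig_poly I c)) < e"
proof -
  obtain f where f: "f \<in> borel_measurable circle" "F = abs_circle_fun f" by (rule circle_fun_cases)
  note [measurable] = f(1)
  have e3: "0 < e / 3" using e by simp
  \<comment> \<open>Three approximations in turn: by bounded functions, by continuous periodic ones,
    and uniformly by trigonometric polynomials.\<close>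
  define t where "t n x = (if norm (f x) \<le> real n then f x else 0)" for n x
  have tm [measurable]: "t n \<in> borel_measurable circle" for n unfolding t_def by measurable
  have "\<exists>n. abs_circle_fun f - abs_circle_fun (t n) \<in> Lp 2 \<and> Lp_norm 2 (abs_circle_fun f - abs_circle_fun (t n)) < e / 3"
  proof (rule Lp_norm_diff_small[OF f(1) tm _ _ _ _ e3])
    show "integrable circle (\<lambda>x. (norm (f x))\<^sup>2)" using F f by (simp add: abs_in_Lp_iff)
    show "AE x in circle. (\<lambda>n. t n x) \<longlonglongrightarrow> f x"
    proof (rule AE_I2)
      fix x
      obtain m where m: "norm (f x) < real m" using reals_Archimedean2 by blast
      have "eventually (\<lambda>n. t n x = f x) sequentially"
        using eventually_ge_at_top[of m] by eventually_elim (use m in \<open>auto simp: t_def\<close>)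
      then show "(\<lambda>n. t n x) \<longlonglongrightarrow> f x" by (rule tendsto_eventually)
    qed
    show "AE x in circle. (norm (f x - t n x))\<^sup>2 \<le> (norm (f x))\<^sup>2" for n by (simp add: t_def)
  qed simp
  then obtain n where n: "abs_circle_fun f - abs_circle_fun (t n) \<in> Lp 2" "Lp_norm 2 (abs_circle_fun f - abs_circle_fun (t n)) < e / 3"
    by blast
  define B where "B = real n + 1"
  have B: "0 < B" "\<And>x. norm (t n x) \<le> B" by (auto simp: B_def t_def)
  obtain g where g: "\<And>k. continuous_on UNIV (g k)" "\<And>k. g k 0 = g k 1" "\<And>k x. norm (g k x) \<le> B"
    "AE x in circle. (\<lambda>k::nat. g k x) \<longlonglongrightarrow> t n x"
    using bounded_approx_continuous[OF tm B] by blast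
  note [measurable] = borel_measurable_id_circle
  have gm [measurable]: "g k \<in> borel_measurable circle" for k
    using measurable_compose[OF borel_measurable_id_circle borel_measurable_continuous_onI[OF g(1)]] by simp
  have "\<exists>k. abs_circle_fun (t n) - abs_circle_fun (g k) \<in> Lp 2 \<and> Lp_norm 2 (abs_circle_fun (t n) - abs_circle_fun (g k)) < e / 3"
  proof (rule Lp_norm_diff_small[OF tm gm _ g(4) _ _ e3])
    show "integrable circle (\<lambda>x. (2 * B)\<^sup>2)" by simp
    show "AE x in circle. (norm (t n x - g k x))\<^sup>2 \<le> (2 * B)\<^sup>2" for k
    proof (rule AE_I2, rule power_mono)
      fix x show "norm (t n x - g k x) \<le> 2 * B"
        using norm_triangle_ineq4[of "t n x" "g k x"] B(2)[of x] g(3)[of k x] by linarith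
    qed simp
  qed simp
  then obtain k where k: "abs_circle_fun (t n) - abs_circle_fun (g k) \<in> Lp 2" "Lp_norm 2 (abs_circle_fun (t n) - abs_circle_fun (g k)) < e / 3"
    by blast
  obtain q where q: "is_trig_poly q" "\<And>x. x \<in> {0..1} \<Longrightarrow> norm (g k x - q x) < e / 4"
    using trig_poly_uniform_approx[of "g k" "e / 4"] g(1)[of k] g(2)[of k] e continuous_on_subset by (metis subset_UNIV zero_less_divide_iff zero_less_numeral)
  obtain I c where I: "finite I" "q = trig_poly I c" using q(1) by (auto simp: is_trig_poly_def)
  have qm [measurable]: "q \<in> borel_measurable circle" unfolding I by measurable
  have "(\<integral>\<^sup>+x. ennreal (norm (g k x - q x) powr 2) \<partial>circle) \<le> (\<integral>\<^sup>+x. ennreal ((e / 4) powr 2) \<partial>circle)"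
  proof (rule nn_integral_mono)
    fix x assume "x \<in> space circle"
    then have "norm (g k x - q x) \<le> e / 4" using q(2)[of x] by (simp add: space_circle)
    then show "ennreal (norm (g k x - q x) powr 2) \<le> ennreal ((e / 4) powr 2)" by (intro ennreal_leI powr_mono2) auto
  qed
  then have le: "(\<integral>\<^sup>+x. ennreal (norm (g k x - q x) powr 2) \<partial>circle) \<le> ennreal ((e / 4) powr 2)"
    by (simp add: circle.emeasure_space_1)
  have "(\<lambda>x. g k x - q x) \<in> borel_measurable circle" by measurable
  from Lp_norm_leI[OF this _ _ le] e
  have q': "abs_circle_fun (g k) - abs_circle_fun q \<in> Lp 2" "Lp_norm 2 (abs_circle_fun (g k) - abs_circle_fun q) \<le> e / 4"
    by (simp_all add: abs_circle_fun_diff)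
  have eq: "F - abs_circle_fun q = (abs_circle_fun f - abs_circle_fun (t n)) + ((abs_circle_fun (t n) - abs_circle_fun (g k)) + (abs_circle_fun (g k) - abs_circle_fun q))"
    using f by simp
  have "Lp_norm 2 (F - abs_circle_fun q) < e"
    unfolding eq using Lp_add[OF n(1) Lp_add(1)[OF k(1) q'(1)]] Lp_add(2)[OF k(1) q'(1)] n(2) k(2) q'(2) e by simp
  then show ?thesis using I by blast
qed

section \<open>Interpolation\<close>

context circle_measure
begin

lemma cis_measurable_nu: "(\<lambda>y. cis (a * y)) \<in> borel_measurable \<nu>"
proof -
  note [measurable] = borel_measurable_id_nu
  show ?thesis unfolding cis_conv_exp by measurable
qed

lemma conv_trig_poly: "conv (trig_poly I c) = trig_poly I (\<lambda>n. c n * fourier_coeff n)"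
proof
  fix x
  have i: "integrable \<nu> (\<lambda>y. c n * cis (2 * pi * of_int n * x) * cis (- 2 * pi * of_int n * y))" for n
  proof (rule integrable_const_bound[of _ "norm (c n)"])
    have [measurable]: "(\<lambda>y. cis (- 2 * pi * of_int n * y)) \<in> borel_measurable \<nu>" by (rule cis_measurable_nu)
    show "(\<lambda>y. c n * cis (2 * pi * of_int n * x) * cis (- 2 * pi * of_int n * y)) \<in> borel_measurable \<nu>"
      by measurable
  qed (simp add: norm_mult)
  have "cis (2 * pi * of_int n * frac (x - y)) = cis (2 * pi * of_int n * x) * cis (- 2 * pi * of_int n * y)" for n y
    unfolding cis_int_frac by (simp add: cis_mult algebra_simps)
  then have "conv (trig_poly I c) x = (\<integral>y. (\<Sum>n\<in>I. c n * cis (2 * pi * of_int n * x) * cis (- 2 * pi * of_int n * y)) \<partial>\<nu>)"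
    by (simp add: conv_def trig_poly_def mult.assoc)
  also have "\<dots> = (\<Sum>n\<in>I. \<integral>y. c n * cis (2 * pi * of_int n * x) * cis (- 2 * pi * of_int n * y) \<partial>\<nu>)"
    using i by (rule Bochner_Integration.integral_sum)
  also have "\<dots> = trig_poly I (\<lambda>n. c n * fourier_coeff n) x"
    by (simp add: trig_poly_def fourier_coeff_def mult_ac)
  finally show "conv (trig_poly I c) x = trig_poly I (\<lambda>n. c n * fourier_coeff n) x" .
qed

lemma root_product_trig_poly:
  "root_product ws (abs_circle_fun (trig_poly I c)) = abs_circle_fun (trig_poly I (\<lambda>n. c n * (\<Prod>w\<leftarrow>ws. fourier_coeff n - w)))"
proof (induction ws)
  case (Cons w ws)
  have "trig_poly I (\<lambda>n. d n * fourier_coeff n) x - w * trig_poly I d x = trig_poly I (\<lambda>n. d n * (fourier_coeff n - w)) x" for d x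
    by (simp add: trig_poly_def sum_distrib_left sum_subtractf[symmetric] algebra_simps)
  note eq = this
  define d where "d = (\<lambda>n. c n * (\<Prod>w\<leftarrow>ws. fourier_coeff n - w))"
  have "root_product ws (abs_circle_fun (trig_poly I c)) = abs_circle_fun (trig_poly I d)"
    using Cons by (simp only: d_def)
  then have "root_product (w # ws) (abs_circle_fun (trig_poly I c)) = abs_circle_fun (trig_poly I (\<lambda>n. d n * (fourier_coeff n - w)))"
    by (simp add: T_abs conv_trig_poly abs_circle_fun_scale abs_circle_fun_diff eq)
  then show ?case by (simp add: d_def mult_ac)
qed simp

text \<open>On trigonometric polynomials \<open>root_product ws\<close> multiplies the coefficients,
  and Parseval gives the bound. The crude operator bound \<open>C\<close>, the product of the
  \<open>1 + norm w\<close>, then transfers it to all of \<open>L^2\<close> by density.\<close>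

lemma root_product_L2:
  assumes F: "F \<in> Lp 2" and bound: "\<And>n. norm (\<Prod>w\<leftarrow>ws. fourier_coeff n - w) \<le> \<epsilon>"
  shows "Lp_norm 2 (root_product ws F) \<le> \<epsilon> * Lp_norm 2 F"
proof -
  have \<epsilon>: "0 \<le> \<epsilon>" using bound[of 0] norm_ge_zero order_trans by blast
  have trig: "Lp_norm 2 (root_product ws (abs_circle_fun (trig_poly I c))) \<le> \<epsilon> * Lp_norm 2 (abs_circle_fun (trig_poly I c))"
    if I: "finite I" for I c
  proof (rule power2_le_imp_le)
    have "(Lp_norm 2 (root_product ws (abs_circle_fun (trig_poly I c))))\<^sup>2 = (\<Sum>n\<in>I. (norm (c n * (\<Prod>w\<leftarrow>ws. fourier_coeff n - w)))\<^sup>2)"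
      unfolding root_product_trig_poly by (rule Lp_norm_trig_poly(2)[OF I])
    also have "\<dots> \<le> (\<Sum>n\<in>I. \<epsilon>\<^sup>2 * (norm (c n))\<^sup>2)"
    proof (rule sum_mono)
      fix n
      have "(norm (\<Prod>w\<leftarrow>ws. fourier_coeff n - w))\<^sup>2 \<le> \<epsilon>\<^sup>2" using bound by (intro power_mono) auto
      then have "(norm (c n))\<^sup>2 * (norm (\<Prod>w\<leftarrow>ws. fourier_coeff n - w))\<^sup>2 \<le> (norm (c n))\<^sup>2 * \<epsilon>\<^sup>2" by (intro mult_left_mono) auto
      then show "(norm (c n * (\<Prod>w\<leftarrow>ws. fourier_coeff n - w)))\<^sup>2 \<le> \<epsilon>\<^sup>2 * (norm (c n))\<^sup>2"
        by (simp add: norm_mult power_mult_distrib mult.commute)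
    qed
    also have "\<dots> = (\<epsilon> * Lp_norm 2 (abs_circle_fun (trig_poly I c)))\<^sup>2"
      using Lp_norm_trig_poly(2)[OF I] by (simp add: power_mult_distrib sum_distrib_left)
    finally show "(Lp_norm 2 (root_product ws (abs_circle_fun (trig_poly I c))))\<^sup>2 \<le> (\<epsilon> * Lp_norm 2 (abs_circle_fun (trig_poly I c)))\<^sup>2" .
    show "0 \<le> \<epsilon> * Lp_norm 2 (abs_circle_fun (trig_poly I c))" using \<epsilon> by simp
  qed
  define C where "C = (\<Prod>w\<leftarrow>ws. 1 + norm w)"
  have C: "0 \<le> C" unfolding C_def by (induction ws) auto
  have F1: "F \<in> Lp 1" by (rule Lp_mono[OF F]) auto
  show ?thesis
  proof (rule field_le_epsilon)
    fix e :: real assume e: "0 < e"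
    define e' where "e' = e / (C + \<epsilon> + 1)"
    have e': "0 < e'" "(C + \<epsilon>) * e' \<le> e"
    proof -
      show "0 < e'" using e C \<epsilon> by (simp add: e'_def)
      have "(C + \<epsilon>) * e' \<le> (C + \<epsilon> + 1) * e'" using \<open>0 < e'\<close> by (intro mult_right_mono) auto
      then show "(C + \<epsilon>) * e' \<le> e" using C \<epsilon> by (simp add: e'_def)
    qed
    obtain I c where I: "finite I" "Lp_norm 2 (F - abs_circle_fun (trig_poly I c)) < e'"
      using trig_poly_dense_L2[OF F e'(1)] by blast
    define G where "G = abs_circle_fun (trig_poly I c)"
    have G: "G \<in> Lp 2" unfolding G_def by (rule Lp_norm_trig_poly(1)[OF I(1)])
    have G1: "G \<in> Lp 1" by (rule Lp_mono[OF G]) auto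
    have D: "F - G \<in> Lp 2" by (rule Lp_diff(1)[OF F G]) simp
    have nG: "Lp_norm 2 G \<le> Lp_norm 2 F + e'"
      using Lp_diff(2)[OF F D] I(2) by (simp add: G_def)
    have R: "root_product ws (F - G) \<in> Lp 2 \<and> Lp_norm 2 (root_product ws (F - G)) \<le> C * Lp_norm 2 (F - G)"
      unfolding C_def by (rule root_product_Lp[OF D]) simp
    have RG: "root_product ws G \<in> Lp 2" using root_product_Lp[OF G, of ws] by simp
    have "root_product ws F = root_product ws (F - G) + root_product ws G"
      by (simp add: root_product_diff[OF F1 G1])
    then have "Lp_norm 2 (root_product ws F) \<le> Lp_norm 2 (root_product ws (F - G)) + Lp_norm 2 (root_product ws G)"
      using Lp_add(2)[of "root_product ws (F - G)" 2 "root_product ws G"] R RG by simp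
    also have "\<dots> \<le> C * e' + \<epsilon> * (Lp_norm 2 F + e')"
    proof (rule add_mono)
      show "Lp_norm 2 (root_product ws (F - G)) \<le> C * e'"
        using R I(2) mult_left_mono[of "Lp_norm 2 (F - G)" e' C] C by (simp add: G_def)
      show "Lp_norm 2 (root_product ws G) \<le> \<epsilon> * (Lp_norm 2 F + e')"
        using trig[OF I(1), of c] mult_left_mono[OF nG \<epsilon>] by (simp add: G_def)
    qed
    also have "\<dots> = \<epsilon> * Lp_norm 2 F + (C + \<epsilon>) * e'" by (simp add: algebra_simps)
    also have "\<dots> \<le> \<epsilon> * Lp_norm 2 F + e" using e'(2) by simp
    finally show "Lp_norm 2 (root_product ws F) \<le> \<epsilon> * Lp_norm 2 F + e" .
  qed
qed

end

text \<open>What real interpolation consumes: additivity, for splitting a function into its large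
  and small parts, and bounds at the exponents 1, 2 and infinity.\<close>

definition endpoint_bounds :: "(circle_fun \<Rightarrow> circle_fun) \<Rightarrow> real \<Rightarrow> real \<Rightarrow> bool" where
  "endpoint_bounds A M \<epsilon> \<longleftrightarrow>
     (\<forall>F\<in>Lp 1. \<forall>G\<in>Lp 1. A (F + G) = A F + A G) \<and>
     (\<forall>F\<in>Lp 1. A F \<in> Lp 1 \<and> Lp_norm 1 (A F) \<le> M * Lp_norm 1 F) \<and>
     (\<forall>F\<in>Lp 2. A F \<in> Lp 2 \<and> Lp_norm 2 (A F) \<le> \<epsilon> * Lp_norm 2 F) \<and>
     (\<forall>b F. sup_bounded b F \<longrightarrow> sup_bounded (M * b) (A F))"

lemma ennreal_mult3: "0 \<le> a \<Longrightarrow> 0 \<le> b \<Longrightarrow> 0 \<le> c \<Longrightarrow> ennreal (a * (b * c)) = ennreal a * (ennreal b * ennreal c)"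
  by (simp add: ennreal_mult)

section \<open>Layer cake formula and Marcinkiewicz interpolation\<close>

lemma nn_integral_powr_layer:
  fixes p t :: real
  assumes "0 < p" "0 \<le> t"
  shows "(\<integral>\<^sup>+s. ennreal (p * s powr (p - 1)) * indicator {0..t} s \<partial>lborel) = ennreal (t powr p)"
proof -
  have "((\<lambda>s. p * s powr (p - 1)) has_integral p * (t powr (p - 1 + 1) / (p - 1 + 1))) {0..t}"
    using assms by (intro has_integral_mult_right has_integral_powr_from_0) auto
  then show ?thesis using assms
    by (subst nn_integral_has_integral_lebesgue'[where I="t powr p"]) auto
qed

text \<open>Layer cake: \<open>h x powr p\<close> is the integral of
  \<open>p * s powr (p - 1)\<close> over \<open>0 \<le> s \<le> h x\<close>. After Tonelli the
  measure of a level set appears and is replaced by the integral of \<open>k s\<close>; a second use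
  of Tonelli leaves an integral over \<open>s\<close> for each fixed \<open>x\<close>.\<close>

lemma strong_type_of_distribution:
  fixes h :: "real \<Rightarrow> real" and k :: "real \<Rightarrow> real \<Rightarrow> ennreal"
  assumes [measurable]: "h \<in> borel_measurable circle" and h: "\<And>x. 0 \<le> h x" and p: "0 < p"
    and k: "(\<lambda>(s, x). k s x) \<in> borel_measurable (lborel \<Otimes>\<^sub>M circle)"
    and weak: "\<And>s. 0 < s \<Longrightarrow> emeasure circle {x \<in> space circle. s \<le> h x} \<le> (\<integral>\<^sup>+x. k s x \<partial>circle)"
  shows "(\<integral>\<^sup>+x. ennreal (h x powr p) \<partial>circle)
    \<le> (\<integral>\<^sup>+x. \<integral>\<^sup>+s. ennreal (p * s powr (p - 1)) * indicator {0..} s * k s x \<partial>lborel \<partial>circle)"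
proof -
  interpret pair_sigma_finite lborel circle
    by (intro pair_sigma_finite.intro sigma_finite_lborel sigma_finite_circle)
  define w where "w s = ennreal (p * s powr (p - 1)) * indicator {0..} s" for s :: real
  have [measurable]: "w \<in> borel_measurable lborel" unfolding w_def by measurable
  have [measurable]: "(\<lambda>z. k (fst z) (snd z)) \<in> borel_measurable (lborel \<Otimes>\<^sub>M circle)"
    using k by (simp add: case_prod_beta')
  have "(\<integral>\<^sup>+x. ennreal (h x powr p) \<partial>circle) = (\<integral>\<^sup>+x. \<integral>\<^sup>+s. w s * indicator {x. s \<le> h x} x \<partial>lborel \<partial>circle)"
  proof (rule nn_integral_cong)
    fix x
    have "ennreal (h x powr p) = (\<integral>\<^sup>+s. ennreal (p * s powr (p - 1)) * indicator {0..h x} s \<partial>lborel)"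
      using p h by (simp add: nn_integral_powr_layer)
    also have "\<dots> = (\<integral>\<^sup>+s. w s * indicator {x. s \<le> h x} x \<partial>lborel)"
      by (intro nn_integral_cong) (auto simp: w_def split: split_indicator)
    finally show "ennreal (h x powr p) = (\<integral>\<^sup>+s. w s * indicator {x. s \<le> h x} x \<partial>lborel)" .
  qed
  also have "\<dots> = (\<integral>\<^sup>+s. \<integral>\<^sup>+x. w s * indicator {x. s \<le> h x} x \<partial>circle \<partial>lborel)"
  proof (rule Fubini')
    have "(\<lambda>z. w (fst z) * indicator {z \<in> space (lborel \<Otimes>\<^sub>M circle). fst z \<le> h (snd z)} z) \<in> borel_measurable (lborel \<Otimes>\<^sub>M circle)"
      by measurable
    then show "(\<lambda>(s, x). w s * indicator {x. s \<le> h x} x) \<in> borel_measurable (lborel \<Otimes>\<^sub>M circle)"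
      by (rule measurable_cong[THEN iffD1, rotated]) (auto split: split_indicator)
  qed
  also have "\<dots> \<le> (\<integral>\<^sup>+s. \<integral>\<^sup>+x. w s * k s x \<partial>circle \<partial>lborel)"
  proof (rule nn_integral_mono)
    fix s :: real
    show "(\<integral>\<^sup>+x. w s * indicator {x. s \<le> h x} x \<partial>circle) \<le> (\<integral>\<^sup>+x. w s * k s x \<partial>circle)"
    proof (cases "0 < s")
      case True
      have [measurable]: "(\<lambda>x. k s x) \<in> borel_measurable circle"
        using measurable_Pair2[OF k, of s] by simp
      have "(\<integral>\<^sup>+x. w s * indicator {x. s \<le> h x} x \<partial>circle) = (\<integral>\<^sup>+x. w s * indicator {x \<in> space circle. s \<le> h x} x \<partial>circle)"
        by (intro nn_integral_cong) (auto split: split_indicator)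
      also have "\<dots> = w s * emeasure circle {x \<in> space circle. s \<le> h x}"
        by (rule nn_integral_cmult_indicator) measurable
      also have "\<dots> \<le> w s * (\<integral>\<^sup>+x. k s x \<partial>circle)" by (intro mult_left_mono weak True) simp
      also have "\<dots> = (\<integral>\<^sup>+x. w s * k s x \<partial>circle)" by (rule nn_integral_cmult[symmetric]) measurable
      finally show ?thesis .
    next
      case False
      \<comment> \<open>At \<open>s = 0\<close> the weight vanishes because
        \<open>0 powr (p - 1) = 0\<close> for every \<open>p\<close>.\<close>
      then have "w s = 0" by (cases "s = 0") (auto simp: w_def)
      then show ?thesis by simp
    qed
  qed
  also have "\<dots> = (\<integral>\<^sup>+x. \<integral>\<^sup>+s. w s * k s x \<partial>lborel \<partial>circle)"
    by (rule Fubini'[symmetric]) (simp add: case_prod_beta')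
  finally show ?thesis by (simp add: w_def)
qed

lemma emeasure_ge_le_Lp_norm:
  assumes f: "f \<in> borel_measurable circle" "abs_circle_fun f \<in> Lp r" and r: "0 < r" and s: "0 < s"
  shows "emeasure circle {x \<in> space circle. s \<le> norm (f x)} \<le> ennreal ((Lp_norm r (abs_circle_fun f) / s) powr r)"
proof -
  note [measurable] = f(1)
  have "emeasure circle {x \<in> space circle. s \<le> norm (f x)} = (\<integral>\<^sup>+x. indicator {x \<in> space circle. s \<le> norm (f x)} x \<partial>circle)"
    by simp
  also have "\<dots> \<le> (\<integral>\<^sup>+x. ennreal (1 / s powr r) * ennreal (norm (f x) powr r) \<partial>circle)"
  proof (rule nn_integral_mono)
    fix x
    show "indicator {x \<in> space circle. s \<le> norm (f x)} x \<le> ennreal (1 / s powr r) * ennreal (norm (f x) powr r)"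
    proof (cases "s \<le> norm (f x)")
      case True
      then have "1 \<le> norm (f x) powr r / s powr r" using r s powr_mono2[of r s "norm (f x)"] by simp
      then show ?thesis by (auto simp: ennreal_mult'[symmetric] split: split_indicator)
    qed simp
  qed
  also have "\<dots> = ennreal (1 / s powr r) * ennreal (Lp_norm r (abs_circle_fun f) powr r)"
    by (subst nn_integral_cmult) (auto simp: nn_integral_powr_eq_Lp_norm[OF f r])
  also have "\<dots> = ennreal ((Lp_norm r (abs_circle_fun f) / s) powr r)"
    using s by (simp add: ennreal_mult'[symmetric] powr_divide)
  finally show ?thesis .
qed

text \<open>Marcinkiewicz interpolation between \<open>(1, 1)\<close> or \<open>(\<infinity>, \<infinity>)\<close> and \<open>(2, 2)\<close>. The constants are tracked because the
  spectral radius argument needs a positive power of \<open>\<epsilon>\<close>.\<close>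

lemma interpolation_above_2:
  assumes A: "endpoint_bounds A M \<epsilon>" and M: "0 < M" and \<epsilon>: "0 < \<epsilon>" and p: "2 < p" and F: "F \<in> Lp p"
  shows "A F \<in> Lp p \<and> Lp_norm p (A F) powr p \<le> (4 * p / (p - 2) * 2 powr (p - 2)) * M powr (p - 2) * \<epsilon> powr 2 * Lp_norm p F powr p"
proof -
  obtain f where f: "f \<in> borel_measurable circle" "F = abs_circle_fun f" by (rule circle_fun_cases)
  obtain g where g: "g \<in> borel_measurable circle" "A F = abs_circle_fun g" by (rule circle_fun_cases)
  note [measurable] = f(1) g(1)
  have F2: "F \<in> Lp 2" by (rule Lp_mono[OF F]) (use p in auto)
  define k where "k s x = ennreal (4 * \<epsilon>\<^sup>2 * s powr (- 2)) * (ennreal ((norm (f x))\<^sup>2) * indicator {z. 2 * M * norm (f (snd z)) > fst z} (s, x))" for s x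
  have "(\<integral>\<^sup>+x. ennreal (norm (g x) powr p) \<partial>circle)
      \<le> (\<integral>\<^sup>+x. \<integral>\<^sup>+s. ennreal (p * s powr (p - 1)) * indicator {0..} s * k s x \<partial>lborel \<partial>circle)"
  proof (rule strong_type_of_distribution)
    have "(\<lambda>z. ennreal (4 * \<epsilon>\<^sup>2 * fst z powr (- 2)) * (ennreal ((norm (f (snd z)))\<^sup>2) * indicator {z \<in> space (lborel \<Otimes>\<^sub>M circle). 2 * M * norm (f (snd z)) > fst z} z))
        \<in> borel_measurable (lborel \<Otimes>\<^sub>M circle)" by measurable
    then show "(\<lambda>(s, x). k s x) \<in> borel_measurable (lborel \<Otimes>\<^sub>M circle)"
      by (rule measurable_cong[THEN iffD1, rotated]) (auto simp: k_def split: split_indicator)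
    fix s :: real assume s: "0 < s"
    \<comment> \<open>At the level \<open>s / (2 * M)\<close> the image of the small part is at most
      \<open>s / 2\<close>, so where \<open>g\<close> reaches \<open>s\<close> the image of the
      large part must be at least \<open>s / 2\<close>.\<close>
    define lo where "lo x = (if 2 * M * norm (f x) > s then 0 else f x)" for x
    define hi where "hi x = (if 2 * M * norm (f x) > s then f x else 0)" for x
    have [measurable]: "lo \<in> borel_measurable circle" "hi \<in> borel_measurable circle"
      unfolding lo_def hi_def by measurable
    have lo: "sup_bounded (s / (2 * M)) (abs_circle_fun lo)"
      unfolding sup_bounded_def using M s by (intro exI[of _ lo]) (auto simp: lo_def field_simps)
    have Fsum: "F = abs_circle_fun lo + abs_circle_fun hi"
      by (simp add: f abs_circle_fun_add) (rule arg_cong[of _ _ abs_circle_fun], auto simp: lo_def hi_def fun_eq_iff)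
    then have hiF: "abs_circle_fun hi = F - abs_circle_fun lo" by simp
    have lo2: "abs_circle_fun lo \<in> Lp 2" by (rule sup_bounded_Lp[OF lo]) simp
    have hi2: "abs_circle_fun hi \<in> Lp 2" unfolding hiF by (rule Lp_diff(1)[OF F2 lo2]) simp
    have L1: "abs_circle_fun lo \<in> Lp 1" "abs_circle_fun hi \<in> Lp 1" using Lp_mono[OF lo2] Lp_mono[OF hi2] by auto
    obtain u where u: "u \<in> borel_measurable circle" "A (abs_circle_fun lo) = abs_circle_fun u" by (rule circle_fun_cases)
    obtain v where v: "v \<in> borel_measurable circle" "A (abs_circle_fun hi) = abs_circle_fun v" by (rule circle_fun_cases)
    note [measurable] = u(1) v(1)
    have "A F = A (abs_circle_fun lo) + A (abs_circle_fun hi)"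
      using A L1 Fsum by (simp add: endpoint_bounds_def)
    then have guv: "AE x in circle. g x = u x + v x"
      using g u v by (simp add: abs_circle_fun_add abs_circle_fun_eq_iff)
    have "sup_bounded (M * (s / (2 * M))) (A (abs_circle_fun lo))"
      using A lo unfolding endpoint_bounds_def by blast
    then have "sup_bounded (s / 2) (A (abs_circle_fun lo))" using M by simp
    then have ub: "AE x in circle. norm (u x) \<le> s / 2" by (rule sup_bounded_AE[OF _ u])
    have v2: "abs_circle_fun v \<in> Lp 2" "Lp_norm 2 (abs_circle_fun v) \<le> \<epsilon> * Lp_norm 2 (abs_circle_fun hi)"
      using A hi2 v unfolding endpoint_bounds_def by auto
    have "emeasure circle {x \<in> space circle. s \<le> norm (g x)} \<le> emeasure circle {x \<in> space circle. s / 2 \<le> norm (v x)}"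
    proof (rule emeasure_mono_AE)
      show "AE x in circle. x \<in> {x \<in> space circle. s \<le> norm (g x)} \<longrightarrow> x \<in> {x \<in> space circle. s / 2 \<le> norm (v x)}"
        using guv ub
      proof eventually_elim
        case (elim x)
        then show ?case using norm_triangle_ineq[of "u x" "v x"] by auto
      qed
    qed measurable
    also have "\<dots> \<le> ennreal ((Lp_norm 2 (abs_circle_fun v) / (s / 2)) powr 2)"
      using s v v2 by (intro emeasure_ge_le_Lp_norm) auto
    also have "\<dots> \<le> ennreal (((\<epsilon> * Lp_norm 2 (abs_circle_fun hi)) / (s / 2)) powr 2)"
      using s v2 by (intro ennreal_leI powr_mono2 divide_right_mono) auto
    also have "((\<epsilon> * Lp_norm 2 (abs_circle_fun hi)) / (s / 2)) powr 2 = (4 * \<epsilon>\<^sup>2 * s powr (- 2)) * Lp_norm 2 (abs_circle_fun hi) powr 2"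
      using s \<epsilon> by (simp add: powr_minus power_mult_distrib power_divide field_simps)
    also have "ennreal \<dots> = ennreal (4 * \<epsilon>\<^sup>2 * s powr (- 2)) * (\<integral>\<^sup>+x. ennreal (norm (hi x) powr 2) \<partial>circle)"
      using nn_integral_powr_eq_Lp_norm[OF _ hi2] by (simp add: ennreal_mult)
    also have "\<dots> = (\<integral>\<^sup>+x. ennreal (4 * \<epsilon>\<^sup>2 * s powr (- 2)) * ennreal (norm (hi x) powr 2) \<partial>circle)"
      by (rule nn_integral_cmult[symmetric]) measurable
    also have "\<dots> = (\<integral>\<^sup>+x. k s x \<partial>circle)"
      by (intro nn_integral_cong) (auto simp: k_def hi_def split: split_indicator)
    finally show "emeasure circle {x \<in> space circle. s \<le> norm (g x)} \<le> (\<integral>\<^sup>+x. k s x \<partial>circle)" .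
  qed (use p in auto)
  also have "\<dots> \<le> (\<integral>\<^sup>+x. ennreal ((4 * p / (p - 2) * 2 powr (p - 2)) * M powr (p - 2) * \<epsilon> powr 2) * ennreal (norm (f x) powr p) \<partial>circle)"
  proof (rule nn_integral_mono)
    fix x
    define y where "y = norm (f x)"
    \<comment> \<open>For fixed \<open>x\<close> there remains the integral of
      \<open>s powr (p - 3)\<close> over \<open>s < 2 * M * y\<close>, which converges at 0 because
      \<open>p > 2\<close>.\<close>
    define c where "c = 4 * p * \<epsilon>\<^sup>2 * y\<^sup>2 / (p - 2)"
    have c: "0 \<le> c" using p by (simp add: c_def)
    have "(\<integral>\<^sup>+s. ennreal (p * s powr (p - 1)) * indicator {0..} s * k s x \<partial>lborel)
        \<le> (\<integral>\<^sup>+s. ennreal c * (ennreal ((p - 2) * s powr (p - 2 - 1)) * indicator {0..2 * M * y} s) \<partial>lborel)"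
    proof (rule nn_integral_mono)
      fix s :: real
      show "ennreal (p * s powr (p - 1)) * indicator {0..} s * k s x
          \<le> ennreal c * (ennreal ((p - 2) * s powr (p - 2 - 1)) * indicator {0..2 * M * y} s)"
      proof (cases "0 \<le> s \<and> s < 2 * M * y")
        case True
        have e: "s powr (p - 1) * s powr (- 2) = s powr (p - 2 - 1)" by (simp add: powr_add[symmetric])
        have "(p * s powr (p - 1)) * ((4 * \<epsilon>\<^sup>2 * s powr (- 2)) * y\<^sup>2) = 4 * p * \<epsilon>\<^sup>2 * y\<^sup>2 * (s powr (p - 1) * s powr (- 2))"
          by (simp add: mult_ac)
        also have "\<dots> = c * ((p - 2) * s powr (p - 2 - 1))" unfolding e using p by (simp add: c_def)
        finally have eq: "(p * s powr (p - 1)) * ((4 * \<epsilon>\<^sup>2 * s powr (- 2)) * y\<^sup>2) = c * ((p - 2) * s powr (p - 2 - 1))" .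
        have "ennreal (p * s powr (p - 1)) * indicator {0..} s * k s x = ennreal (p * s powr (p - 1)) * (ennreal (4 * \<epsilon>\<^sup>2 * s powr (- 2)) * ennreal (y\<^sup>2))"
          using True by (simp add: k_def y_def)
        also have "\<dots> = ennreal ((p * s powr (p - 1)) * ((4 * \<epsilon>\<^sup>2 * s powr (- 2)) * y\<^sup>2))"
          by (rule ennreal_mult3[symmetric]) (use p in auto)
        also have "\<dots> = ennreal c * ennreal ((p - 2) * s powr (p - 2 - 1))" unfolding eq using c by (rule ennreal_mult')
        finally show ?thesis using True by simp
      next
        case False
        then show ?thesis by (auto simp: k_def y_def split: split_indicator)
      qed
    qed
    also have "\<dots> = ennreal c * ennreal ((2 * M * y) powr (p - 2))"
      using p M nn_integral_powr_layer[of "p - 2" "2 * M * y"] by (subst nn_integral_cmult) (auto simp: y_def)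
    also have "\<dots> = ennreal (c * (2 * M * y) powr (p - 2))" using c by (simp add: ennreal_mult')
    also have "c * (2 * M * y) powr (p - 2) = (4 * p / (p - 2) * 2 powr (p - 2)) * M powr (p - 2) * \<epsilon> powr 2 * y powr p"
    proof -
      have "y\<^sup>2 * y powr (p - 2) = y powr p"
      proof (cases "y = 0")
        case False
        then have "y\<^sup>2 = y powr 2" by (simp add: y_def)
        then show ?thesis by (simp add: powr_add[symmetric] del: powr_numeral)
      qed (use p in auto)
      then have "c * (2 * M * y) powr (p - 2) = 4 * p / (p - 2) * 2 powr (p - 2) * M powr (p - 2) * \<epsilon>\<^sup>2 * y powr p"
        using M by (simp add: c_def powr_mult mult_ac y_def)
      then show ?thesis using \<epsilon> by simp
    qed
    also have "ennreal ((4 * p / (p - 2) * 2 powr (p - 2)) * M powr (p - 2) * \<epsilon> powr 2 * y powr p)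
        = ennreal ((4 * p / (p - 2) * 2 powr (p - 2)) * M powr (p - 2) * \<epsilon> powr 2) * ennreal (norm (f x) powr p)"
      unfolding y_def by (rule ennreal_mult) (use p in auto)
    finally show "(\<integral>\<^sup>+s. ennreal (p * s powr (p - 1)) * indicator {0..} s * k s x \<partial>lborel)
      \<le> ennreal ((4 * p / (p - 2) * 2 powr (p - 2)) * M powr (p - 2) * \<epsilon> powr 2) * ennreal (norm (f x) powr p)" .
  qed
  also have "\<dots> = ennreal ((4 * p / (p - 2) * 2 powr (p - 2)) * M powr (p - 2) * \<epsilon> powr 2) * (\<integral>\<^sup>+x. ennreal (norm (f x) powr p) \<partial>circle)"
    by (rule nn_integral_cmult) measurable
  also have "\<dots> = ennreal ((4 * p / (p - 2) * 2 powr (p - 2)) * M powr (p - 2) * \<epsilon> powr 2) * ennreal (Lp_norm p F powr p)"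
    using nn_integral_powr_eq_Lp_norm[OF f(1), of p] F f p by simp
  also have "\<dots> = ennreal ((4 * p / (p - 2) * 2 powr (p - 2)) * M powr (p - 2) * \<epsilon> powr 2 * Lp_norm p F powr p)"
    by (rule ennreal_mult[symmetric]) (use p in auto)
  finally have le: "(\<integral>\<^sup>+x. ennreal (norm (g x) powr p) \<partial>circle)
      \<le> ennreal ((4 * p / (p - 2) * 2 powr (p - 2)) * M powr (p - 2) * \<epsilon> powr 2 * Lp_norm p F powr p)" .
  have "0 \<le> (4 * p / (p - 2) * 2 powr (p - 2)) * M powr (p - 2) * \<epsilon> powr 2 * Lp_norm p F powr p" using p by simp
  from Lp_norm_powr_leI[OF g(1) _ this le] p show ?thesis by (simp add: g)
qed

text \<open>Both parts contribute here: the large one through the bound at 1, the small one through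
  the bound at 2. For fixed \<open>x\<close> the kernel \<open>k1\<close> leads to
  \<open>s powr (p - 2)\<close> below \<open>y / a\<close>, and \<open>k2\<close> to
  \<open>s powr (p - 3)\<close> above it; the integrals converge because \<open>p > 1\<close> and
  \<open>p < 2\<close> respectively.\<close>

lemma interpolation_below_2:
  assumes A: "endpoint_bounds A M \<epsilon>" and M: "0 < M" and \<epsilon>: "0 < \<epsilon>" and p: "1 < p" "p < 2" and F: "F \<in> Lp p"
  shows "A F \<in> Lp p \<and> Lp_norm p (A F) powr p \<le> (2 * p / (p - 1) + 4 * p / (2 - p)) * M powr (2 - p) * \<epsilon> powr (2 * (p - 1)) * Lp_norm p F powr p"
proof -
  obtain f where f: "f \<in> borel_measurable circle" "F = abs_circle_fun f" by (rule circle_fun_cases)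
  obtain g where g: "g \<in> borel_measurable circle" "A F = abs_circle_fun g" by (rule circle_fun_cases)
  note [measurable] = f(1) g(1)
  have F1: "F \<in> Lp 1" by (rule Lp_mono[OF F]) (use p in auto)
  text \<open>The cut-off level that balances the two weak type estimates.\<close>
  define a where "a = M / \<epsilon>\<^sup>2"
  have a: "0 < a" using M \<epsilon> by (simp add: a_def)
  define k1 where "k1 s x = ennreal (2 * M * s powr (- 1)) * (ennreal (norm (f x)) * indicator {z. norm (f (snd z)) > a * fst z} (s, x))" for s x
  define k2 where "k2 s x = ennreal (4 * \<epsilon>\<^sup>2 * s powr (- 2)) * (ennreal ((norm (f x))\<^sup>2) * indicator {z. norm (f (snd z)) \<le> a * fst z} (s, x))" for s x
  have km: "(\<lambda>(s, x). k1 s x) \<in> borel_measurable (lborel \<Otimes>\<^sub>M circle)" "(\<lambda>(s, x). k2 s x) \<in> borel_measurable (lborel \<Otimes>\<^sub>M circle)"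
  proof -
    have "(\<lambda>z. ennreal (2 * M * fst z powr (- 1)) * (ennreal (norm (f (snd z))) * indicator {z \<in> space (lborel \<Otimes>\<^sub>M circle). norm (f (snd z)) > a * fst z} z))
        \<in> borel_measurable (lborel \<Otimes>\<^sub>M circle)" by measurable
    then show "(\<lambda>(s, x). k1 s x) \<in> borel_measurable (lborel \<Otimes>\<^sub>M circle)"
      by (rule measurable_cong[THEN iffD1, rotated]) (auto simp: k1_def split: split_indicator)
    have "(\<lambda>z. ennreal (4 * \<epsilon>\<^sup>2 * fst z powr (- 2)) * (ennreal ((norm (f (snd z)))\<^sup>2) * indicator {z \<in> space (lborel \<Otimes>\<^sub>M circle). norm (f (snd z)) \<le> a * fst z} z))
        \<in> borel_measurable (lborel \<Otimes>\<^sub>M circle)" by measurable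
    then show "(\<lambda>(s, x). k2 s x) \<in> borel_measurable (lborel \<Otimes>\<^sub>M circle)"
      by (rule measurable_cong[THEN iffD1, rotated]) (auto simp: k2_def split: split_indicator)
  qed
  have kx: "(\<lambda>s. k1 s x) \<in> borel_measurable lborel" "(\<lambda>s. k2 s x) \<in> borel_measurable lborel" if "x \<in> space circle" for x
    using measurable_Pair1[OF km(1) that] measurable_Pair1[OF km(2) that] by simp_all
  have ks: "(\<lambda>x. k1 s x) \<in> borel_measurable circle" "(\<lambda>x. k2 s x) \<in> borel_measurable circle" for s
    using measurable_Pair2[OF km(1), of s] measurable_Pair2[OF km(2), of s] by simp_all
  have "(\<integral>\<^sup>+x. ennreal (norm (g x) powr p) \<partial>circle)
      \<le> (\<integral>\<^sup>+x. \<integral>\<^sup>+s. ennreal (p * s powr (p - 1)) * indicator {0..} s * (k1 s x + k2 s x) \<partial>lborel \<partial>circle)"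
  proof (rule strong_type_of_distribution)
    show "(\<lambda>(s, x). k1 s x + k2 s x) \<in> borel_measurable (lborel \<Otimes>\<^sub>M circle)"
      using km by (simp add: case_prod_beta')
    fix s :: real assume s: "0 < s"
    define lo where "lo x = (if norm (f x) > a * s then 0 else f x)" for x
    define hi where "hi x = (if norm (f x) > a * s then f x else 0)" for x
    have [measurable]: "lo \<in> borel_measurable circle" "hi \<in> borel_measurable circle"
      unfolding lo_def hi_def by measurable
    have lo: "sup_bounded (a * s) (abs_circle_fun lo)"
      unfolding sup_bounded_def using a s by (intro exI[of _ lo]) (auto simp: lo_def)
    have Fsum: "F = abs_circle_fun lo + abs_circle_fun hi"
      by (simp add: f abs_circle_fun_add) (rule arg_cong[of _ _ abs_circle_fun], auto simp: lo_def hi_def fun_eq_iff)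
    then have hiF: "abs_circle_fun hi = F - abs_circle_fun lo" by simp
    have lo2: "abs_circle_fun lo \<in> Lp 2" by (rule sup_bounded_Lp[OF lo]) simp
    have lo1: "abs_circle_fun lo \<in> Lp 1" by (rule Lp_mono[OF lo2]) auto
    have hi1: "abs_circle_fun hi \<in> Lp 1" unfolding hiF by (rule Lp_diff(1)[OF F1 lo1]) simp
    obtain u where u: "u \<in> borel_measurable circle" "A (abs_circle_fun lo) = abs_circle_fun u" by (rule circle_fun_cases)
    obtain v where v: "v \<in> borel_measurable circle" "A (abs_circle_fun hi) = abs_circle_fun v" by (rule circle_fun_cases)
    note [measurable] = u(1) v(1)
    have "A F = A (abs_circle_fun lo) + A (abs_circle_fun hi)"
      using A lo1 hi1 Fsum by (simp add: endpoint_bounds_def)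
    then have guv: "AE x in circle. g x = u x + v x"
      using g u v by (simp add: abs_circle_fun_add abs_circle_fun_eq_iff)
    have u2: "abs_circle_fun u \<in> Lp 2" "Lp_norm 2 (abs_circle_fun u) \<le> \<epsilon> * Lp_norm 2 (abs_circle_fun lo)"
      using A lo2 u unfolding endpoint_bounds_def by auto
    have v1: "abs_circle_fun v \<in> Lp 1" "Lp_norm 1 (abs_circle_fun v) \<le> M * Lp_norm 1 (abs_circle_fun hi)"
      using A hi1 v unfolding endpoint_bounds_def by auto
    have "emeasure circle {x \<in> space circle. s \<le> norm (g x)}
        \<le> emeasure circle ({x \<in> space circle. s / 2 \<le> norm (v x)} \<union> {x \<in> space circle. s / 2 \<le> norm (u x)})"
    proof (rule emeasure_mono_AE)
      show "AE x in circle. x \<in> {x \<in> space circle. s \<le> norm (g x)} \<longrightarrow>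
          x \<in> {x \<in> space circle. s / 2 \<le> norm (v x)} \<union> {x \<in> space circle. s / 2 \<le> norm (u x)}"
        using guv
      proof eventually_elim
        case (elim x)
        then show ?case using norm_triangle_ineq[of "u x" "v x"] by auto
      qed
    qed measurable
    also have "\<dots> \<le> emeasure circle {x \<in> space circle. s / 2 \<le> norm (v x)} + emeasure circle {x \<in> space circle. s / 2 \<le> norm (u x)}"
      by (rule emeasure_subadditive) measurable
    also have "\<dots> \<le> (\<integral>\<^sup>+x. k1 s x \<partial>circle) + (\<integral>\<^sup>+x. k2 s x \<partial>circle)"
    proof (rule add_mono)
      have "emeasure circle {x \<in> space circle. s / 2 \<le> norm (v x)} \<le> ennreal ((Lp_norm 1 (abs_circle_fun v) / (s / 2)) powr 1)"
        using s v v1 by (intro emeasure_ge_le_Lp_norm) auto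
      also have "\<dots> \<le> ennreal (((M * Lp_norm 1 (abs_circle_fun hi)) / (s / 2)) powr 1)"
        using s v1 by (intro ennreal_leI powr_mono2 divide_right_mono) auto
      also have "((M * Lp_norm 1 (abs_circle_fun hi)) / (s / 2)) powr 1 = (2 * M * s powr (- 1)) * Lp_norm 1 (abs_circle_fun hi) powr 1"
        using s M by (simp add: powr_minus field_simps)
      also have "ennreal \<dots> = ennreal (2 * M * s powr (- 1)) * (\<integral>\<^sup>+x. ennreal (norm (hi x) powr 1) \<partial>circle)"
      proof -
        have X: "(\<integral>\<^sup>+x. ennreal (norm (hi x) powr 1) \<partial>circle) = ennreal (Lp_norm 1 (abs_circle_fun hi) powr 1)"
          by (rule nn_integral_powr_eq_Lp_norm[OF _ hi1]) auto
        show ?thesis unfolding X by (rule ennreal_mult) (use M in auto)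
      qed
      also have "\<dots> = (\<integral>\<^sup>+x. ennreal (2 * M * s powr (- 1)) * ennreal (norm (hi x) powr 1) \<partial>circle)"
        by (rule nn_integral_cmult[symmetric]) measurable
      also have "\<dots> = (\<integral>\<^sup>+x. k1 s x \<partial>circle)"
        by (intro nn_integral_cong) (auto simp: k1_def hi_def split: split_indicator)
      finally show "emeasure circle {x \<in> space circle. s / 2 \<le> norm (v x)} \<le> (\<integral>\<^sup>+x. k1 s x \<partial>circle)" .
      have "emeasure circle {x \<in> space circle. s / 2 \<le> norm (u x)} \<le> ennreal ((Lp_norm 2 (abs_circle_fun u) / (s / 2)) powr 2)"
        using s u u2 by (intro emeasure_ge_le_Lp_norm) auto
      also have "\<dots> \<le> ennreal (((\<epsilon> * Lp_norm 2 (abs_circle_fun lo)) / (s / 2)) powr 2)"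
        using s u2 by (intro ennreal_leI powr_mono2 divide_right_mono) auto
      also have "((\<epsilon> * Lp_norm 2 (abs_circle_fun lo)) / (s / 2)) powr 2 = (4 * \<epsilon>\<^sup>2 * s powr (- 2)) * Lp_norm 2 (abs_circle_fun lo) powr 2"
        using s \<epsilon> by (simp add: powr_minus power_mult_distrib power_divide field_simps)
      also have "ennreal \<dots> = ennreal (4 * \<epsilon>\<^sup>2 * s powr (- 2)) * (\<integral>\<^sup>+x. ennreal (norm (lo x) powr 2) \<partial>circle)"
        using nn_integral_powr_eq_Lp_norm[OF _ lo2] by (simp add: ennreal_mult)
      also have "\<dots> = (\<integral>\<^sup>+x. ennreal (4 * \<epsilon>\<^sup>2 * s powr (- 2)) * ennreal (norm (lo x) powr 2) \<partial>circle)"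
        by (rule nn_integral_cmult[symmetric]) measurable
      also have "\<dots> = (\<integral>\<^sup>+x. k2 s x \<partial>circle)"
        by (intro nn_integral_cong) (auto simp: k2_def lo_def split: split_indicator)
      finally show "emeasure circle {x \<in> space circle. s / 2 \<le> norm (u x)} \<le> (\<integral>\<^sup>+x. k2 s x \<partial>circle)" .
    qed
    also have "\<dots> = (\<integral>\<^sup>+x. k1 s x + k2 s x \<partial>circle)"
      by (rule nn_integral_add[symmetric]) (rule ks)+
    finally show "emeasure circle {x \<in> space circle. s \<le> norm (g x)} \<le> (\<integral>\<^sup>+x. k1 s x + k2 s x \<partial>circle)" .
  qed (use p in auto)
  also have "\<dots> \<le> (\<integral>\<^sup>+x. ennreal ((2 * p / (p - 1) + 4 * p / (2 - p)) * M powr (2 - p) * \<epsilon> powr (2 * (p - 1))) * ennreal (norm (f x) powr p) \<partial>circle)"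
  proof (rule nn_integral_mono)
    fix x assume x: "x \<in> space circle"
    note [measurable] = kx[OF x]
    define y where "y = norm (f x)"
    have y: "0 \<le> y" by (simp add: y_def)
    define w where "w s = ennreal (p * s powr (p - 1)) * indicator {0..} s" for s :: real
    have wm [measurable]: "w \<in> borel_measurable lborel" unfolding w_def by measurable
    have "(\<integral>\<^sup>+s. ennreal (p * s powr (p - 1)) * indicator {0..} s * (k1 s x + k2 s x) \<partial>lborel)
        = (\<integral>\<^sup>+s. w s * k1 s x + w s * k2 s x \<partial>lborel)"
      by (simp add: w_def distrib_left)
    also have "\<dots> = (\<integral>\<^sup>+s. w s * k1 s x \<partial>lborel) + (\<integral>\<^sup>+s. w s * k2 s x \<partial>lborel)"
      by (rule nn_integral_add) measurable
    also have "\<dots> \<le> ennreal (2 * M * p * y / (p - 1) * (y / a) powr (p - 1)) + ennreal (4 * \<epsilon>\<^sup>2 * p * y\<^sup>2 * ((y / a) powr (p - 2) / (2 - p)))"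
    proof (rule add_mono)
      define c where "c = 2 * M * p * y / (p - 1)"
      have c: "0 \<le> c" using p M y by (simp add: c_def)
      have "(\<integral>\<^sup>+s. w s * k1 s x \<partial>lborel) \<le> (\<integral>\<^sup>+s. ennreal c * (ennreal ((p - 1) * s powr (p - 1 - 1)) * indicator {0..y / a} s) \<partial>lborel)"
      proof (rule nn_integral_mono)
        fix s :: real
        show "w s * k1 s x \<le> ennreal c * (ennreal ((p - 1) * s powr (p - 1 - 1)) * indicator {0..y / a} s)"
        proof (cases "0 \<le> s \<and> a * s < y")
          case True
          have e: "s powr (p - 1) * s powr (- 1) = s powr (p - 1 - 1)"
            by (simp only: powr_add[symmetric]) simp
          have "(p * s powr (p - 1)) * ((2 * M * s powr (- 1)) * y) = 2 * M * p * y * (s powr (p - 1) * s powr (- 1))"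
            by (simp add: mult_ac)
          also have "\<dots> = c * ((p - 1) * s powr (p - 1 - 1))" unfolding e using p by (simp add: c_def)
          finally have eq: "(p * s powr (p - 1)) * ((2 * M * s powr (- 1)) * y) = c * ((p - 1) * s powr (p - 1 - 1))" .
          have "w s * k1 s x = ennreal (p * s powr (p - 1)) * (ennreal (2 * M * s powr (- 1)) * ennreal y)"
            using True by (simp add: w_def k1_def y_def)
          also have "\<dots> = ennreal ((p * s powr (p - 1)) * ((2 * M * s powr (- 1)) * y))"
            by (rule ennreal_mult3[symmetric]) (use p M y in auto)
          also have "\<dots> = ennreal c * ennreal ((p - 1) * s powr (p - 1 - 1))" unfolding eq using c by (rule ennreal_mult')
          finally show ?thesis using True a by (simp add: field_simps)
        next
          case False
          then show ?thesis by (auto simp: w_def k1_def y_def split: split_indicator)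
        qed
      qed
      also have "\<dots> = ennreal c * ennreal ((y / a) powr (p - 1))"
        using p a y nn_integral_powr_layer[of "p - 1" "y / a"] by (subst nn_integral_cmult) auto
      also have "\<dots> = ennreal (c * (y / a) powr (p - 1))" using c by (simp add: ennreal_mult')
      finally show "(\<integral>\<^sup>+s. w s * k1 s x \<partial>lborel) \<le> ennreal (2 * M * p * y / (p - 1) * (y / a) powr (p - 1))" by (simp add: c_def)
    next
      show "(\<integral>\<^sup>+s. w s * k2 s x \<partial>lborel) \<le> ennreal (4 * \<epsilon>\<^sup>2 * p * y\<^sup>2 * ((y / a) powr (p - 2) / (2 - p)))"
      proof (cases "y = 0")
        case True
        then have "k2 s x = 0" for s by (simp add: k2_def y_def)
        then show ?thesis by simp
      next
        case False
        then have ya: "0 < y / a" using y a by simp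
        define c where "c = 4 * \<epsilon>\<^sup>2 * p * y\<^sup>2"
        have c: "0 \<le> c" using p by (simp add: c_def)
        have "((\<lambda>s. s powr (p - 3)) has_integral - ((y / a) powr (p - 3 + 1)) / (p - 3 + 1)) {y / a..}"
          by (rule has_integral_powr_to_inf) (use p ya in auto)
        moreover have "- ((y / a) powr (p - 3 + 1)) / (p - 3 + 1) = (y / a) powr (p - 2) / (2 - p)"
          using p by (simp add: field_simps)
        ultimately have I: "((\<lambda>s. s powr (p - 3)) has_integral (y / a) powr (p - 2) / (2 - p)) {y / a..}" by simp
        have "(\<integral>\<^sup>+s. w s * k2 s x \<partial>lborel) \<le> (\<integral>\<^sup>+s. ennreal c * (ennreal (s powr (p - 3)) * indicator {y / a..} s) \<partial>lborel)"
        proof (rule nn_integral_mono)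
          fix s :: real
          show "w s * k2 s x \<le> ennreal c * (ennreal (s powr (p - 3)) * indicator {y / a..} s)"
          proof (cases "0 \<le> s \<and> y \<le> a * s")
            case True
            have e: "s powr (p - 1) * s powr (- 2) = s powr (p - 3)" by (simp add: powr_add[symmetric])
            have "(p * s powr (p - 1)) * ((4 * \<epsilon>\<^sup>2 * s powr (- 2)) * y\<^sup>2) = c * (s powr (p - 1) * s powr (- 2))"
              by (simp add: c_def mult_ac)
            then have eq: "(p * s powr (p - 1)) * ((4 * \<epsilon>\<^sup>2 * s powr (- 2)) * y\<^sup>2) = c * s powr (p - 3)" unfolding e .
            have "w s * k2 s x = ennreal (p * s powr (p - 1)) * (ennreal (4 * \<epsilon>\<^sup>2 * s powr (- 2)) * ennreal (y\<^sup>2))"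
              using True by (simp add: w_def k2_def y_def)
            also have "\<dots> = ennreal ((p * s powr (p - 1)) * ((4 * \<epsilon>\<^sup>2 * s powr (- 2)) * y\<^sup>2))"
              by (rule ennreal_mult3[symmetric]) (use p in auto)
            also have "\<dots> = ennreal c * ennreal (s powr (p - 3))" unfolding eq using c by (rule ennreal_mult')
            finally show ?thesis using True a by (simp add: field_simps)
          next
            case False
            then show ?thesis by (auto simp: w_def k2_def y_def split: split_indicator)
          qed
        qed
        also have "\<dots> = ennreal c * ennreal ((y / a) powr (p - 2) / (2 - p))"
          using nn_integral_has_integral_lebesgue'[OF _ I] by (subst nn_integral_cmult) auto
        also have "\<dots> = ennreal (c * ((y / a) powr (p - 2) / (2 - p)))"
          by (rule ennreal_mult[symmetric]) (use c p in auto)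
        finally show ?thesis by (simp add: c_def)
      qed
    qed
    also have "\<dots> = ennreal (2 * M * p * y / (p - 1) * (y / a) powr (p - 1) + 4 * \<epsilon>\<^sup>2 * p * y\<^sup>2 * ((y / a) powr (p - 2) / (2 - p)))"
      using p M y by (intro ennreal_plus[symmetric]) auto
    also have "2 * M * p * y / (p - 1) * (y / a) powr (p - 1) + 4 * \<epsilon>\<^sup>2 * p * y\<^sup>2 * ((y / a) powr (p - 2) / (2 - p))
      = (2 * p / (p - 1) + 4 * p / (2 - p)) * M powr (2 - p) * \<epsilon> powr (2 * (p - 1)) * y powr p"
    proof (cases "y = 0")
      case True then show ?thesis using p by simp
    next
      case False
      then have y0: "0 < y" using y by simp
      have ap: "a powr r = M powr r * \<epsilon> powr (- 2 * r)" for r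
      proof -
        have "\<epsilon>\<^sup>2 = \<epsilon> powr 2" using \<epsilon> by simp
        then have "a powr r = M powr r / (\<epsilon> powr 2) powr r" using M \<epsilon> by (simp only: a_def powr_divide)
        also have "\<dots> = M powr r * \<epsilon> powr (- 2 * r)" unfolding powr_powr by (simp add: powr_minus divide_inverse)
        finally show ?thesis .
      qed
      have yp: "(y / a) powr r = y powr r * a powr (- r)" for r
      proof -
        have "(y / a) powr r = y powr r / a powr r" using y0 a by (intro powr_divide)
        then show ?thesis by (simp only: powr_minus divide_inverse)
      qed
      have 1: "M * y * (y / a) powr (p - 1) = M powr (2 - p) * \<epsilon> powr (2 * (p - 1)) * y powr p"
      proof -
        have "M * y * (y / a) powr (p - 1) = M powr 1 * y powr 1 * (y powr (p - 1) * a powr (- (p - 1)))"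
          using M y0 by (simp add: yp)
        also have "\<dots> = (M powr 1 * M powr (- (p - 1))) * \<epsilon> powr (- 2 * (- (p - 1))) * (y powr 1 * y powr (p - 1))"
          unfolding ap by (simp only: mult_ac)
        also have "\<dots> = M powr (2 - p) * \<epsilon> powr (2 * (p - 1)) * y powr p"
          unfolding powr_add[symmetric] by (simp add: algebra_simps)
        finally show ?thesis .
      qed
      have 2: "\<epsilon>\<^sup>2 * y\<^sup>2 * (y / a) powr (p - 2) = M powr (2 - p) * \<epsilon> powr (2 * (p - 1)) * y powr p"
      proof -
        have "\<epsilon>\<^sup>2 * y\<^sup>2 * (y / a) powr (p - 2) = \<epsilon> powr 2 * y powr 2 * (y powr (p - 2) * a powr (- (p - 2)))"
          using \<epsilon> y0 by (simp add: yp)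
        also have "\<dots> = M powr (- (p - 2)) * (\<epsilon> powr 2 * \<epsilon> powr (- 2 * (- (p - 2)))) * (y powr 2 * y powr (p - 2))"
          unfolding ap by (simp only: mult_ac)
        also have "\<dots> = M powr (2 - p) * \<epsilon> powr (2 * (p - 1)) * y powr p"
          unfolding powr_add[symmetric] by (simp add: algebra_simps)
        finally show ?thesis .
      qed
      have "2 * M * p * y / (p - 1) * (y / a) powr (p - 1) + 4 * \<epsilon>\<^sup>2 * p * y\<^sup>2 * ((y / a) powr (p - 2) / (2 - p))
        = 2 * p / (p - 1) * (M * y * (y / a) powr (p - 1)) + 4 * p / (2 - p) * (\<epsilon>\<^sup>2 * y\<^sup>2 * (y / a) powr (p - 2))"
        by (simp add: mult_ac)
      also have "\<dots> = (2 * p / (p - 1) + 4 * p / (2 - p)) * M powr (2 - p) * \<epsilon> powr (2 * (p - 1)) * y powr p"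
        unfolding 1 2 by (simp only: distrib_right mult.assoc)
      finally show ?thesis .
    qed
    also have "ennreal ((2 * p / (p - 1) + 4 * p / (2 - p)) * M powr (2 - p) * \<epsilon> powr (2 * (p - 1)) * y powr p)
        = ennreal ((2 * p / (p - 1) + 4 * p / (2 - p)) * M powr (2 - p) * \<epsilon> powr (2 * (p - 1))) * ennreal (norm (f x) powr p)"
      unfolding y_def by (rule ennreal_mult) (use p in auto)
    finally show "(\<integral>\<^sup>+s. ennreal (p * s powr (p - 1)) * indicator {0..} s * (k1 s x + k2 s x) \<partial>lborel)
      \<le> ennreal ((2 * p / (p - 1) + 4 * p / (2 - p)) * M powr (2 - p) * \<epsilon> powr (2 * (p - 1))) * ennreal (norm (f x) powr p)" .
  qed
  also have "\<dots> = ennreal ((2 * p / (p - 1) + 4 * p / (2 - p)) * M powr (2 - p) * \<epsilon> powr (2 * (p - 1))) * (\<integral>\<^sup>+x. ennreal (norm (f x) powr p) \<partial>circle)"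
    by (rule nn_integral_cmult) measurable
  also have "\<dots> = ennreal ((2 * p / (p - 1) + 4 * p / (2 - p)) * M powr (2 - p) * \<epsilon> powr (2 * (p - 1))) * ennreal (Lp_norm p F powr p)"
    using nn_integral_powr_eq_Lp_norm[OF f(1), of p] F f p by simp
  also have "\<dots> = ennreal ((2 * p / (p - 1) + 4 * p / (2 - p)) * M powr (2 - p) * \<epsilon> powr (2 * (p - 1)) * Lp_norm p F powr p)"
    by (rule ennreal_mult[symmetric]) (use p in auto)
  finally have le: "(\<integral>\<^sup>+x. ennreal (norm (g x) powr p) \<partial>circle)
      \<le> ennreal ((2 * p / (p - 1) + 4 * p / (2 - p)) * M powr (2 - p) * \<epsilon> powr (2 * (p - 1)) * Lp_norm p F powr p)" .
  have "0 \<le> (2 * p / (p - 1) + 4 * p / (2 - p)) * M powr (2 - p) * \<epsilon> powr (2 * (p - 1)) * Lp_norm p F powr p" using p by simp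
  from Lp_norm_powr_leI[OF g(1) _ this le] p show ?thesis by (simp add: g)
qed

text \<open>The constants are quantified before the operator, so they stay fixed while
  \<open>A\<close> runs through the powers of one operator. The exponent \<open>a\<close> of
  \<epsilon> is positive in all three ranges: \<open>2 * (p - 1)\<close>, 2 and 2.\<close>

lemma interpolation:
  fixes p :: real
  assumes p: "1 < p"
  shows "\<exists>C a b. 0 \<le> C \<and> 0 < a \<and> (\<forall>A M \<epsilon>. endpoint_bounds A M \<epsilon> \<longrightarrow> 0 < M \<longrightarrow> 0 < \<epsilon> \<longrightarrow>
     (\<forall>F\<in>Lp p. A F \<in> Lp p \<and> Lp_norm p (A F) powr p \<le> C * M powr b * \<epsilon> powr a * Lp_norm p F powr p))"
proof -
  consider "p < 2" | "p = 2" | "2 < p" by linarith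
  then show ?thesis
  proof cases
    case 1
    then show ?thesis using interpolation_below_2[OF _ _ _ p 1] p
      by (intro exI[of _ "2 * p / (p - 1) + 4 * p / (2 - p)"] exI[of _ "2 * (p - 1)"] exI[of _ "2 - p"]) auto
  next
    case 2
    have "A F \<in> Lp p \<and> Lp_norm p (A F) powr p \<le> 1 * M powr 0 * \<epsilon> powr 2 * Lp_norm p F powr p"
      if "endpoint_bounds A M \<epsilon>" "0 < M" "0 < \<epsilon>" "F \<in> Lp p" for A M \<epsilon> F
    proof -
      have A: "A F \<in> Lp 2" "Lp_norm 2 (A F) \<le> \<epsilon> * Lp_norm 2 F"
        using that 2 unfolding endpoint_bounds_def by auto
      have "Lp_norm 2 (A F) powr 2 \<le> (\<epsilon> * Lp_norm 2 F) powr 2" by (intro powr_mono2 A) auto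
      then show ?thesis using A(1) that 2 by (simp add: power_mult_distrib)
    qed
    then show ?thesis by (intro exI[of _ 1] exI[of _ 2] exI[of _ 0]) auto
  next
    case 3
    then show ?thesis using interpolation_above_2[OF _ _ _ 3] p
      by (intro exI[of _ "4 * p / (p - 2) * 2 powr (p - 2)"] exI[of _ 2] exI[of _ "p - 2"]) auto
  qed
qed

section \<open>Spectra\<close>

text \<open>The words \<open>W J\<close> give \<open>x j\<close> a share of about
  \<open>1 / 2 ^ Suc j\<close> of all positions. If \<open>y\<close> lies within
  \<open>\<eta> ^ (2 ^ Suc j)\<close> of \<open>x j\<close>, these positions alone contribute
  \<open>\<eta> ^ (2 ^ J)\<close>, whatever \<open>j\<close> is. By compactness finitely many such
  neighbourhoods cover \<open>K\<close>, so one word serves all of \<open>K\<close>.\<close>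

lemma small_root_product:
  fixes K :: "complex set"
  assumes K: "compact K" "countable K" "K \<noteq> {}" "K \<subseteq> cball 0 1" and \<epsilon>: "0 < \<epsilon>"
  shows "\<exists>ws. ws \<noteq> [] \<and> set ws \<subseteq> K \<and> (\<forall>y\<in>K. norm (\<Prod>w\<leftarrow>ws. y - w) \<le> \<epsilon> ^ length ws)"
proof -
  define x where "x = from_nat_into K"
  have xK: "x j \<in> K" for j unfolding x_def using K(3) by (rule from_nat_into)
  have surj: "\<exists>j. y = x j" if "y \<in> K" for y
    using from_nat_into_surj[OF K(2) that] by (auto simp: x_def)
  \<comment> \<open>Points of the unit disc are at most 2 apart, so each factor that is not small
    costs 2; hence \<open>2 * \<eta> \<le> \<epsilon>\<close>. The cap at 1 permits lowering the
    exponent \<open>2 ^ J\<close> to the length of the word, which is one less.\<close>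
  define \<eta> where "\<eta> = min (\<epsilon> / 2) 1"
  have \<eta>: "0 < \<eta>" "\<eta> \<le> 1" "2 * \<eta> \<le> \<epsilon>" using \<epsilon> by (auto simp: \<eta>_def)
  define W where "W = rec_nat [] (\<lambda>J ws. ws @ ws @ [x J])"
  have W: "W 0 = []" "\<And>J. W (Suc J) = W J @ W J @ [x J]" by (simp_all add: W_def)
  have len: "Suc (length (W J)) = 2 ^ J" for J by (induction J) (simp_all add: W)
  have WK: "set (W J) \<subseteq> K" for J by (induction J) (use xK in \<open>auto simp: W\<close>)
  define P where "P J y = norm (\<Prod>w\<leftarrow>W J. y - w)" for J y
  have P_Suc: "P (Suc J) y = P J y * P J y * norm (y - x J)" for J y by (simp add: P_def W norm_mult)
  have two: "norm (y - x j) \<le> 2" if "y \<in> K" for y j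
  proof -
    have "norm y \<le> 1" "norm (x j) \<le> 1" using K(4) that xK[of j] by auto
    then show ?thesis using norm_triangle_ineq4[of y "x j"] by linarith
  qed
  have P0: "0 \<le> P J y" for J y by (simp add: P_def)
  have crude: "P J y \<le> 2 ^ length (W J)" if "y \<in> K" for J y
  proof (induction J)
    case (Suc J)
    have "P (Suc J) y \<le> 2 ^ length (W J) * 2 ^ length (W J) * 2"
      unfolding P_Suc using Suc P0 two[OF that] by (intro mult_mono) auto
    then show ?case by (simp add: W power_add)
  qed (simp add: P_def W)
  \<comment> \<open>The small factor enters at step \<open>j\<close> with exponent
    \<open>2 ^ Suc j\<close>; each later step squares the product and so doubles this
    exponent.\<close>
  have fine: "P J y \<le> \<eta> ^ (2 ^ J) * 2 ^ length (W J)" if "y \<in> K" "norm (y - x j) \<le> \<eta> ^ (2 ^ Suc j)" "j < J" for J y j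
    using that(3)
  proof (induction J)
    case (Suc J)
    have sq: "\<eta> ^ (2 ^ Suc J) = \<eta> ^ (2 ^ J) * \<eta> ^ (2 ^ J)" by (simp add: power_add[symmetric] mult_2)
    show ?case
    proof (cases "j = J")
      case True
      have "P (Suc J) y \<le> 2 ^ length (W J) * 2 ^ length (W J) * \<eta> ^ (2 ^ Suc J)"
        unfolding P_Suc using crude[OF that(1)] P0 that(2) True by (intro mult_mono) auto
      also have "\<dots> \<le> 2 ^ length (W J) * 2 ^ length (W J) * \<eta> ^ (2 ^ Suc J) * 2" using \<eta> by simp
      finally show ?thesis by (simp add: W power_add mult_ac)
    next
      case False
      then have IH: "P J y \<le> \<eta> ^ (2 ^ J) * 2 ^ length (W J)" using Suc by simp
      have "P (Suc J) y \<le> (\<eta> ^ (2 ^ J) * 2 ^ length (W J)) * (\<eta> ^ (2 ^ J) * 2 ^ length (W J)) * 2"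
        unfolding P_Suc using IH P0 two[OF that(1)] \<eta> by (intro mult_mono) auto
      then show ?thesis unfolding sq by (simp add: W power_add mult_ac)
    qed
  qed simp
  have "K \<subseteq> (\<Union>j. ball (x j) (\<eta> ^ (2 ^ Suc j)))"
  proof
    fix y assume "y \<in> K"
    then obtain j where "y = x j" using surj by blast
    then have "y \<in> ball (x j) (\<eta> ^ (2 ^ Suc j))" using \<eta> by simp
    then show "y \<in> (\<Union>j. ball (x j) (\<eta> ^ (2 ^ Suc j)))" by blast
  qed
  then obtain D where D: "finite D" "K \<subseteq> (\<Union>j\<in>D. ball (x j) (\<eta> ^ (2 ^ Suc j)))"
    using compactE_image[OF K(1), of UNIV "\<lambda>j. ball (x j) (\<eta> ^ (2 ^ Suc j))"] by auto
  obtain J0 where J0: "D \<subseteq> {..<J0}" using finite_nat_iff_bounded D(1) by blast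
  define J where "J = Suc J0"
  have "norm (\<Prod>w\<leftarrow>W J. y - w) \<le> \<epsilon> ^ length (W J)" if y: "y \<in> K" for y
  proof -
    obtain j where j: "j \<in> D" "y \<in> ball (x j) (\<eta> ^ (2 ^ Suc j))" using D y by blast
    then have "norm (y - x j) \<le> \<eta> ^ (2 ^ Suc j)" "j < J"
      using J0 by (auto simp: J_def dist_norm norm_minus_commute)
    then have "P J y \<le> \<eta> ^ (2 ^ J) * 2 ^ length (W J)" using fine[OF y] by blast
    also have "\<dots> \<le> \<eta> ^ length (W J) * 2 ^ length (W J)"
      using \<eta> len[of J] by (intro mult_right_mono power_decreasing) auto
    also have "\<dots> = (2 * \<eta>) ^ length (W J)" by (simp add: power_mult_distrib mult.commute)
    also have "\<dots> \<le> \<epsilon> ^ length (W J)" using \<eta> by (intro power_mono) auto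
    finally show ?thesis by (simp add: P_def)
  qed
  then show ?thesis using WK[of J] by (intro exI[of _ "W J"]) (auto simp: J_def W)
qed

section \<open>Operators whose powers grow more slowly than those of \<zeta>\<close>

lemma Lp_norm_add3_le:
  assumes "F \<in> Lp p" "G \<in> Lp p" "H \<in> Lp p" "1 \<le> p"
  shows "Lp_norm p (F - G - H) \<le> Lp_norm p F + Lp_norm p G + Lp_norm p H"
  using Lp_diff(2)[OF Lp_diff(1)[OF assms(1,2,4)] assms(3,4)] Lp_diff(2)[OF assms(1,2,4)] by simp

context
  fixes A :: "circle_fun \<Rightarrow> circle_fun" and p C R :: real and \<zeta> :: complex
  assumes p: "1 \<le> p"
    and add: "\<And>F G. F \<in> Lp p \<Longrightarrow> G \<in> Lp p \<Longrightarrow> A (F + G) = A F + A G"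
    and scale: "\<And>c F. F \<in> Lp p \<Longrightarrow> A (c *\<^sub>c F) = c *\<^sub>c A F"
    and iter: "\<And>m F. F \<in> Lp p \<Longrightarrow> (A ^^ m) F \<in> Lp p \<and> Lp_norm p ((A ^^ m) F) \<le> C * R ^ m * Lp_norm p F"
    and R: "0 \<le> C" "0 \<le> R" "R < norm \<zeta>"
begin

text \<open>The powers of \<open>A\<close> act on \<open>F\<close> by powers of \<zeta>, which
  outgrow the bound \<open>C * R ^ m\<close>.\<close>

lemma eigenvector_zero:
  assumes F: "F \<in> Lp p" and eig: "A F = \<zeta> *\<^sub>c F" shows "F = 0"
proof (rule ccontr)
  assume "F \<noteq> 0"
  then have N: "0 < Lp_norm p F" using Lp_norm_eq_0[OF F] p Lp_norm_nonneg[of p F] by (auto simp: order_less_le)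
  have \<zeta>0: "0 < norm \<zeta>" using R by linarith
  have p0: "0 < p" using p by simp
  have it: "(A ^^ m) F = (\<zeta> ^ m) *\<^sub>c F" for m
    by (induction m) (simp_all add: scale[OF F] eig mult.commute)
  have "1 \<le> C * (R / norm \<zeta>) ^ m" for m
  proof -
    have "norm \<zeta> ^ m * Lp_norm p F \<le> C * R ^ m * Lp_norm p F"
      using iter[OF F, of m] Lp_scale(2)[OF F p0, of "\<zeta> ^ m"] by (simp add: it norm_power)
    then have "norm \<zeta> ^ m \<le> C * R ^ m" using N by simp
    then show ?thesis using \<zeta>0 by (simp add: power_divide field_simps)
  qed
  moreover have "(\<lambda>m. C * (R / norm \<zeta>) ^ m) \<longlonglongrightarrow> C * 0"
    using R \<zeta>0 by (intro tendsto_mult tendsto_const LIMSEQ_power_zero) (simp add: divide_less_eq)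
  ultimately have "1 \<le> C * 0" by (intro LIMSEQ_le_const) auto
  then show False by simp
qed

text \<open>The Neumann series for the inverse of \<open>A\<close> minus \<zeta>: its partial sums
  solve the equation up to a telescoped remainder. The norm bound on \<open>E\<close> is what later
  makes the inverse a bounded operator.\<close>

lemma neumann_solution:
  assumes F: "F \<in> Lp p"
  shows "\<exists>E\<in>Lp p. A E - \<zeta> *\<^sub>c E = F \<and> Lp_norm p E \<le> C / norm \<zeta> / (1 - R / norm \<zeta>) * Lp_norm p F"
proof -
  have \<zeta>0: "0 < norm \<zeta>" "\<zeta> \<noteq> 0" using R by auto
  have p0: "0 < p" using p by simp
  define \<rho> where "\<rho> = R / norm \<zeta>"
  have \<rho>: "0 \<le> \<rho>" "\<rho> < 1" using R \<zeta>0 by (auto simp: \<rho>_def)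
  define c where "c = C / norm \<zeta> * Lp_norm p F"
  have A1: "A G \<in> Lp p" "Lp_norm p (A G) \<le> C * R * Lp_norm p G" if "G \<in> Lp p" for G
    using iter[OF that, of 1] by auto
  have A0: "A 0 = 0" using add[of 0 0] p0 by simp
  define f where "f k = (- (inverse \<zeta> ^ Suc k)) *\<^sub>c (A ^^ k) F" for k
  have f: "f k \<in> Lp p" "Lp_norm p (f k) \<le> c * \<rho> ^ k" for k
  proof -
    have i: "(A ^^ k) F \<in> Lp p" "Lp_norm p ((A ^^ k) F) \<le> C * R ^ k * Lp_norm p F" using iter[OF F] by auto
    show "f k \<in> Lp p" unfolding f_def by (rule Lp_scale(1)[OF i(1) p0])
    have "Lp_norm p (f k) = inverse (norm \<zeta>) ^ Suc k * Lp_norm p ((A ^^ k) F)"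
      unfolding f_def Lp_scale(2)[OF i(1) p0] by (simp add: norm_mult norm_power norm_inverse)
    also have "\<dots> \<le> inverse (norm \<zeta>) ^ Suc k * (C * R ^ k * Lp_norm p F)" using i(2) by (intro mult_left_mono) auto
    also have "\<dots> = c * \<rho> ^ k" using \<zeta>0 by (simp add: c_def \<rho>_def power_divide field_simps)
    finally show "Lp_norm p (f k) \<le> c * \<rho> ^ k" .
  qed
  have gs: "summable (\<lambda>k. c * \<rho> ^ (k + n))" "(\<Sum>k. c * \<rho> ^ (k + n)) = c * \<rho> ^ n / (1 - \<rho>)" for n
  proof -
    have "(\<lambda>k. c * \<rho> ^ n * \<rho> ^ k) sums (c * \<rho> ^ n * (1 / (1 - \<rho>)))"
      using \<rho> by (intro sums_mult geometric_sums) auto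
    then have "(\<lambda>k. c * \<rho> ^ (k + n)) sums (c * \<rho> ^ n / (1 - \<rho>))" by (simp add: power_add mult_ac)
    then show "summable (\<lambda>k. c * \<rho> ^ (k + n))" "(\<Sum>k. c * \<rho> ^ (k + n)) = c * \<rho> ^ n / (1 - \<rho>)"
      by (auto simp: sums_iff)
  qed
  have smn: "summable (\<lambda>k. Lp_norm p (f (k + n)))" for n
    by (rule summable_comparison_test'[OF gs(1)[of n], of 0]) (use f(2) in auto)
  have sm: "summable (\<lambda>k. Lp_norm p (f k))" using smn[of 0] by simp
  obtain G where G: "G \<in> Lp p" "\<And>n. Lp_norm p (G - (\<Sum>k<n. f k)) \<le> (\<Sum>k. Lp_norm p (f (k + n)))"
    using Lp_complete[OF f(1) p sm] by blast
  have tail: "Lp_norm p (G - (\<Sum>k<n. f k)) \<le> c * \<rho> ^ n / (1 - \<rho>)" for n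
    using G(2)[of n] suminf_le[OF f(2) smn gs(1)[of n]] gs(2)[of n] by simp
  have S: "(\<Sum>k<n. f k) \<in> Lp p" for n using Lp_sum[of "{..<n}" f p] f(1) p by auto
  have tele: "A (\<Sum>k<n. f k) - \<zeta> *\<^sub>c (\<Sum>k<n. f k) = F - (inverse \<zeta> ^ n) *\<^sub>c (A ^^ n) F" for n
  proof (induction n)
    case 0 then show ?case by (simp add: A0)
  next
    case (Suc n)
    have i: "(A ^^ n) F \<in> Lp p" using iter[OF F] by auto
    have e1: "A (f n) = - ((inverse \<zeta> ^ Suc n) *\<^sub>c (A ^^ Suc n) F)" unfolding f_def scale[OF i] by simp
    have e2: "\<zeta> *\<^sub>c f n = - ((inverse \<zeta> ^ n) *\<^sub>c (A ^^ n) F)"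
      using \<zeta>0 by (simp add: f_def circle_fun.scale_scale[symmetric] del: circle_fun.scale_scale) (simp add: field_simps)
    have e3: "A (\<Sum>k<Suc n. f k) = A (\<Sum>k<n. f k) + A (f n)" using add[OF S f(1)] by simp
    have e4: "\<zeta> *\<^sub>c (\<Sum>k<Suc n. f k) = \<zeta> *\<^sub>c (\<Sum>k<n. f k) + \<zeta> *\<^sub>c f n"
      by (simp add: circle_fun.scale_right_distrib)
    have "A (\<Sum>k<Suc n. f k) - \<zeta> *\<^sub>c (\<Sum>k<Suc n. f k)
        = (A (\<Sum>k<n. f k) - \<zeta> *\<^sub>c (\<Sum>k<n. f k)) + (A (f n) - \<zeta> *\<^sub>c f n)"
      unfolding e3 e4 by simp
    also have "\<dots> = F - (inverse \<zeta> ^ Suc n) *\<^sub>c (A ^^ Suc n) F" unfolding Suc e1 e2 by simp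
    finally show ?case .
  qed
  \<comment> \<open>Comparison with the \<open>n\<close>-th partial sum: one error comes from the
    tail of the series through boundedness of \<open>A\<close>, one from the telescoped remainder.
    Both vanish in the limit.\<close>
  have "Lp_norm p (A G - \<zeta> *\<^sub>c G - F) \<le> (C * R + norm \<zeta>) * (c * \<rho> ^ n / (1 - \<rho>)) + C * \<rho> ^ n * Lp_norm p F" for n
  proof -
    define D where "D = G - (\<Sum>k<n. f k)"
    have D: "D \<in> Lp p" unfolding D_def by (rule Lp_diff(1)[OF G(1) S p])
    have GD: "G = D + (\<Sum>k<n. f k)" by (simp add: D_def)
    have i: "(A ^^ n) F \<in> Lp p" "Lp_norm p ((A ^^ n) F) \<le> C * R ^ n * Lp_norm p F" using iter[OF F] by auto
    have "A G - \<zeta> *\<^sub>c G - F = A D - \<zeta> *\<^sub>c D - (inverse \<zeta> ^ n) *\<^sub>c (A ^^ n) F"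
    proof -
      have "A G - \<zeta> *\<^sub>c G - F = A D - \<zeta> *\<^sub>c D + (A (\<Sum>k<n. f k) - \<zeta> *\<^sub>c (\<Sum>k<n. f k)) - F"
        unfolding GD add[OF D S] circle_fun.scale_right_distrib by simp
      then show ?thesis unfolding tele by simp
    qed
    also have "Lp_norm p \<dots> \<le> Lp_norm p (A D) + Lp_norm p (\<zeta> *\<^sub>c D) + Lp_norm p ((inverse \<zeta> ^ n) *\<^sub>c (A ^^ n) F)"
      by (intro Lp_norm_add3_le A1 D Lp_scale i p0 p)
    also have "\<dots> \<le> C * R * Lp_norm p D + norm \<zeta> * Lp_norm p D + inverse (norm \<zeta>) ^ n * (C * R ^ n * Lp_norm p F)"
      using A1(2)[OF D] i(2) unfolding Lp_scale(2)[OF D p0] Lp_scale(2)[OF i(1) p0]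
      by (intro add_mono) (auto simp: norm_power norm_inverse intro!: mult_left_mono)
    also have "inverse (norm \<zeta>) ^ n * (C * R ^ n * Lp_norm p F) = C * \<rho> ^ n * Lp_norm p F"
      by (simp add: \<rho>_def power_divide field_simps)
    also have "C * R * Lp_norm p D + norm \<zeta> * Lp_norm p D = (C * R + norm \<zeta>) * Lp_norm p D" by (simp add: algebra_simps)
    also have "\<dots> \<le> (C * R + norm \<zeta>) * (c * \<rho> ^ n / (1 - \<rho>))"
      using tail[of n] R unfolding D_def by (intro mult_left_mono) auto
    finally show ?thesis by simp
  qed
  moreover have "(\<lambda>n. (C * R + norm \<zeta>) * (c * \<rho> ^ n / (1 - \<rho>)) + C * \<rho> ^ n * Lp_norm p F)
      \<longlonglongrightarrow> (C * R + norm \<zeta>) * (c * 0 / (1 - \<rho>)) + C * 0 * Lp_norm p F"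
    using \<rho> by (intro tendsto_intros LIMSEQ_power_zero) auto
  ultimately have "Lp_norm p (A G - \<zeta> *\<^sub>c G - F) \<le> (C * R + norm \<zeta>) * (c * 0 / (1 - \<rho>)) + C * 0 * Lp_norm p F"
    by (intro LIMSEQ_le_const) auto
  then have "Lp_norm p (A G - \<zeta> *\<^sub>c G - F) = 0" by (simp add: order_antisym)
  moreover have "A G - \<zeta> *\<^sub>c G - F \<in> Lp p" by (intro Lp_diff A1 G Lp_scale F p0 p)
  ultimately have "A G - \<zeta> *\<^sub>c G - F = 0" using Lp_norm_eq_0[OF _ p0] by blast
  moreover have "Lp_norm p G \<le> C / norm \<zeta> / (1 - \<rho>) * Lp_norm p F" using tail[of 0] by (simp add: c_def)
  ultimately show ?thesis using G(1) by (auto simp: \<rho>_def)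
qed

end

lemma prod_list_one_plus_norm_le:
  fixes ws :: "complex list"
  shows "(\<And>w. w \<in> set ws \<Longrightarrow> norm w \<le> 1) \<Longrightarrow> (\<Prod>w\<leftarrow>ws. 1 + norm w) \<le> 2 ^ length ws"
proof (induction ws)
  case (Cons w ws)
  have "0 \<le> (\<Prod>w\<leftarrow>ws. 1 + norm w)" by (induction ws) auto
  then have "(1 + norm w) * (\<Prod>w\<leftarrow>ws. 1 + norm w) \<le> 2 * 2 ^ length ws"
    using Cons(1)[OF Cons(2)] Cons(2)[of w] by (intro mult_mono) auto
  then show ?case by simp
qed simp

context circle_measure
begin

section \<open>Dividing \<open>q(T) - q(z)\<close> by \<open>T - z\<close>, and the inclusion of the
  spectrum\<close>

lemma T_diff: "F \<in> Lp 1 \<Longrightarrow> G \<in> Lp 1 \<Longrightarrow> T (F - G) = T F - T G"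
  \<comment> \<open>\<open>root_product [0]\<close> is \<open>T\<close> itself.\<close>
  using root_product_diff[of F G "[0]"] by simp

text \<open>The quotient \<open>(q(T) - q(z)) / (T - z)\<close>.\<close>

fun cofactor :: "complex \<Rightarrow> complex list \<Rightarrow> circle_fun \<Rightarrow> circle_fun" where
  "cofactor z [] F = 0"
| "cofactor z (w # ws) F = T (cofactor z ws F) - w *\<^sub>c cofactor z ws F + (\<Prod>w\<leftarrow>ws. z - w) *\<^sub>c F"

lemma cofactor_Lp:
  assumes p: "1 \<le> p"
  shows "\<exists>D\<ge>0. \<forall>F\<in>Lp p. cofactor z ws F \<in> Lp p \<and> Lp_norm p (cofactor z ws F) \<le> D * Lp_norm p F"
proof (induction ws)
  case Nil then show ?case using p by (intro exI[of _ 0]) auto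
next
  case (Cons w ws)
  have p0: "0 < p" using p by simp
  obtain D where D: "D \<ge> 0" "\<And>F. F \<in> Lp p \<Longrightarrow> cofactor z ws F \<in> Lp p"
    "\<And>F. F \<in> Lp p \<Longrightarrow> Lp_norm p (cofactor z ws F) \<le> D * Lp_norm p F" using Cons by blast
  define q where "q = (\<Prod>w\<leftarrow>ws. z - w)"
  show ?case
  proof (intro exI[of _ "D + norm w * D + norm q"] conjI ballI)
    fix F assume F: "F \<in> Lp p"
    let ?G = "cofactor z ws F"
    have G: "?G \<in> Lp p" "Lp_norm p ?G \<le> D * Lp_norm p F" using D F by auto
    have m: "T ?G \<in> Lp p" "w *\<^sub>c ?G \<in> Lp p" "q *\<^sub>c F \<in> Lp p" using T_Lp(1)[OF G(1) p] Lp_scale(1)[OF _ p0] G F by auto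
    show "cofactor z (w # ws) F \<in> Lp p" using Lp_add(1)[OF Lp_diff(1)[OF m(1,2) p] m(3) p] by (simp add: q_def)
    have "Lp_norm p (cofactor z (w # ws) F) \<le> Lp_norm p (T ?G - w *\<^sub>c ?G) + Lp_norm p (q *\<^sub>c F)"
      using Lp_add(2)[OF Lp_diff(1)[OF m(1,2) p] m(3) p] by (simp add: q_def)
    also have "\<dots> \<le> Lp_norm p ?G + norm w * Lp_norm p ?G + norm q * Lp_norm p F"
      using Lp_diff(2)[OF m(1,2) p] T_Lp(2)[OF G(1) p] Lp_scale(2)[OF G(1) p0] Lp_scale(2)[OF F p0] by simp
    also have "\<dots> \<le> D * Lp_norm p F + norm w * (D * Lp_norm p F) + norm q * Lp_norm p F"
      using G(2) by (intro add_mono mult_left_mono) auto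
    finally show "Lp_norm p (cofactor z (w # ws) F) \<le> (D + norm w * D + norm q) * Lp_norm p F"
      by (simp add: algebra_simps)
  qed (use D in auto)
qed

lemma cofactor_zero: "cofactor z ws 0 = 0"
proof (induction ws)
  case (Cons w ws)
  have "T 0 = 0" using T_scale[of 0 0] by simp
  then show ?case using Cons by simp
qed simp

text \<open>Horner's scheme read as an operator identity, in both orders of composition: with
  \<open>T - z\<close> applied last it gives solvability, with \<open>T - z\<close> applied first it
  gives injectivity.\<close>

lemma cofactor_eq:
  assumes F: "F \<in> Lp 1"
  shows "T (cofactor z ws F) - z *\<^sub>c cofactor z ws F = root_product ws F - (\<Prod>w\<leftarrow>ws. z - w) *\<^sub>c F"
    and "cofactor z ws (T F - z *\<^sub>c F) = root_product ws F - (\<Prod>w\<leftarrow>ws. z - w) *\<^sub>c F"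
proof -
  have T0: "T 0 = 0" using T_scale[of 0 0] by simp
  have C: "cofactor z ws G \<in> Lp 1" if "G \<in> Lp 1" for ws G
    using cofactor_Lp[of 1 z ws] that by auto
  have TF: "T F \<in> Lp 1" using T_Lp(1)[OF F] by simp
  show "T (cofactor z ws F) - z *\<^sub>c cofactor z ws F = root_product ws F - (\<Prod>w\<leftarrow>ws. z - w) *\<^sub>c F"
  proof (induction ws)
    case (Cons w ws)
    let ?G = "cofactor z ws F"
    define q where "q = (\<Prod>w\<leftarrow>ws. z - w)"
    have G: "?G \<in> Lp 1" "T ?G \<in> Lp 1" using C[OF F] T_Lp(1)[OF C[OF F]] by auto
    have P: "root_product ws F \<in> Lp 1" using root_product_Lp[OF F] by simp
    have IH: "T ?G = z *\<^sub>c ?G + root_product ws F - q *\<^sub>c F" using Cons by (simp add: q_def algebra_simps)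
    have IH2: "T (T ?G) = z *\<^sub>c T ?G + T (root_product ws F) - q *\<^sub>c T F"
    proof -
      have "T (T ?G) = T (z *\<^sub>c ?G + root_product ws F - q *\<^sub>c F)" by (rule arg_cong[where f = T, OF IH])
      also have "\<dots> = T (z *\<^sub>c ?G + root_product ws F) - T (q *\<^sub>c F)"
        by (intro T_diff Lp_add Lp_scale G P F; simp)
      also have "T (z *\<^sub>c ?G + root_product ws F) = T (z *\<^sub>c ?G) + T (root_product ws F)"
        by (intro T_add Lp_scale G P) simp
      finally show ?thesis by (simp add: T_scale)
    qed
    have exp: "T (T ?G - w *\<^sub>c ?G + q *\<^sub>c F) = T (T ?G) - w *\<^sub>c T ?G + q *\<^sub>c T F"
    proof -
      have "T (T ?G - w *\<^sub>c ?G + q *\<^sub>c F) = T (T ?G - w *\<^sub>c ?G) + T (q *\<^sub>c F)"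
        by (intro T_add Lp_diff Lp_scale G F; simp)
      also have "T (T ?G - w *\<^sub>c ?G) = T (T ?G) - T (w *\<^sub>c ?G)" by (intro T_diff Lp_scale G; simp)
      finally show ?thesis by (simp add: T_scale)
    qed
    have "T (cofactor z (w # ws) F) - z *\<^sub>c cofactor z (w # ws) F
        = T (T ?G) - w *\<^sub>c T ?G + q *\<^sub>c T F - z *\<^sub>c (T ?G - w *\<^sub>c ?G + q *\<^sub>c F)"
      by (simp add: exp flip: q_def)
    also have "\<dots> = T (root_product ws F) - w *\<^sub>c (T ?G - z *\<^sub>c ?G) - (z * q) *\<^sub>c F"
      unfolding IH2 by (simp add: circle_fun.scale_right_distrib circle_fun.scale_right_diff_distrib mult.commute[of w z])
    also have "T ?G - z *\<^sub>c ?G = root_product ws F - q *\<^sub>c F" using Cons by (simp add: q_def)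
    also have "T (root_product ws F) - w *\<^sub>c (root_product ws F - q *\<^sub>c F) - (z * q) *\<^sub>c F
        = root_product (w # ws) F - ((z - w) * q) *\<^sub>c F"
      by (simp add: circle_fun.scale_right_diff_distrib circle_fun.scale_left_diff_distrib left_diff_distrib)
    finally show ?case by (simp add: q_def)
  qed (simp add: T0)
  show "cofactor z ws (T F - z *\<^sub>c F) = root_product ws F - (\<Prod>w\<leftarrow>ws. z - w) *\<^sub>c F"
  proof (induction ws)
    case (Cons w ws)
    define q where "q = (\<Prod>w\<leftarrow>ws. z - w)"
    have P: "root_product ws F \<in> Lp 1" using root_product_Lp[OF F] by simp
    have "cofactor z (w # ws) (T F - z *\<^sub>c F) = T (root_product ws F - q *\<^sub>c F) - w *\<^sub>c (root_product ws F - q *\<^sub>c F) + q *\<^sub>c (T F - z *\<^sub>c F)"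
      using Cons by (simp add: q_def)
    also have "T (root_product ws F - q *\<^sub>c F) = T (root_product ws F) - q *\<^sub>c T F"
      using T_diff[OF P Lp_scale(1)[OF F]] by (simp add: T_scale)
    also have "\<dots> - w *\<^sub>c (root_product ws F - q *\<^sub>c F) + q *\<^sub>c (T F - z *\<^sub>c F)
        = root_product (w # ws) F - ((z - w) * q) *\<^sub>c F"
      by (simp add: circle_fun.scale_right_diff_distrib circle_fun.scale_left_diff_distrib left_diff_distrib mult.commute[of q z])
    finally show ?case by (simp add: q_def)
  qed simp
qed

text \<open>Each factor \<open>T - w\<close> has norm at most 2 on \<open>L^1\<close> and for the
  sup bound, because \<open>T\<close> is a contraction there and \<open>w\<close> lies in the unit
  disc.\<close>

lemma endpoint_bounds_root_product:
  assumes ws: "\<And>w. w \<in> set ws \<Longrightarrow> norm w \<le> 1"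
    and \<epsilon>: "\<And>n. norm (\<Prod>w\<leftarrow>ws. fourier_coeff n - w) \<le> \<epsilon>"
  shows "endpoint_bounds (root_product ws) (2 ^ length ws) \<epsilon>"
  unfolding endpoint_bounds_def
proof (intro conjI ballI allI impI)
  note le = prod_list_one_plus_norm_le[OF ws]
  fix F assume F: "F \<in> Lp 1"
  show "root_product ws F \<in> Lp 1" using root_product_Lp[OF F] by simp
  have "Lp_norm 1 (root_product ws F) \<le> (\<Prod>w\<leftarrow>ws. 1 + norm w) * Lp_norm 1 F" using root_product_Lp[OF F] by simp
  also have "\<dots> \<le> 2 ^ length ws * Lp_norm 1 F" using le by (intro mult_right_mono) auto
  finally show "Lp_norm 1 (root_product ws F) \<le> 2 ^ length ws * Lp_norm 1 F" .
next
  fix F b assume F: "sup_bounded b F"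
  then have "0 \<le> b" unfolding sup_bounded_def by (meson norm_ge_zero order_trans)
  then have "(\<Prod>w\<leftarrow>ws. 1 + norm w) * b \<le> 2 ^ length ws * b" using prod_list_one_plus_norm_le[OF ws] by (intro mult_right_mono) auto
  then show "sup_bounded (2 ^ length ws * b) (root_product ws F)"
    using sup_bounded_mono[OF root_product_sup_bounded[OF F]] by blast
qed (use root_product_add root_product_L2[OF _ \<epsilon>] root_product_Lp[of _ 2] in auto)

theorem Lp_spectrum_subset:
  assumes K: "compact K" "countable K" "K \<subseteq> cball 0 1" and coeff: "range fourier_coeff \<subseteq> K" and p: "1 < p"
  shows "Lp_spectrum p T \<subseteq> K"
proof (rule ccontr)
  assume "\<not> Lp_spectrum p T \<subseteq> K"
  then obtain z where z: "z \<in> Lp_spectrum p T" "z \<notin> K" by blast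
  have p1: "1 \<le> p" and p0: "0 < p" using p by auto
  have L1: "F \<in> Lp 1" if "F \<in> Lp p" for F by (rule Lp_mono[OF that]) (use p in auto)
  have K0: "K \<noteq> {}" using coeff by auto
  define d where "d = infdist z K"
  have d: "0 < d" "\<And>w. w \<in> K \<Longrightarrow> d \<le> norm (z - w)"
  proof -
    show "0 < d" unfolding d_def using infdist_pos_not_in_closed[OF compact_imp_closed[OF K(1)] K0 z(2)] .
    show "d \<le> norm (z - w)" if "w \<in> K" for w unfolding d_def using infdist_le[OF that, of z] by (simp add: dist_norm)
  qed
  obtain C a b where Cab: "0 \<le> C" "0 < a"
    and interp: "\<And>A M \<epsilon> F. endpoint_bounds A M \<epsilon> \<Longrightarrow> 0 < M \<Longrightarrow> 0 < \<epsilon> \<Longrightarrow> F \<in> Lp p \<Longrightarrow>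
       A F \<in> Lp p \<and> Lp_norm p (A F) powr p \<le> C * M powr b * \<epsilon> powr a * Lp_norm p F powr p"
    using interpolation[OF p] by metis
  \<comment> \<open>Chosen so that each root contributes the factor \<open>d / 2\<close> to the
    interpolated \<open>L^p\<close> bound for \<open>q(T)\<close>, against a factor of at least
    \<open>d\<close> in \<open>norm \<zeta>\<close>. Solving for \<epsilon> uses
    \<open>0 < a\<close>.\<close>
  define \<epsilon> where "\<epsilon> = ((d / 2) powr p / 2 powr b) powr (1 / a)"
  have \<epsilon>: "0 < \<epsilon>" "2 powr b * \<epsilon> powr a = (d / 2) powr p" using d Cab by (auto simp: \<epsilon>_def powr_powr)
  obtain ws where ws: "ws \<noteq> []" "set ws \<subseteq> K" "\<And>y. y \<in> K \<Longrightarrow> norm (\<Prod>w\<leftarrow>ws. y - w) \<le> \<epsilon> ^ length ws"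
    using small_root_product[OF K(1,2) K0 K(3) \<epsilon>(1)] by blast
  define A where "A = root_product ws"
  define \<zeta> where "\<zeta> = (\<Prod>w\<leftarrow>ws. z - w)"
  define R where "R = (d / 2) ^ length ws"
  define C1 where "C1 = C powr (1 / p)"
  have \<zeta>: "R < norm \<zeta>"
  proof -
    have "d ^ length ws \<le> norm (\<Prod>w\<leftarrow>ws. z - w)" using ws(2)
    proof (induction ws)
      case (Cons w ws)
      then show ?case using d by (simp add: norm_mult mult_mono)
    qed simp
    moreover have "R < d ^ length ws" unfolding R_def using d ws(1) by (intro power_strict_mono) auto
    ultimately show ?thesis by (simp add: \<zeta>_def)
  qed
  \<comment> \<open>A power of \<open>q(T)\<close> is again a product over roots, so each power is
    interpolated as a whole and the constant \<open>C1\<close> does not accumulate.\<close>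
  have Am: "A ^^ m = root_product (concat (replicate m ws))" for m
    by (induction m) (auto simp: A_def fun_eq_iff root_product_append)
  have iter: "(A ^^ m) F \<in> Lp p \<and> Lp_norm p ((A ^^ m) F) \<le> C1 * R ^ m * Lp_norm p F" if F: "F \<in> Lp p" for m F
  proof -
    define l where "l = length ws * m"
    have "length (concat (replicate k ws)) = length ws * k" for k by (induction k) auto
    then have len: "length (concat (replicate m ws)) = l" by (simp add: l_def)
    have "norm (\<Prod>w\<leftarrow>concat (replicate m ws). y - w) \<le> \<epsilon> ^ l" if "y \<in> K" for y
    proof -
      have "(\<Prod>w\<leftarrow>concat (replicate m ws). y - w) = (\<Prod>w\<leftarrow>ws. y - w) ^ m" by (induction m) auto
      then have "norm (\<Prod>w\<leftarrow>concat (replicate m ws). y - w) \<le> (\<epsilon> ^ length ws) ^ m"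
        using ws(3)[OF that] by (simp add: norm_power power_mono)
      then show ?thesis by (simp add: l_def power_mult)
    qed
    then have "endpoint_bounds (A ^^ m) (2 ^ l) (\<epsilon> ^ l)"
      unfolding Am len[symmetric] using coeff ws(2) K(3)
      by (intro endpoint_bounds_root_product) (auto split: if_splits)
    then have *: "(A ^^ m) F \<in> Lp p" "Lp_norm p ((A ^^ m) F) powr p \<le> C * (2 ^ l) powr b * (\<epsilon> ^ l) powr a * Lp_norm p F powr p"
      using interp[of "A ^^ m" "2 ^ l" "\<epsilon> ^ l" F] F \<epsilon>(1) by auto
    have "(2 ^ l) powr b * (\<epsilon> ^ l) powr a = (2 powr b * \<epsilon> powr a) powr real l"
      using \<epsilon>(1) by (simp add: powr_mult powr_powr powr_realpow[symmetric] mult.commute)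
    also have "\<dots> = ((d / 2) powr real l) powr p" unfolding \<epsilon>(2) by (simp add: powr_powr mult.commute)
    also have "(d / 2) powr real l = (d / 2) ^ l" by (rule powr_realpow) (use d in simp)
    also have "(d / 2) ^ l = R ^ m" by (simp add: R_def l_def power_mult)
    finally have e: "(2 ^ l) powr b * (\<epsilon> ^ l) powr a = (R ^ m) powr p" .
    have R0: "0 \<le> R" using d by (simp add: R_def)
    have "Lp_norm p ((A ^^ m) F) powr p \<le> C * ((2 ^ l) powr b * (\<epsilon> ^ l) powr a) * Lp_norm p F powr p"
      using *(2) by (simp add: mult.assoc)
    also have "\<dots> = (C1 * R ^ m * Lp_norm p F) powr p"
      unfolding e using Cab p0 R0 by (simp add: C1_def powr_mult powr_powr)
    finally have le: "Lp_norm p ((A ^^ m) F) powr p \<le> (C1 * R ^ m * Lp_norm p F) powr p" .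
    have "0 \<le> C1 * R ^ m * Lp_norm p F" using R0 by (simp add: C1_def)
    then have "Lp_norm p ((A ^^ m) F) \<le> C1 * R ^ m * Lp_norm p F"
      using le powr_less_mono2[OF p0] by (meson linorder_not_le)
    then show ?thesis using *(1) by simp
  qed
  have addA: "A (F + G) = A F + A G" if "F \<in> Lp p" "G \<in> Lp p" for F G
    unfolding A_def by (rule root_product_add) (use L1 that in auto)
  have scaleA: "A (c *\<^sub>c F) = c *\<^sub>c A F" for c F unfolding A_def by (rule root_product_scale)
  have C1: "0 \<le> C1" "0 \<le> R" using d by (auto simp: C1_def R_def)
  have neumann: "\<exists>E\<in>Lp p. A E - \<zeta> *\<^sub>c E = F \<and> Lp_norm p E \<le> C1 / norm \<zeta> / (1 - R / norm \<zeta>) * Lp_norm p F"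
    if "F \<in> Lp p" for F
    by (rule neumann_solution[where A = A, OF p1 _ _ _ C1 \<zeta> that]) (erule (1) addA | rule scaleA | erule iter)+
  have eigen: "F = 0" if "F \<in> Lp p" "A F = \<zeta> *\<^sub>c F" for F
    by (rule eigenvector_zero[where A = A and \<zeta> = \<zeta>, OF p1 _ _ _ C1 \<zeta> that]) (erule (1) addA | rule scaleA | erule iter)+
  obtain D where D: "D \<ge> 0" "\<And>F. F \<in> Lp p \<Longrightarrow> cofactor z ws F \<in> Lp p"
    "\<And>F. F \<in> Lp p \<Longrightarrow> Lp_norm p (cofactor z ws F) \<le> D * Lp_norm p F" using cofactor_Lp[OF p1] by blast
  define B where "B = D * (C1 / norm \<zeta> / (1 - R / norm \<zeta>))"
  have TL: "T F - z *\<^sub>c F \<in> Lp p" if "F \<in> Lp p" for F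
    by (intro Lp_diff T_Lp Lp_scale that p1 p0)
  \<comment> \<open>Invert \<open>q(T) - q(z)\<close> by the Neumann series, then apply the
    cofactor.\<close>
  have ex: "\<exists>G\<in>Lp p. T G - z *\<^sub>c G = F \<and> Lp_norm p G \<le> B * Lp_norm p F" if F: "F \<in> Lp p" for F
  proof -
    obtain E where E: "E \<in> Lp p" "A E - \<zeta> *\<^sub>c E = F" "Lp_norm p E \<le> C1 / norm \<zeta> / (1 - R / norm \<zeta>) * Lp_norm p F"
      using neumann[OF F] by blast
    have "T (cofactor z ws E) - z *\<^sub>c cofactor z ws E = F"
      using cofactor_eq(1)[OF L1[OF E(1)], of z ws] E(2) by (simp add: A_def \<zeta>_def)
    moreover have "Lp_norm p (cofactor z ws E) \<le> B * Lp_norm p F"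
      using D(3)[OF E(1)] mult_left_mono[OF E(3) D(1)] by (simp add: B_def)
    ultimately show ?thesis using D(2)[OF E(1)] by blast
  qed
  have inj: "G = 0" if "G \<in> Lp p" "T G - z *\<^sub>c G = 0" for G
  proof -
    have "root_product ws G - \<zeta> *\<^sub>c G = 0"
      using cofactor_eq(2)[OF L1[OF that(1)], of z ws] that(2) by (simp add: cofactor_zero \<zeta>_def)
    then show ?thesis using eigen[OF that(1)] by (simp add: A_def)
  qed
  have uniq: "G = H" if "G \<in> Lp p" "H \<in> Lp p" "T G - z *\<^sub>c G = T H - z *\<^sub>c H" for G H
  proof -
    have "T (G - H) - z *\<^sub>c (G - H) = 0"
      unfolding T_diff[OF L1[OF that(1)] L1[OF that(2)]] circle_fun.scale_right_diff_distrib
      using that(3) by (simp add: algebra_simps)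
    then have "G - H = 0" using inj[of "G - H"] Lp_diff(1)[OF that(1,2) p1] by blast
    then show ?thesis by simp
  qed
  \<comment> \<open>A solution with a norm bound is chosen; additivity and homogeneity of the choice
    come from uniqueness.\<close>
  define S where "S F = (SOME G. G \<in> Lp p \<and> T G - z *\<^sub>c G = F \<and> Lp_norm p G \<le> B * Lp_norm p F)" for F
  have S: "S F \<in> Lp p" "T (S F) - z *\<^sub>c S F = F" "Lp_norm p (S F) \<le> B * Lp_norm p F" if F: "F \<in> Lp p" for F
  proof -
    have "\<exists>G. G \<in> Lp p \<and> T G - z *\<^sub>c G = F \<and> Lp_norm p G \<le> B * Lp_norm p F" using ex[OF F] by blast
    from someI_ex[OF this] show "S F \<in> Lp p" "T (S F) - z *\<^sub>c S F = F" "Lp_norm p (S F) \<le> B * Lp_norm p F"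
      unfolding S_def by auto
  qed
  have "bounded_operator_Lp p S"
    unfolding bounded_operator_Lp_def
  proof (intro conjI ballI allI)
    fix F G assume F: "F \<in> Lp p" and G: "G \<in> Lp p"
    show "S (F + G) = S F + S G"
    proof (rule uniq)
      show "S (F + G) \<in> Lp p" "S F + S G \<in> Lp p" by (intro S Lp_add F G p1)+
      show "T (S (F + G)) - z *\<^sub>c S (F + G) = T (S F + S G) - z *\<^sub>c (S F + S G)"
        using S(2)[OF Lp_add(1)[OF F G p1]] S(2)[OF F] S(2)[OF G] T_add[OF L1[OF S(1)[OF F]] L1[OF S(1)[OF G]]]
        by (simp add: circle_fun.scale_right_distrib algebra_simps)
    qed
  next
    fix c F assume F: "F \<in> Lp p"
    show "S (c *\<^sub>c F) = c *\<^sub>c S F"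
    proof (rule uniq)
      show "S (c *\<^sub>c F) \<in> Lp p" "c *\<^sub>c S F \<in> Lp p" by (intro S Lp_scale F p0)+
      have "T (c *\<^sub>c S F) - z *\<^sub>c (c *\<^sub>c S F) = c *\<^sub>c (T (S F) - z *\<^sub>c S F)"
        by (simp add: T_scale circle_fun.scale_right_diff_distrib mult.commute)
      then show "T (S (c *\<^sub>c F)) - z *\<^sub>c S (c *\<^sub>c F) = T (c *\<^sub>c S F) - z *\<^sub>c (c *\<^sub>c S F)"
        using S(2)[OF Lp_scale(1)[OF F p0]] S(2)[OF F] by simp
    qed
  qed (use S in auto)
  moreover have "S (T F - z *\<^sub>c F) = F" if F: "F \<in> Lp p" for F
    using uniq[OF S(1)[OF TL[OF F]] F S(2)[OF TL[OF F]]] .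
  ultimately have "z \<notin> Lp_spectrum p T" unfolding Lp_spectrum_def using S(2) by blast
  then show False using z(1) by simp
qed

end

section \<open>Fourier coefficients of the Cantor-Lebesgue measure\<close>

lemma real_distribution_convolution:
  assumes M: "real_distribution M" and N: "real_distribution N"
  shows "real_distribution (M \<star> N)"
proof -
  interpret M: real_distribution M by fact
  interpret N: real_distribution N by fact
  interpret pair_prob_space M N ..
  have "(\<lambda>(x, y). x + y) \<in> borel_measurable (M \<Otimes>\<^sub>M N)" by (simp add: case_prod_beta')
  then have "prob_space (M \<star> N)" unfolding convolution_def by (rule prob_space_distr)
  then show ?thesis by (simp add: real_distribution_def real_distribution_axioms_def)
qed

lemma char_convolution:
  assumes M: "real_distribution M" and N: "real_distribution N"
  shows "char (M \<star> N) t = char M t * char N t"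
proof -
  interpret M: real_distribution M by fact
  interpret N: real_distribution N by fact
  interpret pair_prob_space M N ..
  have m: "(\<lambda>(x, y). x + y) \<in> borel_measurable (M \<Otimes>\<^sub>M N)" by (simp add: case_prod_beta')
  have i: "integrable (M \<Otimes>\<^sub>M N) (\<lambda>z. iexp (t * (fst z + snd z)))"
    by (rule integrable_const_bound[of _ 1]) auto
  have "char (M \<star> N) t = (CLINT z|M \<Otimes>\<^sub>M N. iexp (t * (fst z + snd z)))"
    unfolding char_def convolution_def by (subst integral_distr[OF m]) (auto simp: case_prod_beta')
  also have "\<dots> = (CLINT x|M. CLINT y|N. iexp (t * (x + y)))"
    using integral_fst'[OF i] by simp
  also have "\<dots> = (CLINT x|M. iexp (t * x) * char N t)"
    by (simp add: char_def distrib_left exp_add)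
  also have "\<dots> = char M t * char N t" by (simp add: char_def)
  finally show ?thesis .
qed

lemma AE_convolution:
  assumes M: "real_distribution M" and N: "real_distribution N"
    and a: "AE x in M. \<bar>x\<bar> \<le> a" and b: "AE y in N. \<bar>y\<bar> \<le> b"
  shows "AE z in M \<star> N. \<bar>z\<bar> \<le> a + b"
proof -
  interpret M: real_distribution M by fact
  interpret N: real_distribution N by fact
  interpret pair_prob_space M N ..
  have m: "(\<lambda>(x, y). x + y) \<in> borel_measurable (M \<Otimes>\<^sub>M N)" by (simp add: case_prod_beta')
  have "AE z in M \<Otimes>\<^sub>M N. \<bar>fst z + snd z\<bar> \<le> a + b"
  proof (rule AE_pair_measure)
    show "{z \<in> space (M \<Otimes>\<^sub>M N). \<bar>fst z + snd z\<bar> \<le> a + b} \<in> sets (M \<Otimes>\<^sub>M N)" by measurable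
    show "AE x in M. AE y in N. \<bar>fst (x, y) + snd (x, y)\<bar> \<le> a + b"
      using a
    proof eventually_elim
      case (elim x)
      show ?case using b by eventually_elim (use elim in auto)
    qed
  qed
  then show ?thesis unfolding convolution_def by (subst AE_distr_iff[OF m]) (auto simp: case_prod_beta')
qed

lemma real_distribution_coin: "real_distribution (coin_measure a)"
  unfolding coin_measure_def by (auto simp: real_distribution_def real_distribution_axioms_def intro!: prob_space.prob_space_distr prob_space_measure_pmf)

lemma char_coin: "char (coin_measure a) t = of_real (cos (t * a))"
proof -
  have "char (coin_measure a) t = (CLINT b|measure_pmf (bernoulli_pmf (1/2)). iexp (t * (if b then a else - a)))"
    unfolding char_def coin_measure_def by (subst integral_distr) auto
  also have "\<dots> = (iexp (t * a) + iexp (- (t * a))) / 2" 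
    by (subst integral_measure_pmf[of UNIV]) (auto simp: UNIV_bool scaleR_conv_of_real add_divide_distrib)
  also have "\<dots> = of_real (cos (t * a))" by (simp add: complex_eq_iff Re_exp Im_exp)
  finally show ?thesis .
qed

lemma AE_coin: "AE x in coin_measure a. \<bar>x\<bar> \<le> \<bar>a\<bar>"
  unfolding coin_measure_def by (subst AE_distr_iff) auto

lemma real_distribution_bernoulli_partial: "real_distribution (bernoulli_partial \<theta> n)"
proof (induction n)
  case 0
  show ?case by (simp add: real_distribution_def real_distribution_axioms_def prob_space_return)
qed (simp add: real_distribution_convolution real_distribution_coin)

lemma char_bernoulli_partial: "char (bernoulli_partial \<theta> n) t = of_real (\<Prod>k<n. cos (t / \<theta> ^ k))"
proof (induction n)
  case 0
  show ?case by (simp add: char_def integral_return)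
next
  case (Suc n)
  then show ?case
    by (simp add: char_convolution real_distribution_bernoulli_partial real_distribution_coin char_coin power_one_over)
qed

lemma AE_bernoulli_partial: "AE x in bernoulli_partial \<theta> n. \<bar>x\<bar> \<le> (\<Sum>k<n. \<bar>(1 / \<theta>) ^ k\<bar>)"
proof (induction n)
  case 0
  show ?case unfolding bernoulli_partial.simps by (subst AE_return) auto
next
  case (Suc n)
  then show ?case unfolding bernoulli_partial.simps sum.lessThan_Suc
    by (intro AE_convolution real_distribution_bernoulli_partial real_distribution_coin AE_coin)
qed

lemma tight_bernoulli_partial:
  assumes \<theta>: "2 < \<theta>" shows "tight (bernoulli_partial \<theta>)"
  unfolding tight_def
proof (intro conjI allI impI)
  show "real_distribution (bernoulli_partial \<theta> n)" for n by (rule real_distribution_bernoulli_partial)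
  fix e :: real assume e: "0 < e"
  \<comment> \<open>The partial products live on [-2, 2], strictly inside the half-open interval
    that \<open>tight\<close> asks for.\<close>
  have "measure (bernoulli_partial \<theta> n) {- 3<..3} > 1 - e" for n
  proof -
    interpret real_distribution "bernoulli_partial \<theta> n" by (rule real_distribution_bernoulli_partial)
    have le: "(\<Sum>k<n. \<bar>(1 / \<theta>) ^ k\<bar>) \<le> 2"
    proof -
      have "(\<Sum>k<n. \<bar>(1 / \<theta>) ^ k\<bar>) \<le> (\<Sum>k<n. (1 / 2) ^ k)"
        using \<theta> by (intro sum_mono) (auto simp: power_abs[symmetric] intro!: power_mono divide_left_mono)
      also have "\<dots> \<le> 2" by (simp add: sum_gp_strict)
      finally show ?thesis .
    qed
    have "AE x in bernoulli_partial \<theta> n. x \<in> {- 3<..3}"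
      using AE_bernoulli_partial[of \<theta> n] by eventually_elim (use le in auto)
    then have "prob {- 3<..3} = 1" by (subst prob_eq_1) auto
    then show ?thesis using e by simp
  qed
  then show "\<exists>a b. a < b \<and> (\<forall>n. 1 - e < measure (bernoulli_partial \<theta> n) {a<..b})"
    by (intro exI[of _ "-3"] exI[of _ 3]) auto
qed

text \<open>The signed products need not be monotone; convergence comes from their increments, of
  size at most \<open>|t| / \<theta> ^ n\<close> since \<open>1 - cos x \<le> |x|\<close>.\<close>

lemma convergent_cos_product:
  fixes t \<theta> :: real
  assumes \<theta>: "2 < \<theta>" shows "convergent (\<lambda>n. \<Prod>k<n. cos (t / \<theta> ^ k))"
proof -
  define P where "P n = (\<Prod>k<n. cos (t / \<theta> ^ k))" for n
  have P1: "\<bar>P n\<bar> \<le> 1" for n unfolding P_def abs_prod by (intro prod_le_1) auto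
  have "summable (\<lambda>n. P (Suc n) - P n)"
  proof (rule summable_comparison_test'[of "\<lambda>n. \<bar>t\<bar> * (1 / \<theta>) ^ n" 0])
    show "summable (\<lambda>n. \<bar>t\<bar> * (1 / \<theta>) ^ n)" using \<theta> by (intro summable_mult summable_geometric) simp
    fix n
    have "1 - cos x \<le> \<bar>x\<bar>" for x :: real
    proof -
      have "1 - cos x = 2 * (sin (x / 2))\<^sup>2" using cos_double_sin[of "x / 2"] by simp
      also have "\<dots> = 2 * (\<bar>sin (x / 2)\<bar> * \<bar>sin (x / 2)\<bar>)" by (simp add: power2_eq_square)
      also have "\<dots> \<le> 2 * (\<bar>x / 2\<bar> * 1)" by (intro mult_left_mono mult_mono abs_sin_x_le_abs_x) auto
      finally show ?thesis by simp
    qed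
    note c = this[of "t / \<theta> ^ n"]
    have "P (Suc n) - P n = - (P n * (1 - cos (t / \<theta> ^ n)))" by (simp add: P_def algebra_simps)
    then have "norm (P (Suc n) - P n) = \<bar>P n\<bar> * (1 - cos (t / \<theta> ^ n))" by (simp add: abs_mult)
    also have "\<dots> \<le> 1 * \<bar>t / \<theta> ^ n\<bar>" using P1 c by (intro mult_mono) auto
    also have "\<dots> = \<bar>t\<bar> * (1 / \<theta>) ^ n" using \<theta> by (simp add: power_one_over)
    finally show "norm (P (Suc n) - P n) \<le> \<bar>t\<bar> * (1 / \<theta>) ^ n" .
  qed
  then have "convergent (\<lambda>n. \<Sum>k<n. P (Suc k) - P k)" by (simp add: summable_iff_convergent)
  then have "convergent (\<lambda>n. P n - P 0)" by (simp add: sum_lessThan_telescope)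
  then have "convergent (\<lambda>n. (P n - P 0) + P 0)" by (intro convergent_add convergent_const)
  then show ?thesis by (simp add: P_def)
qed

text \<open>Shows that the definite description denotes. Tightness gives a weak limit along a
  subsequence, whose characteristic function must be the limit of the cosine products. That limit
  exists along the whole sequence, so Levy continuity gives weak convergence of the whole sequence,
  and Levy uniqueness gives a single limit.\<close>

lemma bernoulli_convolution:
  assumes \<theta>: "2 < \<theta>"
  shows "real_distribution (bernoulli_convolution \<theta>)"
    and "(\<lambda>n. complex_of_real (\<Prod>k<n. cos (t / \<theta> ^ k))) \<longlonglongrightarrow> char (bernoulli_convolution \<theta>) t"
proof -
  let ?B = "bernoulli_partial \<theta>"
  note rd = real_distribution_bernoulli_partial
  obtain r M where r: "strict_mono (r :: nat \<Rightarrow> nat)" and M: "real_distribution M" and wc: "weak_conv_m (?B \<circ> id \<circ> r) M"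
    using tight_imp_convergent_subsubsequence[OF tight_bernoulli_partial[OF \<theta>] strict_mono_id] by blast
  have char: "(\<lambda>n. char (?B n) t) \<longlonglongrightarrow> char M t" for t
  proof -
    obtain l where l: "(\<lambda>n. \<Prod>k<n. cos (t / \<theta> ^ k)) \<longlonglongrightarrow> l"
      using convergent_cos_product[OF \<theta>] by (auto simp: convergent_def)
    then have l': "(\<lambda>n. char (?B n) t) \<longlonglongrightarrow> of_real l"
      unfolding char_bernoulli_partial by (rule tendsto_of_real)
    have "(\<lambda>n. char ((?B \<circ> id \<circ> r) n) t) \<longlonglongrightarrow> char M t"
      by (rule levy_continuity1[OF _ M wc]) (simp add: rd)
    moreover have "(\<lambda>n. char ((?B \<circ> id \<circ> r) n) t) \<longlonglongrightarrow> of_real l"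
      using LIMSEQ_subseq_LIMSEQ[OF l' r] by (simp add: o_def)
    ultimately have "char M t = of_real l" by (rule LIMSEQ_unique)
    then show ?thesis using l' by simp
  qed
  have W: "weak_conv_m ?B M" by (rule levy_continuity[OF rd M char])
  have "bernoulli_convolution \<theta> = M"
    unfolding bernoulli_convolution_def
  proof (rule the_equality)
    show "real_distribution M \<and> weak_conv_m ?B M" using M W by simp
    fix M' assume M': "real_distribution M' \<and> weak_conv_m ?B M'"
    have "char M' = char M"
    proof
      fix t
      have "(\<lambda>n. char (?B n) t) \<longlonglongrightarrow> char M' t" by (rule levy_continuity1[OF rd]) (use M' in auto)
      then show "char M' t = char M t" using char by (rule LIMSEQ_unique)
    qed
    then show "M' = M" using Levy_uniqueness M M' by blast
  qed
  then show "real_distribution (bernoulli_convolution \<theta>)"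
    and "(\<lambda>n. complex_of_real (\<Prod>k<n. cos (t / \<theta> ^ k))) \<longlonglongrightarrow> char (bernoulli_convolution \<theta>) t"
    using M char[of t] by (simp_all add: char_bernoulli_partial)
qed

lemma circle_measure_cantor_lebesgue:
  assumes \<theta>: "2 < \<theta>" shows "circle_measure (cantor_lebesgue \<theta>)"
proof -
  interpret B: real_distribution "bernoulli_convolution \<theta>" by (rule bernoulli_convolution[OF \<theta>])
  have "(\<lambda>x. frac ((\<theta> - 1) / (2 * \<theta>) * x + 1/2)) \<in> bernoulli_convolution \<theta> \<rightarrow>\<^sub>M circle"
    by (rule measurable_compose[OF _ measurable_frac_circle]) measurable
  then have "prob_space (cantor_lebesgue \<theta>)" unfolding cantor_lebesgue_def by (rule B.prob_space_distr)
  then show ?thesis by (simp add: circle_measure_def circle_measure_axioms_def cantor_lebesgue_def)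
qed

text \<open>As \<open>n\<close> is an integer, \<open>frac\<close> disappears under the character.
  The translation by 1/2 contributes a sign, and the scaling
  \<open>(\<theta> - 1) / (2 * \<theta>)\<close> times \<open>2 * pi\<close> is
  \<open>pi * (1 - 1 / \<theta>)\<close>.\<close>

lemma fourier_coeff_cantor_lebesgue:
  assumes \<theta>: "2 < \<theta>"
  shows "circle_measure.fourier_coeff (cantor_lebesgue \<theta>) n
    = of_real (cos (pi * of_int n)) * char (bernoulli_convolution \<theta>) (- (pi * ((1 - 1 / \<theta>) * of_int n)))"
proof -
  interpret B: real_distribution "bernoulli_convolution \<theta>" by (rule bernoulli_convolution[OF \<theta>])
  interpret circle_measure "cantor_lebesgue \<theta>" by (rule circle_measure_cantor_lebesgue[OF \<theta>])
  define \<phi> where "\<phi> x = (\<theta> - 1) / (2 * \<theta>) * x + 1/2" for x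
  have m: "(\<lambda>x. frac (\<phi> x)) \<in> bernoulli_convolution \<theta> \<rightarrow>\<^sub>M circle"
    unfolding \<phi>_def by (rule measurable_compose[OF _ measurable_frac_circle]) measurable
  note [measurable] = borel_measurable_id_circle
  have mc: "(\<lambda>y. cis (- 2 * pi * of_int n * y)) \<in> borel_measurable circle" unfolding cis_conv_exp by measurable
  have "fourier_coeff n = (\<integral>x. cis (- 2 * pi * of_int n * frac (\<phi> x)) \<partial>bernoulli_convolution \<theta>)"
    unfolding fourier_coeff_def unfolding cantor_lebesgue_def \<phi>_def[symmetric] by (rule integral_distr[OF m mc])
  also have "\<dots> = (\<integral>x. of_real (cos (pi * of_int n)) * iexp (- (pi * ((1 - 1 / \<theta>) * of_int n)) * x) \<partial>bernoulli_convolution \<theta>)"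
  proof (rule Bochner_Integration.integral_cong[OF refl])
    fix x
    have "cis (- 2 * pi * of_int n * frac (\<phi> x)) = cis (- 2 * pi * of_int n * \<phi> x)"
      using cis_int_frac[of "- n" "\<phi> x"] by simp
    also have "- 2 * pi * of_int n * \<phi> x = - (pi * of_int n) + - (pi * ((1 - 1 / \<theta>) * of_int n)) * x"
      using \<theta> by (simp add: \<phi>_def field_simps)
    also have "cis \<dots> = cis (- (pi * of_int n)) * iexp (- (pi * ((1 - 1 / \<theta>) * of_int n)) * x)"
      by (simp only: cis_mult[symmetric]) (simp only: cis_conv_exp)
    also have "cis (- (pi * of_int n)) = of_real (cos (pi * of_int n))"
      by (simp add: complex_eq_iff mult.commute[of pi] sin_times_pi_eq_0)
    finally show "cis (- 2 * pi * of_int n * frac (\<phi> x)) = of_real (cos (pi * of_int n)) * iexp (- (pi * ((1 - 1 / \<theta>) * of_int n)) * x)" .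
  qed
  also have "\<dots> = of_real (cos (pi * of_int n)) * char (bernoulli_convolution \<theta>) (- (pi * ((1 - 1 / \<theta>) * of_int n)))"
    by (simp add: char_def)
  finally show ?thesis .
qed

lemma fourier_coeff_cantor_lebesgue_real:
  assumes \<theta>: "2 < \<theta>"
  shows "\<exists>c::real. circle_measure.fourier_coeff (cantor_lebesgue \<theta>) n = of_real c \<and>
    (\<lambda>m. \<Prod>k<m. \<bar>cos (pi * ((1 - 1 / \<theta>) * of_int n / \<theta> ^ k))\<bar>) \<longlonglongrightarrow> \<bar>c\<bar>"
proof -
  define t where "t = - (pi * ((1 - 1 / \<theta>) * of_int n))"
  obtain l where l: "(\<lambda>m. \<Prod>k<m. cos (t / \<theta> ^ k)) \<longlonglongrightarrow> l"
    using convergent_cos_product[OF \<theta>] by (auto simp: convergent_def)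
  have "char (bernoulli_convolution \<theta>) t = of_real l"
    using LIMSEQ_unique[OF bernoulli_convolution(2)[OF \<theta>] tendsto_of_real[OF l]] .
  then have "circle_measure.fourier_coeff (cantor_lebesgue \<theta>) n = of_real (cos (pi * of_int n) * l)"
    by (simp add: fourier_coeff_cantor_lebesgue[OF \<theta>] t_def)
  moreover have "\<bar>cos (pi * of_int n) * l\<bar> = \<bar>l\<bar>"
  proof -
    have "\<bar>cos (pi * of_int n)\<bar> = 1" using abs_cos_add_of_int[of 0 n] by (simp add: abs_cos_def)
    then show ?thesis by (simp add: abs_mult)
  qed
  moreover have "(\<lambda>m. \<bar>\<Prod>k<m. cos (t / \<theta> ^ k)\<bar>) \<longlonglongrightarrow> \<bar>l\<bar>" by (rule tendsto_rabs[OF l])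
  moreover have "\<bar>\<Prod>k<m. cos (t / \<theta> ^ k)\<bar> = (\<Prod>k<m. \<bar>cos (pi * ((1 - 1 / \<theta>) * of_int n / \<theta> ^ k))\<bar>)" for m
    unfolding abs_prod t_def by (simp add: mult.assoc)
  ultimately show ?thesis by (intro exI[of _ "cos (pi * of_int n) * l"]) simp
qed

theorem corollary1p4:
  fixes \<theta> p :: real
  assumes "\<theta> > 2" and "1 < p"
  shows "countable (Lp_spectrum p (convolution_operator (cantor_lebesgue \<theta>)))"
proof -
  interpret dissection_ratio \<theta> by unfold_locales (rule assms(1))
  interpret circle_measure "cantor_lebesgue \<theta>" by (rule circle_measure_cantor_lebesgue[OF assms(1)])
  obtain c :: "int \<Rightarrow> real" where c: "\<And>n. fourier_coeff n = of_real (c n)"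
    and lim: "\<And>n. (\<lambda>m. \<Prod>k<m. \<bar>cos (pi * ((1 - 1 / \<theta>) * of_int n / \<theta> ^ k))\<bar>) \<longlonglongrightarrow> \<bar>c n\<bar>"
    using fourier_coeff_cantor_lebesgue_real[OF assms(1)] by metis
  have eq: "\<bar>c n\<bar> = cos_product ((1 - 1 / \<theta>) * of_int n)" for n
    using LIMSEQ_unique[OF lim[of n] cos_product_LIMSEQ[of "(1 - 1 / \<theta>) * of_int n", unfolded abs_cos_def]] .
  have sub: "closure (range c) \<subseteq> {- 1..1}"
  proof (rule closure_minimal)
    show "range c \<subseteq> {- 1..1}"
    proof
      fix x assume "x \<in> range c"
      then obtain n where "x = c n" by blast
      then have "\<bar>x\<bar> \<le> 1" using cos_product_bounds(2) by (simp add: eq)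
      then show "x \<in> {- 1..1}" by (simp add: abs_le_iff)
    qed
  qed simp
  \<comment> \<open>The coefficients are real, so the closure is taken in the reals and then
    embedded; it lies in [-1, 1], which yields compactness and the inclusion in the unit
    ball.\<close>
  define K where "K = complex_of_real ` closure (range c)"
  have "compact (closure (range c))"
    using sub bounded_subset[OF bounded_closed_interval] by (simp add: compact_eq_bounded_closed)
  then have "compact K" unfolding K_def by (intro compact_continuous_image continuous_intros)
  moreover have cK: "countable K" unfolding K_def by (intro countable_image countable_closure_cos_product eq)
  moreover have "K \<subseteq> cball 0 1"
  proof
    fix w assume "w \<in> K"
    then obtain x where "x \<in> closure (range c)" "w = of_real x" by (auto simp: K_def)
    then show "w \<in> cball 0 1" using sub by (auto simp: abs_le_iff)
  qed
  moreover have "range fourier_coeff \<subseteq> K"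
  proof
    fix w assume "w \<in> range fourier_coeff"
    then obtain n where "w = of_real (c n)" by (auto simp: c)
    then show "w \<in> K" using closure_subset[of "range c"] by (auto simp: K_def)
  qed
  ultimately have "Lp_spectrum p T \<subseteq> K" by (rule Lp_spectrum_subset[OF _ _ _ _ assms(2)])
  then show ?thesis using cK by (rule countable_subset)
qed

end
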